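(* There exist a compact metrizable space $X$, a normal uniform algebra $A$ on $X$, and a point $x\in X$ that is a peak point for $A$, such that $A$ is not strongly regular at $x$. In fact, $A$ can be taken to be $R(K)$ (with $X=K$) for a certain compact set $K$ in the complex plane $\mathbb{C}$.
   Context: All spaces are Hausdorff. For $X$ compact, $C(X)$ is the algebra of continuous complex-valued functions on $X$ with the supremum norm. A uniform algebra on $X$ is a closed subalgebra of $C(X)$ that contains the constants and separates the points of $X$. A uniform algebra $A$ on $X$ is natural if its maximal ideal space is $X$ (identifying points with evaluation functionals). $A$ is normal on $X$ if for each pair of disjoint closed sets $K_0,K_1\subset X$ there is $f\in A$ with $f=1$ on $K_1$ and $f=0$ on $K_0$; $A$ is normal if it is natural and normal on $X$. For $x\in X$, $M_x=\{f\in A: f(x)=0\}$ and $J_x=\{f\in A: f^{-1}(0)\text{ contains a neighborhood of }x\text{ in }X\}$. $A$ is strongly regular at $x$ if $\overline{J_x}=M_x$. The point $x$ is a peak point for $A$ if there is $f\in A$ with $f(x)=1$ and $|f(y)|<1$ for every $y\in X\setminus\{x\}$. For $K\subset\mathbb{C}$ compact, $R(K)$ is the uniform closure in $C(K)$ of the rational functions with poles off $K$. *)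

theory Defs
  imports "HOL-Analysis.Analysis" "HOL-Computational_Algebra.Polynomial"
begin

text \<open>Complex functions on a space \<open>X\<close> are extensional (equal to \<open>undefined\<close> off \<open>topspace X\<close>),
  so that they are determined by their values on \<open>X\<close>.  For compact \<open>X\<close>, the library's metric
  \<open>cfunspace X euclidean_metric\<close> consists of exactly the continuous functions and its distance is
  the supremum of \<open>dist (f x) (g x)\<close> over \<open>topspace X\<close>, i.e. the distance of the supremum norm.\<close>

abbreviation cont_metric :: "'a topology \<Rightarrow> ('a \<Rightarrow> complex) metric" where
  "cont_metric X \<equiv> cfunspace X euclidean_metric"

abbreviation cont_space :: "'a topology \<Rightarrow> ('a \<Rightarrow> complex) set" where
  "cont_space X \<equiv> mspace (cont_metric X)"

abbreviation sup_topology :: "'a topology \<Rightarrow> ('a \<Rightarrow> complex) topology" where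
  "sup_topology X \<equiv> mtopology_of (cont_metric X)"

definition fun_const :: "'a topology \<Rightarrow> complex \<Rightarrow> 'a \<Rightarrow> complex" where
  "fun_const X c = (\<lambda>x\<in>topspace X. c)"

definition fun_scale :: "'a topology \<Rightarrow> complex \<Rightarrow> ('a \<Rightarrow> complex) \<Rightarrow> 'a \<Rightarrow> complex" where
  "fun_scale X c f = (\<lambda>x\<in>topspace X. c * f x)"

definition fun_add :: "'a topology \<Rightarrow> ('a \<Rightarrow> complex) \<Rightarrow> ('a \<Rightarrow> complex) \<Rightarrow> 'a \<Rightarrow> complex" where
  "fun_add X f g = (\<lambda>x\<in>topspace X. f x + g x)"

definition fun_mult :: "'a topology \<Rightarrow> ('a \<Rightarrow> complex) \<Rightarrow> ('a \<Rightarrow> complex) \<Rightarrow> 'a \<Rightarrow> complex" where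
  "fun_mult X f g = (\<lambda>x\<in>topspace X. f x * g x)"

definition uniform_algebra :: "'a topology \<Rightarrow> ('a \<Rightarrow> complex) set \<Rightarrow> bool" where
  "uniform_algebra X A \<longleftrightarrow>
     compact_space X \<and> Hausdorff_space X \<and>
     A \<subseteq> cont_space X \<and>
     closedin (sup_topology X) A \<and>
     (\<forall>c. fun_const X c \<in> A) \<and>
     (\<forall>f\<in>A. \<forall>c. fun_scale X c f \<in> A) \<and>
     (\<forall>f\<in>A. \<forall>g\<in>A. fun_add X f g \<in> A \<and> fun_mult X f g \<in> A) \<and>
     (\<forall>x\<in>topspace X. \<forall>y\<in>topspace X. x \<noteq> y \<longrightarrow> (\<exists>f\<in>A. f x \<noteq> f y))"

text \<open>The maximal ideal space of \<open>A\<close>: the nonzero complex homomorphisms of \<open>A\<close> (extensional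
  on \<open>A\<close>), with the Gelfand topology, i.e. the topology of pointwise convergence on \<open>A\<close>.\<close>

definition complex_homs :: "'a topology \<Rightarrow> ('a \<Rightarrow> complex) set \<Rightarrow> (('a \<Rightarrow> complex) \<Rightarrow> complex) set" where
  "complex_homs X A =
     {\<phi> \<in> extensional A.
        (\<forall>f\<in>A. \<forall>c. \<phi> (fun_scale X c f) = c * \<phi> f) \<and>
        (\<forall>f\<in>A. \<forall>g\<in>A. \<phi> (fun_add X f g) = \<phi> f + \<phi> g \<and> \<phi> (fun_mult X f g) = \<phi> f * \<phi> g) \<and>
        (\<exists>f\<in>A. \<phi> f \<noteq> 0)}"

definition maximal_ideal_space ::
  "'a topology \<Rightarrow> ('a \<Rightarrow> complex) set \<Rightarrow> (('a \<Rightarrow> complex) \<Rightarrow> complex) topology" where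
  "maximal_ideal_space X A =
     subtopology (product_topology (\<lambda>_. euclidean) A) (complex_homs X A)"

definition point_eval :: "('a \<Rightarrow> complex) set \<Rightarrow> 'a \<Rightarrow> ('a \<Rightarrow> complex) \<Rightarrow> complex" where
  "point_eval A x = (\<lambda>f\<in>A. f x)"

definition natural_algebra :: "'a topology \<Rightarrow> ('a \<Rightarrow> complex) set \<Rightarrow> bool" where
  "natural_algebra X A \<longleftrightarrow> homeomorphic_map X (maximal_ideal_space X A) (point_eval A)"

definition normal_on :: "'a topology \<Rightarrow> ('a \<Rightarrow> complex) set \<Rightarrow> bool" where
  "normal_on X A \<longleftrightarrow>
     (\<forall>K0 K1. closedin X K0 \<and> closedin X K1 \<and> disjnt K0 K1 \<longrightarrow>
        (\<exists>f\<in>A. (\<forall>x\<in>K1. f x = 1) \<and> (\<forall>x\<in>K0. f x = 0)))"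

definition normal_uniform_algebra :: "'a topology \<Rightarrow> ('a \<Rightarrow> complex) set \<Rightarrow> bool" where
  "normal_uniform_algebra X A \<longleftrightarrow> uniform_algebra X A \<and> natural_algebra X A \<and> normal_on X A"

definition ideal_M :: "('a \<Rightarrow> complex) set \<Rightarrow> 'a \<Rightarrow> ('a \<Rightarrow> complex) set" where
  "ideal_M A x = {f \<in> A. f x = 0}"

definition ideal_J :: "'a topology \<Rightarrow> ('a \<Rightarrow> complex) set \<Rightarrow> 'a \<Rightarrow> ('a \<Rightarrow> complex) set" where
  "ideal_J X A x = {f \<in> A. \<exists>U. openin X U \<and> x \<in> U \<and> (\<forall>y\<in>U. f y = 0)}"

definition strongly_regular_at :: "'a topology \<Rightarrow> ('a \<Rightarrow> complex) set \<Rightarrow> 'a \<Rightarrow> bool" where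
  "strongly_regular_at X A x \<longleftrightarrow> sup_topology X closure_of ideal_J X A x = ideal_M A x"

definition peak_point :: "'a topology \<Rightarrow> ('a \<Rightarrow> complex) set \<Rightarrow> 'a \<Rightarrow> bool" where
  "peak_point X A x \<longleftrightarrow>
     x \<in> topspace X \<and> (\<exists>f\<in>A. f x = 1 \<and> (\<forall>y\<in>topspace X - {x}. cmod (f y) < 1))"

definition rational_functions :: "complex set \<Rightarrow> (complex \<Rightarrow> complex) set" where
  "rational_functions K =
     {(\<lambda>z\<in>K. poly p z / poly q z) | p q. \<forall>z\<in>K. poly q z \<noteq> 0}"

definition R_algebra :: "complex set \<Rightarrow> (complex \<Rightarrow> complex) set" where
  "R_algebra K = sup_topology (top_of_set K) closure_of rational_functions K"

end

theory Submission
  imports Defs "HOL-Complex_Analysis.Complex_Analysis"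
begin

text \<open>\<open>K\<close> is the disc \<open>\<bar>z - 1/2\<bar> \<le> 1/2\<close>, that is \<open>Re (1 / z) \<ge> 1\<close>, minus a countable family of small open
  discs (holes) that are extremely small near 0. The function \<open>1 - z\<close> peaks at 0.

  Normality: for each annulus from a countable dense family of annuli that avoid 0, there are holes inside it and a uniform
  limit of rational functions, with poles in the holes, that is 1 inside and 0 outside the annulus. A product of
  functions \<open>1 - f\<close> then separates any two disjoint closed sets, without an appeal to Gelfand theory.

  Failure of strong regularity: \<open>exp (1 / z)\<close> is unbounded near 0 in the interior of the disc, but bounded on
  each circle \<open>Re (1 / z) = t\<close>. If \<open>g\<close> vanishes near 0 then \<open>g * exp (1 / z)\<close> belongs to \<open>R(K)\<close>, so its integral over
  such a circle, minus the integrals around the holes inside it, is 0. For \<open>z * exp (1 / z)\<close> the same difference is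
  \<open>\<pi> * \<i>\<close>. Since the holes are small, this difference is controlled by the sup norm distance from \<open>g\<close> to the
  function \<open>z\<close> on \<open>K\<close>, which is therefore bounded below.\<close>

subsection \<open>Functions that are 1 inside and 0 outside an annulus\<close>

text \<open>The obstacle is that a circle \<open>Re (1 / z) = t\<close> may meet infinitely many
  holes, so contour integrals cannot be kept inside K. The error estimate is therefore first
  extended from K to an open set G, and compactness leaves finitely many relevant holes. In the
  coordinate w = 1 / z the circles become vertical lines and these holes lie in discs of total
  radius at most 1/8, so they can be merged into discs with disjoint closures that some line with 1
  < t < 2 misses. The quantity to control under merging is the radius times exp (Re centre), because
  it bounds the error integral of exp (1 / z) around a disc; "extremely small near 0" means that the
  sum of such weights is at most 1/8. At distance at least d from 0 the weight is at most a
  constant, depending on d, times the radius of the hole, which is why the annuli must avoid 0. The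
  constant 1/20 balances the budget: an error of that size costs at most 9 pi / 20 on the tangent
  circle and pi / 20 on all inner circles, together only half of the pi to be accounted for.\<close>

lemma norm_one_minus_power_ge:
  fixes w :: complex
  assumes N: "N > 0" and d: "\<And>\<zeta>. \<zeta> ^ N = 1 \<Longrightarrow> d \<le> cmod (w - \<zeta>)"
  shows "min (1/2) (real N * d / 8) \<le> cmod (1 - w ^ N)"
proof (rule ccontr)
  assume "\<not> ?thesis"
  then have small: "cmod (1 - w ^ N) < 1/2" and lt: "cmod (1 - w ^ N) < real N * d / 8"
    by auto
  define v where "v = w ^ N - 1"
  define u where "u = Ln (1 + v)"
  have v: "cmod v < 1/2" using small by (simp add: v_def norm_minus_commute)
  then have nz: "1 + v \<noteq> 0"
    by (auto simp: add_eq_0_iff)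
  have u: "exp u = w ^ N" unfolding u_def using nz by (simp add: v_def)
  have unorm: "cmod u \<le> 2 * cmod v" unfolding u_def by (rule norm_Ln_le) (use v in simp)
  \<comment> \<open>\<open>exp (u / N)\<close> is an N-th root of \<open>w ^ N\<close> close to 1;
    dividing by it moves w to a genuine root of unity at distance of order
    \<open>|1 - w ^ N| / N\<close>. The bounds 2 for \<open>Ln\<close> and 3 for \<open>exp\<close>
    give the factor 6, within the 8 of the claim.\<close>
  define \<zeta> where "\<zeta> = w * exp (- (u / of_nat N))"
  have "\<zeta> ^ N = w ^ N * exp (of_nat N * (- (u / of_nat N)))"
    by (simp only: \<zeta>_def power_mult_distrib exp_of_nat_mult)
  also have "\<dots> = 1" using N by (simp add: u[symmetric] exp_minus)
  finally have z1: "\<zeta> ^ N = 1" .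
  have zn: "cmod \<zeta> = 1"
  proof (rule power_eq_imp_eq_base)
    show "cmod \<zeta> ^ N = 1 ^ N" using arg_cong[OF z1, of cmod] by (simp add: norm_power)
  qed (use N in auto)
  have w: "w = \<zeta> * exp (u / of_nat N)"
    by (simp add: \<zeta>_def exp_minus)
  have uN: "cmod (u / of_nat N) \<le> 1"
  proof -
    have "cmod (u / of_nat N) \<le> cmod u" using N by (simp add: norm_divide divide_le_eq mult_le_cancel_left1)
    then show ?thesis using unorm v by linarith
  qed
  have "cmod (exp (u / of_nat N) - (\<Sum>k\<le>0. (u / of_nat N) ^ k / fact k))
      \<le> exp \<bar>Re (u / of_nat N)\<bar> * cmod (u / of_nat N) ^ Suc 0 / fact 0"
    by (rule Taylor_exp)
  then have "cmod (exp (u / of_nat N) - 1) \<le> exp \<bar>Re (u / of_nat N)\<bar> * cmod (u / of_nat N)"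
    by simp
  also have "\<dots> \<le> 3 * cmod (u / of_nat N)"
  proof (rule mult_right_mono)
    have "\<bar>Re (u / of_nat N)\<bar> \<le> 1" using uN abs_Re_le_cmod order_trans by blast
    then have "exp \<bar>Re (u / of_nat N)\<bar> \<le> exp 1" by simp
    then show "exp \<bar>Re (u / of_nat N)\<bar> \<le> 3" using exp_le by linarith
  qed simp
  finally have expb: "cmod (exp (u / of_nat N) - 1) \<le> 3 * cmod (u / of_nat N)" .
  have "d \<le> cmod (w - \<zeta>)" using d z1 by blast
  also have "\<dots> = cmod (exp (u / of_nat N) - 1)"
    using zn by (metis norm_mult w mult.right_neutral right_diff_distrib mult_1)
  also have "\<dots> \<le> 3 * cmod (u / of_nat N)" by (rule expb)
  also have "\<dots> = 3 * cmod u / N" by (simp add: norm_divide)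
  also have "\<dots> \<le> 6 * cmod v / N" using unorm by (intro divide_right_mono) auto
  finally have "N * d \<le> 6 * cmod v" using N by (simp add: field_simps)
  moreover have "cmod (1 - w ^ N) = cmod v" by (simp add: v_def norm_minus_commute)
  ultimately show False using lt norm_ge_zero[of v] by linarith
qed


text \<open>Not extensional, unlike \<open>rational_functions\<close>, so that plain lambda terms
  and unbounded sets such as \<open>- holes H\<close> are covered.\<close>

definition rational_on :: "complex set \<Rightarrow> (complex \<Rightarrow> complex) \<Rightarrow> bool" where
  "rational_on S f \<longleftrightarrow> (\<exists>p q. \<forall>z\<in>S. poly q z \<noteq> 0 \<and> f z = poly p z / poly q z)"

lemma rational_onI: "(\<And>z. z \<in> S \<Longrightarrow> poly q z \<noteq> 0 \<and> f z = poly p z / poly q z) \<Longrightarrow> rational_on S f"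
  unfolding rational_on_def by blast

lemma rational_on_subset: "rational_on S f \<Longrightarrow> T \<subseteq> S \<Longrightarrow> rational_on T f"
  unfolding rational_on_def by blast

lemma rational_on_const: "rational_on S (\<lambda>z. c)"
  by (rule rational_onI[where p = "[:c:]" and q = 1]) simp

lemma rational_on_ident: "rational_on S (\<lambda>z. z)"
  by (rule rational_onI[where p = "[:0, 1:]" and q = 1]) simp

lemma rational_on_add:
  assumes "rational_on S f" "rational_on S g"
  shows "rational_on S (\<lambda>z. f z + g z)"
proof -
  from assms obtain p q p' q' where "\<forall>z\<in>S. poly q z \<noteq> 0 \<and> f z = poly p z / poly q z"
    "\<forall>z\<in>S. poly q' z \<noteq> 0 \<and> g z = poly p' z / poly q' z"
    unfolding rational_on_def by blast
  then show ?thesis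
    by (intro rational_onI[where p = "p * q' + p' * q" and q = "q * q'"]) (auto simp: add_frac_eq)
qed

lemma rational_on_mult:
  assumes "rational_on S f" "rational_on S g"
  shows "rational_on S (\<lambda>z. f z * g z)"
proof -
  from assms obtain p q p' q' where "\<forall>z\<in>S. poly q z \<noteq> 0 \<and> f z = poly p z / poly q z"
    "\<forall>z\<in>S. poly q' z \<noteq> 0 \<and> g z = poly p' z / poly q' z"
    unfolding rational_on_def by blast
  then show ?thesis
    by (intro rational_onI[where p = "p * p'" and q = "q * q'"]) auto
qed

lemma rational_on_inverse:
  assumes "rational_on S f" "\<And>z. z \<in> S \<Longrightarrow> f z \<noteq> 0"
  shows "rational_on S (\<lambda>z. inverse (f z))"
proof -
  from assms obtain p q where pq: "\<forall>z\<in>S. poly q z \<noteq> 0 \<and> f z = poly p z / poly q z"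
    unfolding rational_on_def by blast
  show ?thesis
    by (rule rational_onI[where p = q and q = p]) (use pq assms(2) in auto)
qed

lemma rational_on_diff:
  assumes "rational_on S f" "rational_on S g"
  shows "rational_on S (\<lambda>z. f z - g z)"
  using rational_on_add[OF assms(1) rational_on_mult[OF rational_on_const[of S "-1"] assms(2)]]
  by simp

lemma rational_on_power: "rational_on S f \<Longrightarrow> rational_on S (\<lambda>z. f z ^ n)"
  by (induction n) (auto intro: rational_on_const rational_on_mult)

abbreviation hole :: "complex \<times> real \<Rightarrow> complex set" where
  "hole h \<equiv> ball (fst h) (snd h)"

abbreviation holes :: "(complex \<times> real) set \<Rightarrow> complex set" where
  "holes H \<equiv> (\<Union>h\<in>H. hole h)"

text \<open>The witness \<open>1 / (1 - w ^ N)\<close> with \<open>w = (z - c) / s\<close> has its N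
  poles evenly spaced on the circle of radius s, each inside a hole of radius
  \<open>\<eta> / N\<close>. Off the holes \<open>norm_one_minus_power_ge\<close> bounds it in terms
  of \<open>R / \<eta>\<close> alone, so N can grow and make \<kappa> arbitrarily small at no cost
  in total radius or in sup norm. The later iteration rests on this.\<close>

lemma annular_step:
  fixes c :: complex
  assumes r: "0 < r" "r < s" "s < R" and \<eta>: "\<eta> > 0" and \<kappa>: "\<kappa> > 0"
  obtains a H where "finite H" "\<And>h. h \<in> H \<Longrightarrow> snd h > 0 \<and> hole h \<subseteq> {z. r < cmod (z - c) \<and> cmod (z - c) < R}"
    "sum snd H \<le> \<eta>" "rational_on (- holes H) a"
    "\<And>z. R \<le> cmod (z - c) \<Longrightarrow> cmod (a z) \<le> \<kappa>"
    "\<And>z. cmod (z - c) \<le> r \<Longrightarrow> cmod (1 - a z) \<le> \<kappa>"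
    "\<And>z. z \<notin> holes H \<Longrightarrow> cmod (a z) \<le> 2 + 8 * R / \<eta>"
proof -
  \<comment> \<open>Halved because \<open>|w ^ N| \<le> \<kappa>' \<le> 1/2\<close> only yields
    \<open>|1 - w ^ N| \<ge> 1/2\<close>, hence an error \<open>2 * \<kappa>'\<close>.\<close>
  define \<kappa>' where "\<kappa>' = min \<kappa> 1 / 2"
  have \<kappa>': "0 < \<kappa>'" "\<kappa>' \<le> 1/2" "2 * \<kappa>' \<le> \<kappa>" using \<kappa> by (auto simp: \<kappa>'_def)
  have "(\<lambda>n. (r/s)^n) \<longlonglongrightarrow> 0" using r by (intro LIMSEQ_realpow_zero) auto
  then have e1: "\<forall>\<^sub>F n in sequentially. (r/s)^n < \<kappa>'"
    using \<kappa>'(1) by (rule order_tendstoD)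
  have "(\<lambda>n. (s/R)^n) \<longlonglongrightarrow> 0" using r by (intro LIMSEQ_realpow_zero) auto
  then have e2: "\<forall>\<^sub>F n in sequentially. (s/R)^n < \<kappa>'"
    using \<kappa>'(1) by (rule order_tendstoD)
  have "(\<lambda>n. \<eta> / real n) \<longlonglongrightarrow> 0" by (rule lim_const_over_n)
  then have e3: "\<forall>\<^sub>F n in sequentially. \<eta> / real n < min (s - r) (R - s)"
    by (rule order_tendstoD) (use r in auto)
  have "\<forall>\<^sub>F n in sequentially. n > 0 \<and> (r/s)^n < \<kappa>' \<and> (s/R)^n < \<kappa>' \<and> \<eta> / real n < min (s - r) (R - s)"
    using eventually_gt_at_top[of "0::nat"] e1 e2 e3 by eventually_elim blast
  then obtain N where N: "N > 0" "(r/s)^N < \<kappa>'" "(s/R)^N < \<kappa>'" "\<eta> / N < s - r" "\<eta> / N < R - s"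
    by (auto dest!: eventually_happens'[OF sequentially_bot])
  define Z where "Z = {\<zeta>::complex. \<zeta> ^ N = 1}"
  have Z: "finite Z" "card Z = N"
    using N(1) by (auto simp: Z_def card_roots_unity_eq intro: finite_roots_unity)
  define H where "H = (\<lambda>\<zeta>. (c + of_real s * \<zeta>, \<eta> / N)) ` Z"
  define w where "w = (\<lambda>z. (z - c) / of_real s)"
  define a where "a = (\<lambda>z. inverse (1 - w z ^ N))"
  have s: "s > 0" "R > 0" using r by auto
  have cw: "cmod (w z) = cmod (z - c) / s" for z using s by (simp add: w_def norm_divide)
  have unit: "cmod \<zeta> = 1" if "\<zeta> \<in> Z" for \<zeta>
  proof (rule power_eq_imp_eq_base)
    have "\<zeta> ^ N = 1" using that by (simp add: Z_def)
    from arg_cong[OF this, of cmod] show "cmod \<zeta> ^ N = 1 ^ N" by (simp add: norm_power)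
  qed (use N in auto)
  have lower: "inverse (2 + 8 * R / \<eta>) \<le> cmod (1 - w z ^ N)" if z: "z \<notin> holes H" for z
  proof -
    have "\<eta> / N / s \<le> cmod (w z - \<zeta>)" if "\<zeta> ^ N = 1" for \<zeta>
    proof -
      have "z \<notin> ball (c + of_real s * \<zeta>) (\<eta> / N)" using z that by (auto simp: H_def Z_def)
      then have "\<eta> / N \<le> cmod (z - (c + of_real s * \<zeta>))" by (simp add: dist_norm norm_minus_commute)
      also have "z - (c + of_real s * \<zeta>) = of_real s * (w z - \<zeta>)" using s by (simp add: w_def field_simps)
      also have "cmod \<dots> = s * cmod (w z - \<zeta>)" using s by (simp add: norm_mult)
      finally show ?thesis using s by (simp add: pos_divide_le_eq[OF s(1)] mult.commute del: divide_divide_eq_left)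
    qed
    then have *: "min (1/2) (real N * (\<eta> / N / s) / 8) \<le> cmod (1 - w z ^ N)"
      by (rule norm_one_minus_power_ge[OF N(1)])
    have "inverse (2 + 8 * R / \<eta>) \<le> inverse 2"
      using \<eta> s by (intro le_imp_inverse_le) auto
    moreover have "inverse (2 + 8 * R / \<eta>) \<le> inverse (8 * s / \<eta>)"
    proof (rule le_imp_inverse_le)
      have "8 * s / \<eta> \<le> 8 * R / \<eta>" using r \<eta> by (simp add: divide_right_mono)
      then show "8 * s / \<eta> \<le> 2 + 8 * R / \<eta>" by simp
    qed (use \<eta> s in simp)
    moreover have "inverse (8 * s / \<eta>) = real N * (\<eta> / N / s) / 8"
      using N \<eta> s by (simp add: field_simps)
    ultimately show ?thesis using * by (simp add: inverse_eq_divide)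
  qed
  have pos: "inverse (2 + 8 * R / \<eta>) > 0" using \<eta> s by (simp add: add_pos_pos)
  have "rational_on (- holes H) (\<lambda>z. 1 - w z ^ N)"
    unfolding w_def divide_inverse
    by (intro rational_on_diff rational_on_const rational_on_power rational_on_mult rational_on_ident)
  then have rat: "rational_on (- holes H) a"
    unfolding a_def
  proof (rule rational_on_inverse)
    fix z assume "z \<in> - holes H"
    then show "1 - w z ^ N \<noteq> 0" using lower[of z] pos by auto
  qed
  show ?thesis
  proof
    show "finite H" using Z by (simp add: H_def)
    show "rational_on (- holes H) a" by (rule rat)
    have "sum snd H \<le> (\<Sum>\<zeta>\<in>Z. snd (c + of_real s * \<zeta>, \<eta> / N))"
      unfolding H_def using Z \<eta> by (intro sum_image_le[THEN order_trans]) auto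
    also have "\<dots> = \<eta>" using Z N by simp
    finally show "sum snd H \<le> \<eta>" .
    show "snd h > 0 \<and> hole h \<subseteq> {z. r < cmod (z - c) \<and> cmod (z - c) < R}" if "h \<in> H" for h
    proof -
      from that obtain \<zeta> where \<zeta>: "\<zeta> \<in> Z" "h = (c + of_real s * \<zeta>, \<eta> / N)" by (auto simp: H_def)
      have n: "cmod (of_real s * \<zeta>) = s" using unit[OF \<zeta>(1)] s by (simp add: norm_mult)
      have "r < cmod (z - c) \<and> cmod (z - c) < R" if "z \<in> hole h" for z
      proof -
        have d: "cmod (z - c - of_real s * \<zeta>) < \<eta> / N"
          using that \<zeta>(2) by (simp add: dist_norm norm_minus_commute algebra_simps)
        then show ?thesis
          using norm_triangle_ineq3[of "z - c" "of_real s * \<zeta>"] n N(4,5) by (auto simp: abs_le_iff)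
      qed
      then show ?thesis using \<zeta> N \<eta> by auto
    qed
    show "cmod (a z) \<le> \<kappa>" if "R \<le> cmod (z - c)" for z
    proof -
      have "(R / s) ^ N \<le> cmod (w z) ^ N"
        using that s by (intro power_mono) (auto simp: cw divide_right_mono)
      moreover have "(R / s) ^ N > inverse \<kappa>'"
        using N(3) \<kappa>' s by (simp add: power_divide field_simps)
      moreover have "inverse \<kappa>' \<ge> 2" using \<kappa>' by (simp add: field_simps)
      ultimately have "cmod (1 - w z ^ N) \<ge> inverse \<kappa>' - 1"
        using norm_triangle_ineq2[of "w z ^ N" 1] by (simp add: norm_power norm_minus_commute)
      moreover have "inverse \<kappa>' - 1 \<ge> inverse (2 * \<kappa>')"
        using \<kappa>' by (simp add: field_simps)
      ultimately have "inverse (2 * \<kappa>') \<le> cmod (1 - w z ^ N)" by linarith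
      then have "cmod (a z) \<le> 2 * \<kappa>'"
        unfolding a_def norm_inverse using \<kappa>'
        by (metis inverse_inverse_eq le_imp_inverse_le inverse_positive_iff_positive mult_pos_pos zero_less_numeral)
      then show ?thesis using \<kappa>' by linarith
    qed
    show "cmod (1 - a z) \<le> \<kappa>" if "cmod (z - c) \<le> r" for z
    proof -
      have "cmod (w z) ^ N \<le> (r / s) ^ N"
        using that s by (intro power_mono) (auto simp: cw divide_right_mono)
      then have le: "cmod (w z ^ N) \<le> \<kappa>'" using N(2) by (simp add: norm_power)
      then have ge: "cmod (1 - w z ^ N) \<ge> 1/2"
        using norm_triangle_ineq2[of 1 "w z ^ N"] \<kappa>' by simp
      then have "1 - w z ^ N \<noteq> 0" by auto
      then have "1 - a z = - (w z ^ N / (1 - w z ^ N))" by (simp add: a_def field_simps)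
      then have "cmod (1 - a z) = cmod (w z ^ N) / cmod (1 - w z ^ N)" by (simp add: norm_divide)
      also have "\<dots> \<le> \<kappa>' / (1/2)" using le ge \<kappa>' by (intro frac_le) auto
      finally show ?thesis using \<kappa>' by simp
    qed
    show "cmod (a z) \<le> 2 + 8 * R / \<eta>" if "z \<notin> holes H" for z
      unfolding a_def norm_inverse using le_imp_inverse_le[OF lower[OF that] pos] by simp
  qed
qed

text \<open>One of the coefficients f and 1 - f has modulus at most 1; as they sum to 1, the other
  has modulus at most 2. Hence the factor 3.\<close>

lemma mix_bounds:
  fixes f a b :: complex
  defines "g \<equiv> f * a + (1 - f) * b"
  assumes \<kappa>: "0 \<le> \<kappa>"
  shows "cmod f \<le> 1 \<Longrightarrow> cmod a \<le> \<kappa> \<Longrightarrow> cmod b \<le> \<kappa> \<Longrightarrow> cmod g \<le> 3 * \<kappa>"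
    and "cmod (1 - f) \<le> 1 \<Longrightarrow> cmod (1 - a) \<le> \<kappa> \<Longrightarrow> cmod (1 - b) \<le> \<kappa> \<Longrightarrow> cmod (1 - g) \<le> 3 * \<kappa>"
proof -
  assume *: "cmod f \<le> 1" "cmod a \<le> \<kappa>" "cmod b \<le> \<kappa>"
  have "cmod (1 - f) \<le> 2" using norm_triangle_ineq4[of 1 f] *(1) by simp
  then have "cmod (f * a) \<le> 1 * \<kappa>" "cmod ((1 - f) * b) \<le> 2 * \<kappa>"
    unfolding norm_mult using * \<kappa> mult_mono[of "cmod f" 1 "cmod a" \<kappa>] mult_mono[of "cmod (1 - f)" 2 "cmod b" \<kappa>] by auto
  then show "cmod g \<le> 3 * \<kappa>" unfolding g_def using norm_triangle_ineq[of "f * a" "(1 - f) * b"] by linarith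
next
  assume *: "cmod (1 - f) \<le> 1" "cmod (1 - a) \<le> \<kappa>" "cmod (1 - b) \<le> \<kappa>"
  have "cmod f \<le> 2" using norm_triangle_ineq4[of 1 "1 - f"] *(1) by simp
  then have "cmod (f * (1 - a)) \<le> 2 * \<kappa>" "cmod ((1 - f) * (1 - b)) \<le> 1 * \<kappa>"
    unfolding norm_mult
    using * \<kappa> mult_mono[of "cmod f" 2 "cmod (1 - a)" \<kappa>] mult_mono[of "cmod (1 - f)" 1 "cmod (1 - b)" \<kappa>] by auto
  moreover have "1 - g = f * (1 - a) + (1 - f) * (1 - b)" by (simp add: g_def algebra_simps)
  ultimately show "cmod (1 - g) \<le> 3 * \<kappa>"
    using norm_triangle_ineq[of "f * (1 - a)" "(1 - f) * (1 - b)"] by simp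
qed

text \<open>The witness is the mixture of \<open>f\<close> with a step \<open>a\<close> farther out and a step \<open>b\<close> farther in. It stays
  close to \<open>f\<close>, because each step is large or far from constant only where \<open>f\<close> or \<open>1 - f\<close> is
  already tiny, and it is much closer to 1 and 0 on slightly smaller regions.\<close>

lemma annular_improve:
  fixes c :: complex and f :: "complex \<Rightarrow> complex"
  assumes r: "0 < r" "r < r1" "r1 < R1" "R1 < R" and \<eta>: "\<eta> > 0" and \<gamma>: "\<gamma> > 0" and \<epsilon>': "\<epsilon>' > 0"
    and H: "finite H" and rat: "rational_on (- holes H) f"
    and out: "\<And>z. R1 \<le> cmod (z - c) \<Longrightarrow> cmod (f z) \<le> \<epsilon>"
    and inn: "\<And>z. cmod (z - c) \<le> r1 \<Longrightarrow> cmod (1 - f z) \<le> \<epsilon>"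
    and \<epsilon>: "\<epsilon> \<le> 1" "\<epsilon> * (3 + 16 * R / \<eta>) \<le> \<gamma> / 2"
    and M: "\<And>z. z \<notin> holes H \<Longrightarrow> cmod (f z) \<le> M"
  obtains g H' r2 R2 where "r < r2" "r2 < r1" "R1 < R2" "R2 < R" "finite H'" "H \<subseteq> H'"
    "\<And>h. h \<in> H' - H \<Longrightarrow> snd h > 0 \<and> hole h \<subseteq> {z. r < cmod (z - c) \<and> cmod (z - c) < R}"
    "sum snd (H' - H) \<le> \<eta>" "rational_on (- holes H') g"
    "\<And>z. R2 \<le> cmod (z - c) \<Longrightarrow> cmod (g z) \<le> \<epsilon>'"
    "\<And>z. cmod (z - c) \<le> r2 \<Longrightarrow> cmod (1 - g z) \<le> \<epsilon>'"
    "\<And>z. z \<notin> holes H' \<Longrightarrow> cmod (g z - f z) \<le> \<gamma>"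
proof -
  \<comment> \<open>Bounds both steps off their holes, each being given the budget
    \<open>\<eta> / 2\<close>. It does not depend on \<kappa>, so \<epsilon> can be fixed against B
    before \<kappa> is chosen.\<close>
  define B where "B = 2 + 16 * R / \<eta>"
  have B: "B \<ge> 2" using r \<eta> by (simp add: B_def)
  define M' where "M' = max M 0"
  \<comment> \<open>\<open>\<gamma> / 4\<close> serves where a factor f or 1 - f of modulus at most
    2 multiplies \<kappa>, \<open>\<gamma> / (2 * M' + 1)\<close> the middle annulus, where f is
    only known to be bounded, and \<open>\<epsilon>' / 3\<close> the factor 3 of
    \<open>mix_bounds\<close>.\<close>
  define \<kappa> where "\<kappa> = Min {\<gamma> / 4, \<gamma> / (2 * M' + 1), \<epsilon>' / 3}"
  have M': "M' \<ge> 0" "M \<le> M'" by (auto simp: M'_def)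
  have \<kappa>: "\<kappa> \<le> \<gamma> / 4" "\<kappa> \<le> \<gamma> / (2 * M' + 1)" "\<kappa> \<le> \<epsilon>' / 3"
    unfolding \<kappa>_def by (rule Min_le; simp)+
  have \<kappa>0: "\<kappa> > 0" using \<gamma> \<epsilon>' M' by (auto simp: \<kappa>_def)
  have \<epsilon>0: "0 \<le> \<epsilon>" using order_trans[OF norm_ge_zero inn[of c]] r by simp
  obtain a Ha where a: "finite Ha"
    "\<And>h. h \<in> Ha \<Longrightarrow> snd h > 0 \<and> hole h \<subseteq> {z. R1 < cmod (z - c) \<and> cmod (z - c) < (R1 + R) / 2}"
    "sum snd Ha \<le> \<eta> / 2" "rational_on (- holes Ha) a"
    "\<And>z. (R1 + R) / 2 \<le> cmod (z - c) \<Longrightarrow> cmod (a z) \<le> \<kappa>"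
    "\<And>z. cmod (z - c) \<le> R1 \<Longrightarrow> cmod (1 - a z) \<le> \<kappa>"
    "\<And>z. z \<notin> holes Ha \<Longrightarrow> cmod (a z) \<le> 2 + 8 * ((R1 + R) / 2) / (\<eta> / 2)"
    by (rule annular_step[of R1 "(3 * R1 + R) / 4" "(R1 + R) / 2" "\<eta> / 2" \<kappa> c]) (use r \<eta> \<kappa>0 in auto)
  obtain b Hb where b: "finite Hb"
    "\<And>h. h \<in> Hb \<Longrightarrow> snd h > 0 \<and> hole h \<subseteq> {z. (r + r1) / 2 < cmod (z - c) \<and> cmod (z - c) < r1}"
    "sum snd Hb \<le> \<eta> / 2" "rational_on (- holes Hb) b"
    "\<And>z. r1 \<le> cmod (z - c) \<Longrightarrow> cmod (b z) \<le> \<kappa>"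
    "\<And>z. cmod (z - c) \<le> (r + r1) / 2 \<Longrightarrow> cmod (1 - b z) \<le> \<kappa>"
    "\<And>z. z \<notin> holes Hb \<Longrightarrow> cmod (b z) \<le> 2 + 8 * r1 / (\<eta> / 2)"
    by (rule annular_step[of "(r + r1) / 2" "(r + 3 * r1) / 4" r1 "\<eta> / 2" \<kappa> c]) (use r \<eta> \<kappa>0 in auto)
  define H' where "H' = H \<union> Ha \<union> Hb"
  define g where "g = (\<lambda>z. f z * a z + (1 - f z) * b z)"
  have aB: "cmod (a z) \<le> B" if "z \<notin> holes H'" for z
  proof -
    have "cmod (a z) \<le> 2 + 8 * ((R1 + R) / 2) / (\<eta> / 2)" using a(7) that by (auto simp: H'_def)
    also have "\<dots> \<le> B" unfolding B_def using r \<eta> by (simp add: field_simps)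
    finally show ?thesis .
  qed
  have bB: "cmod (b z) \<le> B" if "z \<notin> holes H'" for z
  proof -
    have "cmod (b z) \<le> 2 + 8 * r1 / (\<eta> / 2)" using b(7) that by (auto simp: H'_def)
    also have "\<dots> \<le> B" unfolding B_def using r \<eta> by (simp add: field_simps)
    finally show ?thesis .
  qed
  \<comment> \<open>In each of three regions both products contain a small factor: \<open>b\<close>
    and \<open>f\<close> beyond \<open>R1\<close>, \<open>1 - f\<close> and \<open>1 - a\<close>
    within \<open>r1\<close>, \<open>b\<close> and \<open>1 - a\<close> in between.\<close>
  have gf: "g z - f z = (1 - f z) * b z - f z * (1 - a z)" for z
    by (simp add: g_def algebra_simps)
  have tri: "cmod (g z - f z) \<le> cmod (1 - f z) * cmod (b z) + cmod (f z) * cmod (1 - a z)" for z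
    unfolding gf by (metis norm_mult norm_triangle_ineq4)
  have \<epsilon>B: "\<epsilon> * (1 + B) \<le> \<gamma> / 2" using \<epsilon>(2) by (simp add: B_def algebra_simps)
  have \<epsilon>B2: "\<epsilon> * B \<le> \<gamma> / 2" using \<epsilon>B \<epsilon>0 by (simp add: algebra_simps)
  show ?thesis
  proof (rule that[of "(r + r1) / 2" "(R1 + R) / 2" H' g])
    show "sum snd (H' - H) \<le> \<eta>"
    proof -
      have "sum snd (H' - H) \<le> sum snd (Ha \<union> Hb)"
        by (rule sum_mono2) (use a(1,2) b(1,2) in \<open>auto simp: H'_def less_imp_le\<close>)
      also have "\<dots> \<le> sum snd Ha + sum snd Hb"
      proof -
        have "0 \<le> sum snd (Ha \<inter> Hb)" by (rule sum_nonneg) (meson IntD1 a(2) less_imp_le)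
        then show ?thesis by (simp add: sum_Un[OF a(1) b(1)])
      qed
      finally show ?thesis using a(3) b(3) by simp
    qed
    show "rational_on (- holes H') g"
      unfolding g_def
      by (intro rational_on_add rational_on_mult rational_on_diff rational_on_const
          rational_on_subset[OF rat] rational_on_subset[OF a(4)] rational_on_subset[OF b(4)]) (auto simp: H'_def)
    show "snd h > 0 \<and> hole h \<subseteq> {z. r < cmod (z - c) \<and> cmod (z - c) < R}" if "h \<in> H' - H" for h
      using that a(2)[of h] b(2)[of h] r unfolding H'_def by force
    show "cmod (g z) \<le> \<epsilon>'" if z: "(R1 + R) / 2 \<le> cmod (z - c)" for z
    proof -
      have "cmod (g z) \<le> 3 * \<kappa>" unfolding g_def
        by (rule mix_bounds) (use z r \<epsilon> \<kappa>0 out[of z] a(5) b(5) in auto)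
      then show ?thesis using \<kappa> by simp
    qed
    show "cmod (1 - g z) \<le> \<epsilon>'" if z: "cmod (z - c) \<le> (r + r1) / 2" for z
    proof -
      have "cmod (1 - g z) \<le> 3 * \<kappa>" unfolding g_def
        by (rule mix_bounds) (use z r \<epsilon> \<kappa>0 inn[of z] a(6) b(6) in auto)
      then show ?thesis using \<kappa> by simp
    qed
    show "cmod (g z - f z) \<le> \<gamma>" if z: "z \<notin> holes H'" for z
    proof -
      have f1: "cmod (1 - f z) \<le> 1 + cmod (f z)" using norm_triangle_ineq4[of 1 "f z"] by simp
      have f2: "cmod (f z) \<le> 1 + cmod (1 - f z)" using norm_triangle_ineq4[of 1 "1 - f z"] by simp
      have a1: "cmod (1 - a z) \<le> 1 + B" using norm_triangle_ineq4[of 1 "a z"] aB[OF z] by simp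
      consider "R1 \<le> cmod (z - c)" | "cmod (z - c) \<le> r1" | "r1 \<le> cmod (z - c)" "cmod (z - c) \<le> R1" by linarith
      then show ?thesis
      proof cases
        case 1
        then have "cmod (b z) \<le> \<kappa>" "cmod (f z) \<le> \<epsilon>" using b(5) out r by auto
        then have "cmod (1 - f z) * cmod (b z) \<le> 2 * \<kappa>" "cmod (f z) * cmod (1 - a z) \<le> \<epsilon> * (1 + B)"
          using f1 a1 \<epsilon> \<kappa>0 \<epsilon>0 by (auto intro!: mult_mono)
        then show ?thesis using tri[of z] \<epsilon>B \<kappa> by linarith
      next
        case 2
        then have "cmod (1 - a z) \<le> \<kappa>" "cmod (1 - f z) \<le> \<epsilon>" using a(6) inn r by auto
        then have "cmod (1 - f z) * cmod (b z) \<le> \<epsilon> * B" "cmod (f z) * cmod (1 - a z) \<le> 2 * \<kappa>"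
          using f2 bB[OF z] \<epsilon> \<kappa>0 \<epsilon>0 by (auto intro!: mult_mono)
        then show ?thesis using tri[of z] \<epsilon>B2 \<kappa> by linarith
      next
        case 3
        then have *: "cmod (1 - a z) \<le> \<kappa>" "cmod (b z) \<le> \<kappa>" using a(6) b(5) r by auto
        have fM: "cmod (f z) \<le> M'" using M[of z] z M' by (auto simp: H'_def)
        have "cmod (1 - f z) * cmod (b z) \<le> (1 + M') * \<kappa>" "cmod (f z) * cmod (1 - a z) \<le> M' * \<kappa>"
          using f1 * fM M' \<kappa>0 by (auto intro!: mult_mono)
        then have "cmod (g z - f z) \<le> (2 * M' + 1) * \<kappa>" using tri[of z] by (simp add: algebra_simps)
        also have "\<dots> \<le> \<gamma>" using \<kappa>(2) M' by (simp add: pos_le_divide_eq mult.commute)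
        finally show ?thesis .
      qed
    qed
  qed (use r a(1) b(1) H in \<open>auto simp: H'_def\<close>)
qed

lemma geometric_increments_converge:
  fixes x :: "nat \<Rightarrow> complex"
  assumes "\<And>n. cmod (x (Suc n) - x n) \<le> (1/2)^n"
  shows "\<exists>L. x \<longlonglongrightarrow> L \<and> (\<forall>n. cmod (L - x n) \<le> 2 * (1/2)^n)"
proof -
  \<comment> \<open>The factor \<open>1 - (1/2)^k\<close> is the exact partial geometric sum; it
    lets the induction close.\<close>
  have step: "cmod (x (n + k) - x n) \<le> 2 * (1/2)^n * (1 - (1/2)^k)" for n k
  proof (induction k)
    case (Suc k)
    have "cmod (x (n + Suc k) - x n) \<le> cmod (x (Suc (n + k)) - x (n + k)) + cmod (x (n + k) - x n)"
      using norm_triangle_ineq[of "x (Suc (n + k)) - x (n + k)" "x (n + k) - x n"] by simp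
    also have "\<dots> \<le> (1/2)^(n + k) + 2 * (1/2)^n * (1 - (1/2)^k)"
      using assms[of "n + k"] Suc by linarith
    also have "\<dots> = 2 * (1/2)^n * (1 - (1/2)^Suc k)"
      by (simp add: power_add algebra_simps)
    finally show ?case .
  qed simp
  have le: "cmod (x (n + k) - x n) \<le> 2 * (1/2)^n" for n k
    by (rule order_trans[OF step]) (simp add: mult_left_le)
  have "(\<lambda>n. 2 * (1/2::real)^n) \<longlonglongrightarrow> 2 * 0" by (intro tendsto_intros LIMSEQ_realpow_zero) auto
  then have lim0: "(\<lambda>n. 2 * (1/2::real)^n) \<longlonglongrightarrow> 0" by simp
  have "Cauchy x"
  proof (rule CauchyI')
    fix e :: real assume "e > 0"
    then obtain N where N: "2 * (1/2::real)^N < e / 2"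
      using order_tendstoD(2)[OF lim0, of "e / 2"] by (auto simp: eventually_sequentially)
    show "\<exists>M. \<forall>m\<ge>M. \<forall>n>m. dist (x m) (x n) < e"
    proof (rule exI[of _ N], intro allI impI)
      fix m n assume mn: "N \<le> m" "m < n"
      have "cmod (x m - x n) \<le> 2 * (1/2)^m"
        using le[of m "n - m"] mn by (simp add: norm_minus_commute)
      also have "\<dots> \<le> 2 * (1/2)^N" using mn by (simp add: power_decreasing)
      finally show "dist (x m) (x n) < e" using N \<open>e > 0\<close> by (simp add: dist_norm)
    qed
  qed
  then obtain L where L: "x \<longlonglongrightarrow> L" using Cauchy_convergent_iff convergent_def by blast
  have "cmod (L - x n) \<le> 2 * (1/2)^n" for n
  proof (rule Lim_norm_ubound)
    show "((\<lambda>k. x (n + k) - x n) \<longlongrightarrow> L - x n) sequentially"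
      using LIMSEQ_ignore_initial_segment[OF L, of n] by (intro tendsto_intros) (simp add: add.commute)
  qed (use le in auto)
  with L show ?thesis by blast
qed

text \<open>Iterates \<open>annular_improve\<close> from one \<open>annular_step\<close>. The
  transition radii approach r and R but stay strictly between them, so on
  \<open>|z - c| \<le> r\<close> and on \<open>|z - c| \<ge> R\<close> every approximant obeys its
  estimate \<open>e n\<close>, and the limit is exactly 1 or 0 there.\<close>

lemma annular_function:
  fixes c :: complex
  assumes r: "0 < r" "r < R" and \<eta>: "\<eta> > 0"
  obtains H f where "\<And>h. h \<in> H \<Longrightarrow> snd h > 0 \<and> hole h \<subseteq> {z. r < cmod (z - c) \<and> cmod (z - c) < R}"
    "\<And>F. finite F \<Longrightarrow> F \<subseteq> H \<Longrightarrow> sum snd F \<le> \<eta>"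
    "\<And>\<epsilon>. \<epsilon> > 0 \<Longrightarrow> \<exists>g. rational_on (- holes H) g \<and> (\<forall>z. z \<notin> holes H \<longrightarrow> cmod (f z - g z) \<le> \<epsilon>)"
    "\<And>z. cmod (z - c) \<le> r \<Longrightarrow> f z = 1" "\<And>z. R \<le> cmod (z - c) \<Longrightarrow> f z = 0"
proof -
  define \<eta>s where "\<eta>s n = \<eta> / 2 ^ (n + 2)" for n :: nat
  \<comment> \<open>Solves the condition
    \<open>\<epsilon> * (3 + 16 * R / \<eta>) \<le> \<gamma> / 2\<close> of
    \<open>annular_improve\<close> for budget \<open>\<eta>s n\<close> and change
    \<open>\<gamma> = (1/2) ^ n\<close>. The budgets \<open>\<eta> / 2 ^ (n + 2)\<close> and the
    initial \<open>\<eta> / 2\<close> add up to \<eta>.\<close>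
  define e where "e n = (1/2) ^ n / 2 / (3 + 16 * R / \<eta>s n)" for n
  have \<eta>s: "\<eta>s n > 0" for n using \<eta> by (simp add: \<eta>s_def)
  have R: "R > 0" using r by simp
  have den: "3 + 16 * R / \<eta>s n \<ge> 1" for n using \<eta>s[of n] R by (simp add: add_increasing2)
  have e: "e n > 0" "e n \<le> (1/2) ^ n" "e n * (3 + 16 * R / \<eta>s n) \<le> (1/2) ^ n / 2" for n
  proof -
    show "e n > 0" unfolding e_def using den[of n] by (intro divide_pos_pos) auto
    show "e n * (3 + 16 * R / \<eta>s n) \<le> (1/2) ^ n / 2"
    proof -
      have "x / d * d = x" if "1 \<le> d" for x d :: real using that by simp
      then show ?thesis unfolding e_def using den[of n] by (metis order_refl)
    qed
    have "e n \<le> (1/2) ^ n / 2 / 1" unfolding e_def using den[of n] by (intro divide_left_mono) auto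
    also have "\<dots> \<le> (1/2) ^ n" by simp
    finally show "e n \<le> (1/2) ^ n" .
  qed
  have e1: "e n \<le> 1" for n using e(2)[of n] power_le_one[of "1/2::real" n] by linarith
  define A where "A h \<longleftrightarrow> snd h > 0 \<and> hole h \<subseteq> {z. r < cmod (z - c) \<and> cmod (z - c) < R}" for h
  \<comment> \<open>The sup bound M is existential: it may depend on n, and the next improvement
    absorbs it into its \<kappa>.\<close>
  define P where "P n = (\<lambda>(f, H, r1, R1). r < r1 \<and> r1 < R1 \<and> R1 < R \<and> finite H \<and> (\<forall>h\<in>H. A h)
      \<and> rational_on (- holes H) f \<and> (\<forall>z. R1 \<le> cmod (z - c) \<longrightarrow> cmod (f z) \<le> e n)
      \<and> (\<forall>z. cmod (z - c) \<le> r1 \<longrightarrow> cmod (1 - f z) \<le> e n) \<and> (\<exists>M. \<forall>z. z \<notin> holes H \<longrightarrow> cmod (f z) \<le> M)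
      \<and> sum snd H \<le> \<eta> * (1 - (1/2) ^ Suc n))" for n
  define Q where "Q n = (\<lambda>(f, H, r1 :: real, R1 :: real) (f', H', r1' :: real, R1' :: real). H \<subseteq> H'
      \<and> (\<forall>z. z \<notin> holes H' \<longrightarrow> cmod (f' z - f z) \<le> (1/2) ^ n))"
    for n :: nat
  have "\<exists>S. \<forall>n. P n (S n) \<and> Q n (S n) (S (Suc n))"
  proof (rule dependent_nat_choice)
    obtain a H where a: "finite H"
      "\<And>h. h \<in> H \<Longrightarrow> snd h > 0 \<and> hole h \<subseteq> {z. (2 * r + R) / 3 < cmod (z - c) \<and> cmod (z - c) < (r + 2 * R) / 3}"
      "sum snd H \<le> \<eta> / 2" "rational_on (- holes H) a"
      "\<And>z. (r + 2 * R) / 3 \<le> cmod (z - c) \<Longrightarrow> cmod (a z) \<le> e 0"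
      "\<And>z. cmod (z - c) \<le> (2 * r + R) / 3 \<Longrightarrow> cmod (1 - a z) \<le> e 0"
      "\<And>z. z \<notin> holes H \<Longrightarrow> cmod (a z) \<le> 2 + 8 * ((r + 2 * R) / 3) / (\<eta> / 2)"
      by (rule annular_step[of "(2 * r + R) / 3" "(r + R) / 2" "(r + 2 * R) / 3" "\<eta> / 2" "e 0" c])
        (use r \<eta> e in auto)
    have "A h" if "h \<in> H" for h using a(2)[OF that] r unfolding A_def by force
    then have "P 0 (a, H, (2 * r + R) / 3, (r + 2 * R) / 3)"
      unfolding P_def using a r by auto
    then show "\<exists>x. P 0 x" by blast
  next
    fix S n assume S: "P n S"
    obtain f H r1 R1 where Seq: "S = (f, H, r1, R1)" using prod_cases4 by blast
    from S obtain M where f: "r < r1" "r1 < R1" "R1 < R" "finite H" "\<And>h. h \<in> H \<Longrightarrow> A h"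
      "rational_on (- holes H) f" "\<And>z. R1 \<le> cmod (z - c) \<Longrightarrow> cmod (f z) \<le> e n"
      "\<And>z. cmod (z - c) \<le> r1 \<Longrightarrow> cmod (1 - f z) \<le> e n"
      "\<And>z. z \<notin> holes H \<Longrightarrow> cmod (f z) \<le> M" "sum snd H \<le> \<eta> * (1 - (1/2) ^ Suc n)"
      unfolding P_def Seq by auto
    obtain g H' r2 R2 where g: "r < r2" "r2 < r1" "R1 < R2" "R2 < R" "finite H'" "H \<subseteq> H'"
      "\<And>h. h \<in> H' - H \<Longrightarrow> snd h > 0 \<and> hole h \<subseteq> {z. r < cmod (z - c) \<and> cmod (z - c) < R}"
      "sum snd (H' - H) \<le> \<eta>s n" "rational_on (- holes H') g"
      "\<And>z. R2 \<le> cmod (z - c) \<Longrightarrow> cmod (g z) \<le> e (Suc n)"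
      "\<And>z. cmod (z - c) \<le> r2 \<Longrightarrow> cmod (1 - g z) \<le> e (Suc n)"
      "\<And>z. z \<notin> holes H' \<Longrightarrow> cmod (g z - f z) \<le> (1/2) ^ n"
      by (rule annular_improve[OF r(1) f(1,2,3) \<eta>s _ e(1) f(4,6,7,8) e1 e(3) f(9)]) auto
    have "sum snd H' = sum snd (H' - H) + sum snd H"
      using sum.subset_diff[OF g(6,5)] .
    also have "\<dots> \<le> \<eta> / 2 ^ (n + 2) + \<eta> * (1 - (1/2) ^ Suc n)" using g(8) f(10) by (simp add: \<eta>s_def)
    also have "\<dots> = \<eta> * (1 - (1/2) ^ Suc (Suc n))" by (simp add: field_simps)
    finally have sm: "sum snd H' \<le> \<eta> * (1 - (1/2) ^ Suc (Suc n))" .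
    have Mg: "cmod (g z) \<le> M + (1/2) ^ n" if "z \<notin> holes H'" for z
    proof -
      have "cmod (f z) \<le> M" using f(9) that g(6) by blast
      then show ?thesis using g(12)[OF that] norm_triangle_sub[of "g z" "f z"] by linarith
    qed
    have "A h" if "h \<in> H'" for h using that f(5) g(7) unfolding A_def by blast
    then have "P (Suc n) (g, H', r2, R2)" unfolding P_def using f g sm Mg by auto
    moreover have "Q n S (g, H', r2, R2)" unfolding Q_def Seq using g by auto
    ultimately show "\<exists>T. P (Suc n) T \<and> Q n S T" by blast
  qed
  then obtain S where S: "\<And>n. P n (S n)" "\<And>n. Q n (S n) (S (Suc n))" by blast
  define f where "f n = fst (S n)" for n
  define Hs where "Hs n = fst (snd (S n))" for n
  have PS: "r < fst (snd (snd (S n)))" "snd (snd (snd (S n))) < R" "finite (Hs n)" "\<And>h. h \<in> Hs n \<Longrightarrow> A h"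
    "rational_on (- holes (Hs n)) (f n)" "\<And>z. snd (snd (snd (S n))) \<le> cmod (z - c) \<Longrightarrow> cmod (f n z) \<le> e n"
    "\<And>z. cmod (z - c) \<le> fst (snd (snd (S n))) \<Longrightarrow> cmod (1 - f n z) \<le> e n"
    "sum snd (Hs n) \<le> \<eta> * (1 - (1/2) ^ Suc n)" for n
    using S(1)[of n] unfolding P_def f_def Hs_def by (auto simp: case_prod_beta)
  have QS: "Hs n \<subseteq> Hs (Suc n)" "\<And>z. z \<notin> holes (Hs (Suc n)) \<Longrightarrow> cmod (f (Suc n) z - f n z) \<le> (1/2) ^ n" for n
    using S(2)[of n] unfolding Q_def f_def Hs_def by (auto simp: case_prod_beta)
  define H where "H = (\<Union>n. Hs n)"
  define F where "F z = lim (\<lambda>n. f n z)" for z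
  have elim: "e \<longlonglongrightarrow> 0"
  proof (rule tendsto_sandwich[OF _ _ tendsto_const])
    show "(\<lambda>n. (1/2::real) ^ n) \<longlonglongrightarrow> 0" by (intro LIMSEQ_realpow_zero) auto
  qed (use e in \<open>auto simp: less_imp_le\<close>)
  have near: "cmod (F z - f n z) \<le> 2 * (1/2) ^ n" if "z \<notin> holes H" for z n
  proof -
    have "z \<notin> holes (Hs n)" for n using that by (auto simp: H_def)
    then have "cmod (f (Suc n) z - f n z) \<le> (1/2) ^ n" for n using QS(2) by blast
    from geometric_increments_converge[of "\<lambda>n. f n z", OF this]
    show ?thesis unfolding F_def using limI by blast
  qed
  show ?thesis
  proof
    show "snd h > 0 \<and> hole h \<subseteq> {z. r < cmod (z - c) \<and> cmod (z - c) < R}" if "h \<in> H" for h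
      using that PS(4) unfolding H_def A_def by blast
    show "sum snd X \<le> \<eta>" if X: "finite X" "X \<subseteq> H" for X
    proof -
      have "\<exists>n. X \<subseteq> Hs n" using X
      proof (induction X)
        case (insert x X)
        then obtain n m where "X \<subseteq> Hs n" "x \<in> Hs m" by (auto simp: H_def)
        then have "insert x X \<subseteq> Hs (max m n)"
          using lift_Suc_mono_le[of Hs, OF QS(1), of n "max m n"] lift_Suc_mono_le[of Hs, OF QS(1), of m "max m n"] by auto
        then show ?case by blast
      qed auto
      then obtain n where n: "X \<subseteq> Hs n" by blast
      have "sum snd X \<le> sum snd (Hs n)"
        by (rule sum_mono2[OF PS(3) n]) (meson A_def DiffD1 PS(4) less_imp_le)
      also have "\<dots> \<le> \<eta> * (1 - (1/2) ^ Suc n)" by (rule PS)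
      also have "\<dots> \<le> \<eta>" using \<eta> by (simp add: mult_left_le)
      finally show ?thesis .
    qed
    show "\<exists>g. rational_on (- holes H) g \<and> (\<forall>z. z \<notin> holes H \<longrightarrow> cmod (F z - g z) \<le> \<epsilon>)" if \<epsilon>: "\<epsilon> > 0" for \<epsilon>
    proof -
      obtain n where n: "(1/2::real) ^ n < \<epsilon> / 2" using real_arch_pow_inv[of "\<epsilon> / 2" "1/2"] \<epsilon> by auto
      have "rational_on (- holes H) (f n)" by (rule rational_on_subset[OF PS(5)[of n]]) (auto simp: H_def)
      moreover have "cmod (F z - f n z) \<le> \<epsilon>" if "z \<notin> holes H" for z using near[OF that, of n] n by linarith
      ultimately show ?thesis by blast
    qed
    show "F z = 1" if "cmod (z - c) \<le> r" for z
    proof -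
      have "(\<lambda>n. 1 - f n z) \<longlonglongrightarrow> 0"
      proof (rule Lim_null_comparison[OF _ elim], rule always_eventually, rule allI)
        fix n show "cmod (1 - f n z) \<le> e n" by (rule PS(7)) (use that PS(1)[of n] in auto)
      qed
      then have "(\<lambda>n. 1 - (1 - f n z)) \<longlonglongrightarrow> 1 - 0" by (intro tendsto_intros)
      then show ?thesis unfolding F_def by (intro limI) simp
    qed
    show "F z = 0" if "R \<le> cmod (z - c)" for z
    proof -
      have "(\<lambda>n. f n z) \<longlonglongrightarrow> 0"
      proof (rule Lim_null_comparison[OF _ elim], rule always_eventually, rule allI)
        fix n show "cmod (f n z) \<le> e n" by (rule PS(6)) (use that PS(2)[of n] in auto)
      qed
      then show ?thesis unfolding F_def by (intro limI)
    qed
  qed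
qed

subsection \<open>Contour integrals of \<open>exp (1 / z)\<close>\<close>

text \<open>Away from 0 the essential singularity can be shifted at small cost: 1 / z and 1 / (z +
  a) stay in a fixed disc, where exp is uniformly continuous. This serves the limit on the tangent
  circle and also the replacement of \<open>exp (1 / z)\<close> by a function holomorphic near the
  whole disc.\<close>

lemma exp_inverse_translate:
  assumes "\<delta> > 0" "\<epsilon> > 0"
  obtains d where "d > 0"
    "\<And>a z :: complex. cmod a \<le> d \<Longrightarrow> \<delta> \<le> cmod z \<Longrightarrow> cmod (exp (1 / (z + a)) - exp (1 / z)) \<le> \<epsilon>"
proof -
  have "compact (cball (0::complex) (2 / \<delta>))" by simp
  moreover have "continuous_on (cball (0::complex) (2 / \<delta>)) exp" by (intro continuous_intros)
  ultimately have "uniformly_continuous_on (cball (0::complex) (2 / \<delta>)) exp"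
    by (intro compact_uniformly_continuous)
  then obtain \<eta> where \<eta>: "\<eta> > 0"
    "\<And>x y::complex. x \<in> cball 0 (2 / \<delta>) \<Longrightarrow> y \<in> cball 0 (2 / \<delta>) \<Longrightarrow> dist y x < \<eta> \<Longrightarrow> dist (exp y) (exp x) < \<epsilon>"
    unfolding uniformly_continuous_on_def using assms by metis
  \<comment> \<open>The first bound keeps \<open>z + a\<close> at distance
    \<open>\<delta> / 2\<close> from 0; the second makes the two arguments of exp differ by at most
    \<open>\<eta> / 2\<close>.\<close>
  define d where "d = min (\<delta> / 2) (\<eta> * \<delta> * \<delta> / 4)"
  show ?thesis
  proof
    show "d > 0" using assms \<eta> by (simp add: d_def)
    fix a z :: complex assume a: "cmod a \<le> d" and z: "\<delta> \<le> cmod z"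
    have d: "d \<le> \<delta> / 2" "d \<le> \<eta> * \<delta> * \<delta> / 4" by (auto simp: d_def)
    have za: "\<delta> / 2 \<le> cmod (z + a)" using norm_diff_ineq[of z a] a z d by linarith
    then have nz: "z \<noteq> 0" "z + a \<noteq> 0" using assms z by auto
    have i1: "cmod (1 / (z + a)) \<le> 1 / (\<delta> / 2)"
      unfolding norm_divide using za assms by (intro frac_le) auto
    have "cmod (1 / z) \<le> 1 / (\<delta> / 2)"
      unfolding norm_divide using z assms by (intro frac_le) auto
    with i1 have in_ball: "1 / (z + a) \<in> cball 0 (2 / \<delta>)" "1 / z \<in> cball 0 (2 / \<delta>)" by auto
    have "1 / (z + a) - 1 / z = - a / ((z + a) * z)" using nz by (simp add: field_simps)
    then have "cmod (1 / (z + a) - 1 / z) = cmod a / (cmod (z + a) * cmod z)"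
      by (simp add: norm_divide norm_mult)
    also have "\<dots> \<le> (\<eta> * \<delta> * \<delta> / 4) / (\<delta> / 2 * \<delta>)"
      using a d za z assms \<eta> by (intro frac_le mult_mono) auto
    also have "\<dots> = \<eta> / 2" using assms by (simp add: field_simps)
    also have "\<dots> < \<eta>" using \<eta> by simp
    finally have "dist (exp (1 / (z + a))) (exp (1 / z)) < \<epsilon>"
      by (intro \<eta>(2)) (use in_ball in \<open>auto simp: dist_norm\<close>)
    then show "cmod (exp (1 / (z + a)) - exp (1 / z)) \<le> \<epsilon>" by (simp add: dist_norm)
  qed
qed

text \<open>The extra point b leaves room for an essential singularity outside the circle, later
  that of \<open>exp (1 / (z + \<alpha>))\<close>. The residue theorem is applied on the connected
  set \<open>- {b}\<close>; it needs only that the winding number around b vanishes.\<close>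

lemma contour_integral_circlepath_residues:
  assumes holo: "F holomorphic_on - {b} - P" and P: "finite P" and r: "r > 0"
    and b: "b \<notin> cball c r" and disj: "sphere c r \<inter> P = {}"
  shows "F contour_integrable_on circlepath c r"
    and "contour_integral (circlepath c r) F = 2 * pi * \<i> * (\<Sum>p\<in>P \<inter> ball c r. residue F p)"
proof -
  have sub: "path_image (circlepath c r) \<subseteq> - {b} - P"
    using b disj r by auto
  have op: "open (- {b} - P)" using P by (intro open_Diff) (auto intro: finite_imp_closed)
  show "F contour_integrable_on circlepath c r"
    by (rule contour_integrable_holomorphic_simple[OF holo op _ sub]) simp
  have out: "winding_number (circlepath c r) p = 0" if "p \<notin> cball c r" for p
    by (rule winding_number_zero_outside[of _ "cball c r"]) (use that r in auto)
  have "contour_integral (circlepath c r) F =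
      2 * pi * \<i> * (\<Sum>p\<in>P. winding_number (circlepath c r) p * residue F p)"
  proof (rule Residue_theorem[OF _ _ P holo])
    show "connected (- {b})" using connected_punctured_universe[of b] by simp
  qed (use sub out b in auto)
  also have "(\<Sum>p\<in>P. winding_number (circlepath c r) p * residue F p) = (\<Sum>p\<in>P \<inter> ball c r. residue F p)"
  proof (rule sum.mono_neutral_cong_right)
    show "\<forall>p\<in>P - P \<inter> ball c r. winding_number (circlepath c r) p * residue F p = 0"
    proof
      fix p assume "p \<in> P - P \<inter> ball c r"
      then have "p \<notin> cball c r" using disj by (auto simp: order_less_le)
      then show "winding_number (circlepath c r) p * residue F p = 0" using out by simp
    qed
    show "winding_number (circlepath c r) p * residue F p = residue F p" if "p \<in> P \<inter> ball c r" for p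
      using that by (simp add: winding_number_circlepath dist_norm norm_minus_commute)
  qed (use P in auto)
  finally show "contour_integral (circlepath c r) F = 2 * pi * \<i> * (\<Sum>p\<in>P \<inter> ball c r. residue F p)" .
qed

text \<open>The substitution \<open>z = a + 1 / v\<close> turns the unit circle around \<open>a\<close> into the reversed
  unit circle in \<open>v\<close>, where Cauchy's formula for derivatives of \<open>exp\<close> applies.\<close>

lemma contour_integral_exp_inverse_circlepath:
  "contour_integral (circlepath a 1) (\<lambda>z. z * exp (1 / (z - a))) = 2 * pi * \<i> * (1/2 + a)"
proof -
  define \<phi> where "\<phi> = (\<lambda>v::complex. a + inverse v)"
  define F where "F = (\<lambda>z. z * exp (1 / (z - a)))"
  have an: "\<phi> analytic_on - {0}"
    unfolding \<phi>_def by (intro analytic_intros) auto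
  have rev: "\<phi> \<circ> circlepath 0 1 = reversepath (circlepath a 1)"
  proof
    fix x :: real
    have "inverse (exp (2 * of_real pi * \<i> * of_real x)) = exp (2 * of_real pi * \<i> * of_real (1 - x))"
      by (simp add: exp_minus[symmetric] right_diff_distrib exp_diff exp_of_real exp_two_pi_i divide_inverse)
    then show "(\<phi> \<circ> circlepath 0 1) x = reversepath (circlepath a 1) x"
      by (simp add: \<phi>_def circlepath reversepath_def)
  qed
  have "contour_integral (\<phi> \<circ> circlepath 0 1) F = contour_integral (circlepath 0 1) (\<lambda>v. deriv \<phi> v * F (\<phi> v))"
    by (rule contour_integral_comp_analyticW[OF an]) auto
  \<comment> \<open>The derivative of \<phi> is \<open>- 1 / v^2\<close>, so the integrand splits
    into \<open>exp v\<close> over \<open>v^2\<close> and over \<open>v^3\<close>.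
    \<open>Suc 1\<close> and \<open>Suc 2\<close> match the first and second derivative in Cauchy's
    formula, with factorials 1 and 2.\<close>
  also have "\<dots> = contour_integral (circlepath 0 1) (\<lambda>v. - (a * (exp v / (v - 0) ^ Suc 1)) - exp v / (v - 0) ^ Suc 2)"
  proof (rule contour_integral_eq)
    fix v :: complex assume "v \<in> path_image (circlepath 0 1)"
    then have v: "v \<noteq> 0" by auto
    have "(\<phi> has_field_derivative - (inverse v * 1 * inverse v)) (at v)"
      unfolding \<phi>_def by (rule derivative_eq_intros refl v | simp)+
    then have D: "deriv \<phi> v = - (1 / v^2)" by (auto dest!: DERIV_imp_deriv simp: power2_eq_square divide_inverse)
    show "deriv \<phi> v * F (\<phi> v) = - (a * (exp v / (v - 0) ^ Suc 1)) - exp v / (v - 0) ^ Suc 2"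
      unfolding D using v by (simp add: F_def \<phi>_def field_simps power2_eq_square power3_eq_cube)
  qed
  also have "\<dots> = - (a * (2 * pi * \<i>)) - pi * \<i>"
  proof (rule contour_integral_unique)
    have C: "((\<lambda>u. exp u / (u - 0) ^ Suc k) has_contour_integral (2 * pi * \<i> / fact k * (deriv ^^ k) exp 0)) (circlepath 0 1)" for k
      by (rule Cauchy_has_contour_integral_higher_derivative_circlepath) (auto intro!: continuous_intros holomorphic_intros)
    have d: "(deriv ^^ k) exp = (exp :: complex \<Rightarrow> complex)" for k
      by (induction k) (auto intro!: ext DERIV_imp_deriv derivative_eq_intros)
    show "((\<lambda>v. - (a * (exp v / (v - 0) ^ Suc 1)) - exp v / (v - 0) ^ Suc 2) has_contour_integral - (a * (2 * pi * \<i>)) - pi * \<i>) (circlepath 0 1)"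
      using has_contour_integral_diff[OF has_contour_integral_neg[OF has_contour_integral_lmul[OF C[of 1], of a]] C[of 2]]
      using d[of 1] d[of 2] by simp
  qed
  finally have "contour_integral (reversepath (circlepath a 1)) F = - (a * (2 * pi * \<i>)) - pi * \<i>"
    by (simp add: rev)
  then show ?thesis unfolding F_def
    by (simp add: contour_integral_reversepath algebra_simps)
qed

text \<open>The singularity lies on the contour. It is moved to a point a > 0 inside, where the
  integral is \<open>2 * pi * \<i> * (1/2 + a)\<close>, and a tends to 0. Approached from outside,
  the integrals would all be 0 and uniform convergence would fail; from inside, the exponentials are
  uniformly bounded on the circle.\<close>

lemma has_contour_integral_exp_inverse_tangent_circle:
  fixes \<rho> :: real
  assumes \<rho>: "\<rho> > 0"
  shows "((\<lambda>z. z * exp (1 / z)) has_contour_integral (pi * \<i>)) (circlepath \<rho> \<rho>)"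
proof -
  define f where "f = (\<lambda>(a::real) z::complex. z * exp (1 / (z - a)))"
  define C where "C = path_image (circlepath (of_real \<rho>) \<rho>)"
  have C: "C = sphere (of_real \<rho>) \<rho>" unfolding C_def using \<rho> by simp
  have sq: "(cmod z)\<^sup>2 = 2 * \<rho> * Re z" if "z \<in> C" for z
  proof -
    have "cmod (z - of_real \<rho>) = \<rho>" using that by (simp add: C dist_norm norm_minus_commute)
    then have "(Re z - \<rho>)\<^sup>2 + (Im z)\<^sup>2 = \<rho>\<^sup>2" using cmod_power2[of "z - of_real \<rho>"] by simp
    then show ?thesis unfolding cmod_power2 by (simp add: power2_eq_square algebra_simps)
  qed
  have Re0: "Re z \<ge> 0" if "z \<in> C" for z
    using sq[OF that] \<rho> by (metis zero_le_power2 zero_le_mult_iff mult_pos_pos not_le zero_less_numeral)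
  \<comment> \<open>From \<open>a \<le> \<rho> / 2\<close> follows \<open>|z - a|^2 = 2 * (\<rho> -
    a) * Re z + a^2 \<ge> \<rho> * Re z\<close>, while the numerator \<open>Re z - a\<close> is at
    most \<open>Re z\<close>.\<close>
  have bound: "Re (1 / (z - of_real a)) \<le> 1 / \<rho>" if z: "z \<in> C" and a: "0 \<le> a" "a \<le> \<rho> / 2" for z a
  proof (cases "Re z = 0")
    case True
    then have "z = 0" using sq[OF z] by simp
    then show ?thesis using a \<rho> by (cases "a = 0") (auto simp: divide_nonneg_nonneg intro: order_trans[of _ 0])
  next
    case False
    with Re0[OF z] have x: "Re z > 0" by simp
    have n: "(cmod (z - of_real a))\<^sup>2 = 2 * (\<rho> - a) * Re z + a\<^sup>2"
      using sq[OF z] unfolding cmod_power2 by (simp add: power2_eq_square algebra_simps)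
    have D: "0 < \<rho> * Re z" using \<rho> x by simp
    have "\<rho> * Re z \<le> 2 * (\<rho> - a) * Re z" using a x by (intro mult_right_mono) auto
    then have le: "\<rho> * Re z \<le> (cmod (z - of_real a))\<^sup>2" using n zero_le_power2[of a] by linarith
    have "Re (1 / (z - of_real a)) = (Re z - a) / (cmod (z - of_real a))\<^sup>2"
      by (simp add: Re_divide cmod_power2)
    also have "\<dots> \<le> Re z / (\<rho> * Re z)" using a D le x by (intro frac_le) auto
    also have "\<dots> = 1 / \<rho>" using x by simp
    finally show ?thesis .
  qed
  have unif: "uniform_limit C f (f 0) (at_right 0)"
  proof (rule uniform_limitI)
    fix e :: real assume e: "e > 0"
    \<comment> \<open>Below modulus \<delta> both exponentials are at most
      \<open>exp (1 / \<rho>)\<close> and the factor z does the work; above it,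
      \<open>|z| \<le> 2 * \<rho>\<close> is combined with the translation estimate. Either way the
      bound is e / 2.\<close>
    define \<delta> where "\<delta> = e / (4 * exp (1 / \<rho>))"
    have \<delta>: "\<delta> > 0" using e by (simp add: \<delta>_def)
    obtain d where d: "d > 0" "\<And>a z :: complex. cmod a \<le> d \<Longrightarrow> \<delta> \<le> cmod z \<Longrightarrow>
        cmod (exp (1 / (z + a)) - exp (1 / z)) \<le> e / (4 * \<rho>)"
      using exp_inverse_translate[OF \<delta>, of "e / (4 * \<rho>)"] e \<rho> by auto
    have "\<forall>\<^sub>F a in at_right 0. a < min d (\<rho> / 2)"
      unfolding eventually_at_right_field using d \<rho> by (intro exI[of _ "min d (\<rho> / 2)"]) auto
    moreover have "\<forall>\<^sub>F a in at_right (0::real). a > 0" by (simp add: eventually_at_right_less)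
    ultimately show "\<forall>\<^sub>F a in at_right 0. \<forall>z\<in>C. dist (f a z) (f 0 z) < e"
    proof eventually_elim
      case (elim a)
      show ?case
      proof
        fix z assume z: "z \<in> C"
        have fd: "dist (f a z) (f 0 z) = cmod z * cmod (exp (1 / (z - of_real a)) - exp (1 / z))"
          by (simp add: f_def dist_norm norm_mult flip: right_diff_distrib)
        show "dist (f a z) (f 0 z) < e"
        proof (cases "\<delta> \<le> cmod z")
          case True
          have "cmod z \<le> cmod (z - of_real \<rho>) + cmod (of_real \<rho>)" using norm_triangle_sub[of z "of_real \<rho>"] by linarith
          also have "\<dots> = 2 * \<rho>" using z \<rho> by (simp add: C dist_norm norm_minus_commute)
          finally have "cmod z \<le> 2 * \<rho>" .
          moreover have "cmod (exp (1 / (z - of_real a)) - exp (1 / z)) \<le> e / (4 * \<rho>)"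
            using d(2)[of "- of_real a" z] True elim by simp
          ultimately have "dist (f a z) (f 0 z) \<le> 2 * \<rho> * (e / (4 * \<rho>))"
            unfolding fd using \<rho> by (intro mult_mono) auto
          also have "\<dots> = e / 2" using \<rho> by simp
          finally show ?thesis using e by linarith
        next
          case False
          have "cmod (exp (1 / (z - of_real a)) - exp (1 / z)) \<le> cmod (exp (1 / (z - of_real a))) + cmod (exp (1 / z))"
            by (rule norm_triangle_ineq4)
          also have "\<dots> \<le> exp (1 / \<rho>) + exp (1 / \<rho>)"
            using bound[OF z, of a] bound[OF z, of 0] elim \<rho> by (intro add_mono) (auto simp: norm_exp_eq_Re)
          finally have "dist (f a z) (f 0 z) \<le> \<delta> * (2 * exp (1 / \<rho>))"
            unfolding fd using False \<delta> by (intro mult_mono) auto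
          also have "\<dots> = e / 2" by (simp add: \<delta>_def)
          finally show ?thesis using e by linarith
        qed
      qed
    qed
  qed
  have small: "\<forall>\<^sub>F a in at_right 0. 0 < a \<and> a < \<rho>"
    using \<rho> by (auto simp: eventually_at_right_field)
  have res: "f a contour_integrable_on circlepath (of_real \<rho>) \<rho> \<and>
      contour_integral (circlepath (of_real \<rho>) \<rho>) (f a) = 2 * pi * \<i> * (1/2 + a)" if a: "0 < a \<and> a < \<rho>" for a
  proof -
    \<comment> \<open>The point \<open>- 2 - \<rho>\<close> is a dummy for b, outside both circles.
      Both circles enclose the only singularity a, so their integrals agree.\<close>
    have holo: "f a holomorphic_on - {- 2 - of_real \<rho>} - {of_real a}"
      unfolding f_def by (intro holomorphic_intros) auto
    have in1: "(of_real a :: complex) \<in> ball (of_real \<rho>) \<rho>"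
      using a by (simp add: dist_norm flip: of_real_diff)
    have b1: "- 2 - of_real \<rho> \<notin> cball (of_real \<rho> :: complex) \<rho>"
    proof -
      have "of_real \<rho> - (- 2 - of_real \<rho>) = (of_real (2 + 2 * \<rho>) :: complex)" by simp
      then have "dist (of_real \<rho>) (- 2 - of_real \<rho> :: complex) = 2 + 2 * \<rho>"
        unfolding dist_norm using \<rho> by (simp only: norm_of_real)
      then show ?thesis using \<rho> by simp
    qed
    have b2: "- 2 - of_real \<rho> \<notin> cball (of_real a :: complex) 1"
    proof -
      have "of_real a - (- 2 - of_real \<rho>) = (of_real (2 + \<rho> + a) :: complex)" by simp
      then have "dist (of_real a) (- 2 - of_real \<rho> :: complex) = 2 + \<rho> + a"
        unfolding dist_norm using \<rho> a[THEN conjunct1] by (simp only: norm_of_real)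
      then show ?thesis using \<rho> a by simp
    qed
    have s1: "sphere (of_real \<rho>) \<rho> \<inter> {of_real a} = ({} :: complex set)" using in1 by auto
    note R1 = contour_integral_circlepath_residues[OF holo _ \<rho> b1 s1]
    have s2: "sphere (of_real a) 1 \<inter> {of_real a} = ({} :: complex set)" by auto
    have one: "(1::real) > 0" by simp
    note R2 = contour_integral_circlepath_residues[OF holo _ one b2 s2]
    have "contour_integral (circlepath (of_real \<rho>) \<rho>) (f a) = contour_integral (circlepath (of_real a) 1) (f a)"
      using R1(2) R2(2) in1 by simp
    also have "\<dots> = 2 * pi * \<i> * (1/2 + a)"
      using contour_integral_exp_inverse_circlepath[of "of_real a"] by (simp add: f_def)
    finally show ?thesis using R1(1) by simp
  qed
  have ev: "\<forall>\<^sub>F a in at_right 0. f a contour_integrable_on circlepath (of_real \<rho>) \<rho>"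
    using small by eventually_elim (use res in blast)
  have vd: "norm (vector_derivative (circlepath (of_real \<rho>) \<rho>) (at t)) \<le> 2 * pi * \<rho>" for t
    using \<rho> by (simp add: vector_derivative_circlepath norm_mult)
  note L = contour_integral_uniform_limit[OF ev unif[unfolded C_def] vd valid_path_circlepath]
  have lim1: "((\<lambda>a. contour_integral (circlepath (of_real \<rho>) \<rho>) (f a)) \<longlongrightarrow>
      contour_integral (circlepath (of_real \<rho>) \<rho>) (f 0)) (at_right 0)"
    by (rule L(2)) simp
  have "((\<lambda>a::real. 2 * pi * \<i> * (1/2 + of_real a)) \<longlongrightarrow> 2 * pi * \<i> * (1/2 + of_real 0)) (at_right 0)"
    by (intro tendsto_intros)
  then have "((\<lambda>a. contour_integral (circlepath (of_real \<rho>) \<rho>) (f a)) \<longlongrightarrow> 2 * pi * \<i> * (1/2 + of_real 0)) (at_right 0)"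
  proof (rule Lim_transform_eventually)
    show "\<forall>\<^sub>F a in at_right 0. 2 * pi * \<i> * (1/2 + of_real a) = contour_integral (circlepath (of_real \<rho>) \<rho>) (f a)"
      by (rule eventually_mono[OF small]) (use res in simp)
  qed
  from tendsto_unique[OF _ lim1 this]
  have "contour_integral (circlepath (of_real \<rho>) \<rho>) (f 0) = pi * \<i>" by simp
  moreover have "f 0 contour_integrable_on circlepath (of_real \<rho>) \<rho>" by (rule L(1)) simp
  ultimately have "(f 0 has_contour_integral (pi * \<i>)) (circlepath (of_real \<rho>) \<rho>)"
    using has_contour_integral_integral by fastforce
  then show ?thesis by (simp add: f_def)
qed

subsection \<open>Merging and inverting discs\<close>

text \<open>Jensen's inequality for two points: exp lies above its tangent at the weighted mean m,
  and the weighted deviations from m cancel.\<close>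

lemma exp_weighted_mean:
  fixes x y :: real
  assumes "p > 0" "q > 0"
  shows "(p + q) * exp ((p * x + q * y) / (p + q)) \<le> p * exp x + q * exp y"
proof -
  define m where "m = (p * x + q * y) / (p + q)"
  have pq: "p + q > 0" using assms by simp
  have m: "p * (x - m) + q * (y - m) = 0" using pq by (simp add: m_def field_simps)
  have "exp m * (1 + (x - m)) \<le> exp m * exp (x - m)" "exp m * (1 + (y - m)) \<le> exp m * exp (y - m)"
    by (intro mult_left_mono exp_ge_add_one_self; simp)+
  then have "exp m * (1 + (x - m)) \<le> exp x" "exp m * (1 + (y - m)) \<le> exp y"
    by (simp_all flip: exp_add)
  then have "p * (exp m * (1 + (x - m))) + q * (exp m * (1 + (y - m))) \<le> p * exp x + q * exp y"
    using assms by (intro add_mono mult_left_mono) auto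
  also have "p * (exp m * (1 + (x - m))) + q * (exp m * (1 + (y - m)))
      = exp m * (p + q + (p * (x - m) + q * (y - m)))" by (simp add: algebra_simps)
  finally show ?thesis unfolding m by (simp add: m_def[symmetric] mult.commute)
qed

text \<open>Two meeting discs are replaced by the disc around their barycentre, weighted by the radii, whose
  radius is the sum. By convexity of \<open>exp\<close> the weight \<open>s * exp (Re C)\<close> does not grow.\<close>

lemma merge_discs:
  fixes Q :: "(complex \<times> real) set"
  assumes "finite Q" "\<And>q. q \<in> Q \<Longrightarrow> snd q > 0"
  obtains Q' where "finite Q'" "\<And>q. q \<in> Q' \<Longrightarrow> snd q > 0"
    "\<And>p q. p \<in> Q' \<Longrightarrow> q \<in> Q' \<Longrightarrow> p \<noteq> q \<Longrightarrow> cball (fst p) (snd p) \<inter> cball (fst q) (snd q) = {}"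
    "\<And>q. q \<in> Q \<Longrightarrow> \<exists>p\<in>Q'. ball (fst q) (snd q) \<subseteq> ball (fst p) (snd p)"
    "sum snd Q' \<le> sum snd Q"
    "(\<Sum>q\<in>Q'. snd q * exp (Re (fst q))) \<le> (\<Sum>q\<in>Q. snd q * exp (Re (fst q)))"
proof -
  \<comment> \<open>Closed discs are separated, because the boundary circles lead to contours that
    must avoid all other discs. Each merger lowers the number of discs.\<close>
  have "\<exists>Q'. finite Q' \<and> (\<forall>q\<in>Q'. snd q > 0) \<and>
      (\<forall>p\<in>Q'. \<forall>q\<in>Q'. p \<noteq> q \<longrightarrow> cball (fst p) (snd p) \<inter> cball (fst q) (snd q) = {}) \<and>
      (\<forall>q\<in>Q. \<exists>p\<in>Q'. ball (fst q) (snd q) \<subseteq> ball (fst p) (snd p)) \<and>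
      sum snd Q' \<le> sum snd Q \<and>
      (\<Sum>q\<in>Q'. snd q * exp (Re (fst q))) \<le> (\<Sum>q\<in>Q. snd q * exp (Re (fst q)))"
    using assms
  proof (induction "card Q" arbitrary: Q rule: less_induct)
    case less
    show ?case
    proof (cases "\<forall>p\<in>Q. \<forall>q\<in>Q. p \<noteq> q \<longrightarrow> cball (fst p) (snd p) \<inter> cball (fst q) (snd q) = {}")
      case True
      then show ?thesis using less.prems by (intro exI[of _ Q]) auto
    next
      case False
      then obtain p q z where pq: "p \<in> Q" "q \<in> Q" "p \<noteq> q" and z: "z \<in> cball (fst p) (snd p)" "z \<in> cball (fst q) (snd q)"
        by blast
      obtain a r b s where ab: "p = (a, r)" "q = (b, s)" by (metis surj_pair)
      have rs: "r > 0" "s > 0" using less.prems(2)[OF pq(1)] less.prems(2)[OF pq(2)] by (auto simp: ab)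
      have dab: "cmod (a - b) \<le> r + s"
        using z dist_triangle[of a b z] by (simp add: ab dist_norm[symmetric] dist_commute)
      define c where "c = (of_real r * a + of_real s * b) / of_real (r + s)"
      define Q1 where "Q1 = Q - {p, q}"
      define new where "new = (c, r + s)"
      have nz: "(of_real (r + s) :: complex) \<noteq> 0" using rs by (simp only: of_real_eq_0_iff)
      \<comment> \<open>The barycentre lies within s of a and within r of b, so the disc of radius r
        + s around it contains both.\<close>
      have "c - a = of_real (s / (r + s)) * (b - a)" "c - b = of_real (r / (r + s)) * (a - b)"
        using nz by (simp_all add: c_def field_simps)
      then have "cmod (c - a) = s / (r + s) * cmod (a - b)" "cmod (c - b) = r / (r + s) * cmod (a - b)"
        using abs_of_nonneg[of "s / (r + s)"] abs_of_nonneg[of "r / (r + s)"] rs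
        by (simp_all only: norm_mult norm_of_real norm_minus_commute[of b a]) simp_all
      moreover have "s / (r + s) * cmod (a - b) \<le> s / (r + s) * (r + s)" "r / (r + s) * cmod (a - b) \<le> r / (r + s) * (r + s)"
        using rs dab by (intro mult_left_mono; simp)+
      ultimately have ca: "cmod (c - a) \<le> s" "cmod (c - b) \<le> r" using rs by auto
      have sub: "ball a r \<subseteq> ball c (r + s)" "ball b s \<subseteq> ball c (r + s)"
      proof -
        show "ball a r \<subseteq> ball c (r + s)"
        proof
          fix x assume "x \<in> ball a r"
          then show "x \<in> ball c (r + s)" using dist_triangle[of c x a] ca(1) by (simp add: dist_norm)
        qed
        show "ball b s \<subseteq> ball c (r + s)"
        proof
          fix x assume "x \<in> ball b s"
          then show "x \<in> ball c (r + s)" using dist_triangle[of c x b] ca(2) by (simp add: dist_norm)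
        qed
      qed
      have Re_c: "Re c = (r * Re a + s * Re b) / (r + s)"
        by (simp add: c_def Re_divide_of_real del: of_real_add)
      have fin: "finite Q1" using less.prems by (simp add: Q1_def)
      have split: "sum f Q = f p + f q + sum f Q1" for f :: "complex \<times> real \<Rightarrow> real"
      proof -
        have "sum f Q = sum f (Q - {p, q}) + sum f {p, q}"
          by (rule sum.subset_diff) (use pq less.prems in auto)
        then show ?thesis using pq(3) by (simp add: Q1_def)
      qed
      \<comment> \<open>Only an inequality, since the new disc may coincide with one already
        present.\<close>
      have ins: "sum f (insert new Q1) \<le> f new + sum f Q1" if "f new \<ge> 0" for f :: "complex \<times> real \<Rightarrow> real"
        using fin that by (cases "new \<in> Q1") (auto simp: insert_absorb)
      have "card (insert new Q1) < card Q"
      proof -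
        have "card Q1 = card Q - 2" unfolding Q1_def using pq less.prems by (simp add: card_Diff_subset)
        moreover have "card Q \<ge> card {p, q}" using pq less.prems by (intro card_mono) auto
        moreover have "card (insert new Q1) \<le> Suc (card Q1)" using fin by (simp add: card_insert_if)
        ultimately show ?thesis using pq(3) by simp
      qed
      moreover have "finite (insert new Q1)" using fin by simp
      moreover have "snd x > 0" if "x \<in> insert new Q1" for x
      proof (cases "x = new")
        case True
        then show ?thesis using rs by (simp add: new_def)
      next
        case False
        then have "x \<in> Q" using that by (simp add: Q1_def)
        then show ?thesis by (rule less.prems(2))
      qed
      ultimately obtain Q' where Q': "finite Q'" "\<forall>q\<in>Q'. snd q > 0"
        "\<forall>p\<in>Q'. \<forall>q\<in>Q'. p \<noteq> q \<longrightarrow> cball (fst p) (snd p) \<inter> cball (fst q) (snd q) = {}"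
        "\<forall>q\<in>insert new Q1. \<exists>p\<in>Q'. ball (fst q) (snd q) \<subseteq> ball (fst p) (snd p)"
        "sum snd Q' \<le> sum snd (insert new Q1)"
        "(\<Sum>q\<in>Q'. snd q * exp (Re (fst q))) \<le> (\<Sum>q\<in>insert new Q1. snd q * exp (Re (fst q)))"
        using less.hyps[of "insert new Q1"] by blast
      have "sum snd (insert new Q1) \<le> sum snd Q"
        using ins[of snd] rs unfolding split[of snd] by (simp add: new_def ab)
      moreover have "(\<Sum>q\<in>insert new Q1. snd q * exp (Re (fst q))) \<le> (\<Sum>q\<in>Q. snd q * exp (Re (fst q)))"
        using ins[of "\<lambda>q. snd q * exp (Re (fst q))"] rs exp_weighted_mean[OF rs, of "Re a" "Re b"]
        unfolding split[of "\<lambda>q. snd q * exp (Re (fst q))"] by (simp add: new_def ab Re_c)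
      moreover have "\<exists>p\<in>Q'. ball (fst x) (snd x) \<subseteq> ball (fst p) (snd p)" if "x \<in> Q" for x
      proof (cases "x \<in> Q1")
        case True
        then show ?thesis using Q'(4) by blast
      next
        case False
        then have "x = p \<or> x = q" using that by (auto simp: Q1_def)
        then have "ball (fst x) (snd x) \<subseteq> ball (fst new) (snd new)" using sub by (auto simp: ab new_def)
        then show ?thesis using Q'(4) by blast
      qed
      ultimately show ?thesis using Q' by (intro exI[of _ Q']) auto
    qed
  qed
  then obtain Q' where Q': "finite Q'" "\<forall>q\<in>Q'. snd q > 0"
    "\<forall>p\<in>Q'. \<forall>q\<in>Q'. p \<noteq> q \<longrightarrow> cball (fst p) (snd p) \<inter> cball (fst q) (snd q) = {}"
    "\<forall>q\<in>Q. \<exists>p\<in>Q'. ball (fst q) (snd q) \<subseteq> ball (fst p) (snd p)" "sum snd Q' \<le> sum snd Q"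
    "(\<Sum>q\<in>Q'. snd q * exp (Re (fst q))) \<le> (\<Sum>q\<in>Q. snd q * exp (Re (fst q)))"
    by blast
  show ?thesis by (rule that[of Q']) (use Q' in blast)+
qed

text \<open>The projections of the discs to the real axis have total length at most
  \<open>2 * sum snd Q\<close>, less than the length of the interval from 1 to 2.\<close>

lemma vertical_line_missing_discs:
  fixes Q :: "(complex \<times> real) set"
  assumes Q: "finite Q" "\<And>q. q \<in> Q \<Longrightarrow> snd q > 0" "2 * sum snd Q < 1"
  obtains t where "1 < t" "t < 2" "\<And>q. q \<in> Q \<Longrightarrow> snd q < \<bar>Re (fst q) - t\<bar>"
proof -
  define I where "I q = {Re (fst q) - snd q .. Re (fst q) + snd q}" for q :: "complex \<times> real"
  have I: "I q \<in> fmeasurable lborel" for q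
    unfolding I_def using fmeasurable_cbox[where 'a = real] by (simp only: box_real)
  have "\<not> {1<..<2::real} \<subseteq> (\<Union>q\<in>Q. I q)"
  proof
    assume sub: "{1<..<2::real} \<subseteq> (\<Union>q\<in>Q. I q)"
    have "measure lborel {1<..<2::real} \<le> measure lborel (\<Union>q\<in>Q. I q)"
      by (rule measure_mono_fmeasurable[OF sub]) (use I Q in \<open>auto intro!: fmeasurable.finite_UN\<close>)
    also have "\<dots> \<le> (\<Sum>q\<in>Q. measure lborel (I q))"
      by (rule measure_UNION_le[OF Q(1)]) (simp add: I_def)
    also have "\<dots> = (\<Sum>q\<in>Q. 2 * snd q)"
      by (rule sum.cong) (use Q(2) in \<open>auto simp: I_def less_imp_le\<close>)
    also have "\<dots> = 2 * sum snd Q" by (simp add: sum_distrib_left)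
    finally show False using Q(3) by simp
  qed
  then obtain t where t: "t \<in> {1<..<2}" "t \<notin> (\<Union>q\<in>Q. I q)" by blast
  show ?thesis
  proof (rule that[of t])
    fix q assume "q \<in> Q"
    then have "t \<notin> I q" using t by blast
    then show "snd q < \<bar>Re (fst q) - t\<bar>" by (auto simp: I_def)
  qed (use t in auto)
qed

text \<open>Centre, and below it radius, of the image under w = 1 / z of the disc with centre C and
  radius s, when 0 is outside the closed disc.\<close>

definition inv_center :: "complex \<Rightarrow> real \<Rightarrow> complex" where
  "inv_center C s = cnj C / of_real ((cmod C)\<^sup>2 - s\<^sup>2)"

definition inv_radius :: "complex \<Rightarrow> real \<Rightarrow> real" where
  "inv_radius C s = s / ((cmod C)\<^sup>2 - s\<^sup>2)"

text \<open>After multiplication by the positive factors \<open>|z|^2\<close> and \<open>D\<close>,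
  both conditions compare the same real quadratic \<open>D * |z|^2 - 2 * Re (C * z) + 1\<close> with
  0.\<close>

lemma inversion_disc:
  assumes s: "0 < s" "s < cmod C" and z: "z \<noteq> 0"
  shows "cmod (z - inv_center C s) < inv_radius C s \<longleftrightarrow> cmod (1 / z - C) < s"
    and "cmod (z - inv_center C s) = inv_radius C s \<longleftrightarrow> cmod (1 / z - C) = s"
proof -
  define D where "D = (cmod C)\<^sup>2 - s\<^sup>2"
  have D: "D > 0" using s by (simp add: D_def power_strict_mono)
  have r: "inv_radius C s \<ge> 0" using D s by (simp add: inv_radius_def D_def[symmetric])
  have D': "D = (Re C)\<^sup>2 + (Im C)\<^sup>2 - s\<^sup>2" by (simp add: D_def cmod_power2)
  have e1: "(cmod z)\<^sup>2 * ((cmod (1 / z - C))\<^sup>2 - s\<^sup>2) = D * (cmod z)\<^sup>2 - 2 * Re (C * z) + 1"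
  proof -
    have "z * (1 / z - C) = 1 - C * z"
      using z by (simp add: right_diff_distrib mult.commute)
    then have "cmod z * cmod (1 / z - C) = cmod (1 - C * z)"
      by (metis norm_mult)
    then have "(cmod z)\<^sup>2 * (cmod (1 / z - C))\<^sup>2 = (cmod (1 - C * z))\<^sup>2"
      by (metis power_mult_distrib)
    also have "\<dots> = 1 - 2 * Re (C * z) + (cmod C)\<^sup>2 * (cmod z)\<^sup>2"
      unfolding cmod_power2 by (simp add: power2_eq_square algebra_simps)
    finally show ?thesis by (simp add: D_def algebra_simps)
  qed
  have e2: "D * ((cmod (z - inv_center C s))\<^sup>2 - (inv_radius C s)\<^sup>2) = D * (cmod z)\<^sup>2 - 2 * Re (C * z) + 1"
  proof -
    have "of_real D * (z - inv_center C s) = of_real D * z - cnj C"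
      using D by (simp add: inv_center_def D_def[symmetric] algebra_simps)
    then have "D * cmod (z - inv_center C s) = cmod (of_real D * z - cnj C)"
      using D by (metis abs_of_pos norm_mult norm_of_real)
    then have "D\<^sup>2 * (cmod (z - inv_center C s))\<^sup>2 = (cmod (of_real D * z - cnj C))\<^sup>2"
      by (metis power_mult_distrib)
    also have "\<dots> = D\<^sup>2 * (cmod z)\<^sup>2 - 2 * D * Re (C * z) + (cmod C)\<^sup>2"
      unfolding cmod_power2 by (simp add: power2_eq_square algebra_simps)
    finally have 1: "D\<^sup>2 * (cmod (z - inv_center C s))\<^sup>2 = D\<^sup>2 * (cmod z)\<^sup>2 - 2 * D * Re (C * z) + (cmod C)\<^sup>2" .
    have "D * inv_radius C s = s" using D by (simp add: inv_radius_def D_def[symmetric])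
    then have 2: "D\<^sup>2 * (inv_radius C s)\<^sup>2 = s\<^sup>2" by (metis power_mult_distrib)
    have "D * (D * ((cmod (z - inv_center C s))\<^sup>2 - (inv_radius C s)\<^sup>2)) = D * (D * (cmod z)\<^sup>2 - 2 * Re (C * z) + 1)"
      using 1 2 by (simp add: D_def[symmetric] power2_eq_square algebra_simps) (simp add: D_def power2_eq_square)
    then show ?thesis using D by simp
  qed
  have e: "(cmod z)\<^sup>2 * ((cmod (1 / z - C))\<^sup>2 - s\<^sup>2) = D * ((cmod (z - inv_center C s))\<^sup>2 - (inv_radius C s)\<^sup>2)"
    using e1 e2 by simp
  have z2: "(cmod z)\<^sup>2 > 0" using z by simp
  have lt: "(cmod (z - inv_center C s))\<^sup>2 - (inv_radius C s)\<^sup>2 < 0 \<longleftrightarrow> (cmod (1 / z - C))\<^sup>2 - s\<^sup>2 < 0"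
    using e z2 D by (metis mult_less_0_iff not_less_iff_gr_or_eq)
  have eq: "(cmod (z - inv_center C s))\<^sup>2 - (inv_radius C s)\<^sup>2 = 0 \<longleftrightarrow> (cmod (1 / z - C))\<^sup>2 - s\<^sup>2 = 0"
    using e z2 D by (metis mult_eq_0_iff less_irrefl)
  show "cmod (z - inv_center C s) < inv_radius C s \<longleftrightarrow> cmod (1 / z - C) < s"
    using lt r s by (metis diff_less_0_iff_less norm_ge_zero power_less_imp_less_base power_strict_mono less_imp_le zero_less_numeral)
  show "cmod (z - inv_center C s) = inv_radius C s \<longleftrightarrow> cmod (1 / z - C) = s"
    using eq r s by (metis diff_eq_diff_eq diff_self norm_ge_zero power2_eq_iff_nonneg less_imp_le eq_iff_diff_eq_0)
qed

lemma zero_notin_inversion_disc: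
  assumes "0 < s" "s < cmod C"
  shows "0 \<notin> cball (inv_center C s) (inv_radius C s)" "inv_radius C s > 0"
proof -
  have D: "(cmod C)\<^sup>2 - s\<^sup>2 > 0" using assms by (simp add: power_strict_mono)
  have "cmod (inv_center C s) = cmod C / ((cmod C)\<^sup>2 - s\<^sup>2)"
    unfolding inv_center_def norm_divide norm_of_real using D by simp
  then show "0 \<notin> cball (inv_center C s) (inv_radius C s)"
    using D assms by (simp add: inv_radius_def dist_norm divide_less_cancel not_le)
  show "inv_radius C s > 0" using D assms by (simp add: inv_radius_def)
qed

text \<open>The inverse of a vertical line is the circle of diameter 1 / t tangent to the imaginary
  axis at 0; t = 1 gives the disc that contains K. All claims are read off from the sign of
  \<open>|z - \<rho>|^2 - \<rho>^2\<close>.\<close>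

lemma inversion_halfplane:
  assumes "t > 0" "z \<noteq> 0"
  shows "cmod (z - of_real (1 / (2 * t))) < 1 / (2 * t) \<longleftrightarrow> t < Re (1 / z)"
    and "cmod (z - of_real (1 / (2 * t))) = 1 / (2 * t) \<longleftrightarrow> t = Re (1 / z)"
    and "cmod (z - of_real (1 / (2 * t))) \<le> 1 / (2 * t) \<longleftrightarrow> t \<le> Re (1 / z)"
proof -
  define \<rho> where "\<rho> = 1 / (2 * t)"
  have \<rho>: "\<rho> > 0" "2 * t * \<rho> = 1" using assms by (auto simp: \<rho>_def)
  have z2: "(cmod z)\<^sup>2 > 0" using assms by simp
  have Rz: "Re (1 / z) = Re z / (cmod z)\<^sup>2" by (simp add: Re_divide cmod_power2)
  have e: "(cmod (z - of_real \<rho>))\<^sup>2 - \<rho>\<^sup>2 = 2 * \<rho> * (cmod z)\<^sup>2 * (t - Re (1 / z))"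
  proof -
    have "(cmod (z - of_real \<rho>))\<^sup>2 - \<rho>\<^sup>2 = (cmod z)\<^sup>2 - 2 * \<rho> * Re z"
      unfolding cmod_power2 by (simp add: power2_eq_square algebra_simps)
    also have "(cmod z)\<^sup>2 = 2 * t * \<rho> * (cmod z)\<^sup>2" using \<rho>(2) by simp
    also have "Re z = (cmod z)\<^sup>2 * Re (1 / z)" using z2 Rz by simp
    finally show ?thesis by (simp add: algebra_simps)
  qed
  have pos: "2 * \<rho> * (cmod z)\<^sup>2 > 0" using \<rho> z2 by simp
  have lt: "(cmod (z - of_real \<rho>))\<^sup>2 - \<rho>\<^sup>2 < 0 \<longleftrightarrow> t - Re (1 / z) < 0"
    unfolding e using pos by (metis mult_less_0_iff order_less_not_sym)
  have eq: "(cmod (z - of_real \<rho>))\<^sup>2 - \<rho>\<^sup>2 = 0 \<longleftrightarrow> t - Re (1 / z) = 0"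
    unfolding e using pos by (simp only: mult_eq_0_iff) auto
  have 1: "cmod (z - of_real \<rho>) < \<rho> \<longleftrightarrow> t < Re (1 / z)"
    using lt \<rho>(1) by (metis diff_less_0_iff_less norm_ge_zero power_less_imp_less_base power_strict_mono less_imp_le zero_less_numeral)
  have 2: "cmod (z - of_real \<rho>) = \<rho> \<longleftrightarrow> t = Re (1 / z)"
    using eq \<rho>(1) by (metis diff_eq_diff_eq diff_self norm_ge_zero power2_eq_iff_nonneg less_imp_le eq_iff_diff_eq_0)
  show "cmod (z - of_real (1 / (2 * t))) < 1 / (2 * t) \<longleftrightarrow> t < Re (1 / z)" using 1 by (simp add: \<rho>_def)
  show "cmod (z - of_real (1 / (2 * t))) = 1 / (2 * t) \<longleftrightarrow> t = Re (1 / z)" using 2 by (simp add: \<rho>_def)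
  show "cmod (z - of_real (1 / (2 * t))) \<le> 1 / (2 * t) \<longleftrightarrow> t \<le> Re (1 / z)"
    using 1 2 unfolding \<rho>_def by (auto simp: le_less)
qed

subsection \<open>Failure of approximation near 0\<close>

text \<open>The map \<open>w = 1 / z\<close> sends the hole with centre \<open>a\<close> and radius \<open>\<rho>\<close> into the disc with centre
  \<open>1 / a\<close> and radius \<open>\<rho> / (\<bar>a\<bar> - \<rho>)\<^sup>2\<close>; the exponential bounds \<open>\<bar>exp (1 / a)\<bar>\<close>.\<close>

definition hole_weight :: "complex \<times> real \<Rightarrow> real" where
  "hole_weight h = snd h / (cmod (fst h) - snd h)\<^sup>2 * exp (1 / (cmod (fst h) - snd h))"

text \<open>\<open>|1 / a - 1 / z| = |z - a| / (|a| * |z|)\<close>, and both factors below are at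
  least \<open>|a| - s\<close>. Unlike the exact image, this enclosing disc is centred at
  \<open>1 / a\<close>, whose real part is easily bounded.\<close>

lemma inverse_in_ball:
  assumes h: "0 < s" "s < cmod a" and z: "z \<in> ball a s"
  shows "z \<noteq> 0" "1 / z \<in> ball (1 / a) (s / (cmod a - s)\<^sup>2)"
proof -
  define d where "d = cmod a - s"
  have d: "d > 0" "d \<le> cmod a" using h by (auto simp: d_def)
  have za: "cmod (z - a) < s" using z by (simp add: dist_norm norm_minus_commute)
  have zd: "d \<le> cmod z" using norm_triangle_ineq3[of z a] za by (simp add: d_def abs_le_iff)
  then show z0: "z \<noteq> 0" using d by auto
  have a0: "a \<noteq> 0" using h by auto
  have "1 / a - 1 / z = (z - a) / (a * z)" using a0 z0 by (simp add: field_simps)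
  then have "dist (1 / a) (1 / z) = cmod (z - a) / (cmod a * cmod z)"
    by (simp add: dist_norm norm_divide norm_mult)
  also have "\<dots> \<le> cmod (z - a) / (d * d)"
    using d zd by (intro divide_left_mono mult_mono mult_pos_pos) auto
  also have "\<dots> < s / (d * d)" using za d by (intro divide_strict_right_mono) auto
  finally show "1 / z \<in> ball (1 / a) (s / (cmod a - s)\<^sup>2)" by (simp add: d_def power2_eq_square)
qed

text \<open>The error is integrated over a circle \<open>Re (1 / z) = t\<close>, which is tangent to the imaginary axis
  at 0, and over the inverses of the finitely many merged discs inside it. The integral of \<open>F\<close> over the former
  is the sum of its integrals over the latter, whereas \<open>z * exp (1 / z)\<close> contributes \<open>\<pi> * \<i>\<close>.\<close>

lemma cannot_approximate_exp_inverse: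
  assumes H: "\<And>h. h \<in> H \<Longrightarrow> 0 < snd h \<and> snd h < cmod (fst h)"
    and W: "\<And>X. finite X \<Longrightarrow> X \<subseteq> H \<Longrightarrow> sum hole_weight X \<le> 1/8"
    and holo: "F holomorphic_on - {b} - P" and P: "finite P" and b: "b \<notin> cball (1/2) (1/2)"
    and G: "open G" "cball (1/2) (1/2) - holes H \<subseteq> G" "G \<inter> P = {}"
    and err: "\<And>z. z \<in> G \<Longrightarrow> z \<noteq> 0 \<Longrightarrow> cmod (F z - z * exp (1 / z)) \<le> exp (Re (1 / z)) / 20 + 1 / 20"
  shows False
proof -
  \<comment> \<open>Openness of G reduces the infinite family to finitely many holes that cover the
    part of the disc outside G.\<close>
  have "compact (cball (1/2) (1/2) - G)" using G(1) by (intro compact_diff) auto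
  moreover have "cball (1/2) (1/2) - G \<subseteq> holes H" using G(2) by auto
  ultimately obtain H' where H': "H' \<subseteq> H" "finite H'" "cball (1/2) (1/2) - G \<subseteq> holes H'"
    using compactE_image[of "cball (1/2) (1/2) - G" H hole] by (metis open_ball)
  define wd where "wd h = (1 / fst h, snd h / (cmod (fst h) - snd h)\<^sup>2)" for h :: "complex \<times> real"
  define Q0 where "Q0 = wd ` H'"
  have Hp: "0 < snd h" "snd h < cmod (fst h)" if "h \<in> H'" for h using H[of h] H' that by blast+
  have wd: "0 < snd (wd h)" "snd (wd h) \<le> hole_weight h" "snd (wd h) * exp (Re (fst (wd h))) \<le> hole_weight h"
    if h: "h \<in> H'" for h
  proof -
    show pos: "0 < snd (wd h)" using Hp[OF h] by (simp add: wd_def)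
    have "snd (wd h) * 1 \<le> hole_weight h"
      unfolding hole_weight_def wd_def using Hp[OF h] by (intro mult_mono) auto
    then show "snd (wd h) \<le> hole_weight h" by simp
    have "Re (1 / fst h) \<le> cmod (1 / fst h)" by (rule complex_Re_le_cmod)
    also have "\<dots> \<le> 1 / (cmod (fst h) - snd h)"
      unfolding norm_divide using Hp[OF h] by (intro frac_le) auto
    finally show "snd (wd h) * exp (Re (fst (wd h))) \<le> hole_weight h"
      unfolding hole_weight_def wd_def using Hp[OF h] by (intro mult_mono) auto
  qed
  have Q0: "finite Q0" "\<And>q. q \<in> Q0 \<Longrightarrow> snd q > 0"
    using H'(2) wd(1) by (auto simp: Q0_def)
  have push: "sum f Q0 \<le> 1/8" if "\<And>h. h \<in> H' \<Longrightarrow> 0 \<le> f (wd h)" "\<And>h. h \<in> H' \<Longrightarrow> f (wd h) \<le> hole_weight h"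
    for f :: "complex \<times> real \<Rightarrow> real"
  proof -
    have "sum f Q0 \<le> sum (f \<circ> wd) H'" unfolding Q0_def by (rule sum_image_le) (use H' that in auto)
    also have "\<dots> \<le> sum hole_weight H'" by (rule sum_mono) (use that in auto)
    also have "\<dots> \<le> 1/8" using W H' by blast
    finally show ?thesis .
  qed
  \<comment> \<open>The exponential sum bounds the inner contour integrals; the plain sum leaves
    room for a vertical line and keeps each merged radius below 1.\<close>
  have W1: "(\<Sum>q\<in>Q0. snd q * exp (Re (fst q))) \<le> 1/8"
    by (rule push) (use wd in \<open>auto intro: less_imp_le\<close>)
  have W2: "sum snd Q0 \<le> 1/8"
    by (rule push) (use wd in \<open>auto intro: less_imp_le\<close>)
  obtain Q where Q: "finite Q" "\<And>q. q \<in> Q \<Longrightarrow> snd q > 0"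
    "\<And>p q. p \<in> Q \<Longrightarrow> q \<in> Q \<Longrightarrow> p \<noteq> q \<Longrightarrow> cball (fst p) (snd p) \<inter> cball (fst q) (snd q) = {}"
    "\<And>q. q \<in> Q0 \<Longrightarrow> \<exists>p\<in>Q. ball (fst q) (snd q) \<subseteq> ball (fst p) (snd p)"
    "sum snd Q \<le> sum snd Q0" "(\<Sum>q\<in>Q. snd q * exp (Re (fst q))) \<le> (\<Sum>q\<in>Q0. snd q * exp (Re (fst q)))"
    by (rule merge_discs[OF Q0]) blast+
  have QW: "sum snd Q \<le> 1/8" "(\<Sum>q\<in>Q. snd q * exp (Re (fst q))) \<le> 1/8"
    using Q(5,6) W1 W2 by linarith+
  obtain t where t: "1 < t" "t < 2" "\<And>q. q \<in> Q \<Longrightarrow> snd q < \<bar>Re (fst q) - t\<bar>"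
  proof (rule vertical_line_missing_discs[OF Q(1,2)])
    show "2 * sum snd Q < 1" using QW(1) by simp
  qed blast+
  define \<rho> where "\<rho> = 1 / (2 * t)"
  have \<rho>: "\<rho> > 0" "\<rho> \<le> 1/2" using t by (auto simp: \<rho>_def field_simps)
  have t0: "t > 0" using t by simp
  have D0: "z \<in> cball (1/2) (1/2) \<longleftrightarrow> 1 \<le> Re (1 / z)" if "z \<noteq> 0" for z
    using inversion_halfplane(3)[of 1 z] that by (simp add: dist_norm norm_minus_commute)
  have Gam: "z \<in> ball (of_real \<rho>) \<rho> \<longleftrightarrow> t < Re (1 / z)" "z \<in> sphere (of_real \<rho>) \<rho> \<longleftrightarrow> t = Re (1 / z)"
    "z \<in> cball (of_real \<rho>) \<rho> \<longleftrightarrow> t \<le> Re (1 / z)" if "z \<noteq> 0" for z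
    using inversion_halfplane[OF t0 that] by (simp_all add: dist_norm norm_minus_commute \<rho>_def)
  have zero: "0 \<in> G"
  proof -
    have "0 \<notin> hole h" if "h \<in> H" for h using H[OF that] by auto
    then have "(0::complex) \<in> cball (1/2) (1/2) - holes H" by auto
    then show ?thesis using G by blast
  qed
  \<comment> \<open>Points of the disc whose inverses avoid the merged discs are off
    \<open>holes H'\<close>, hence in G. This places all contours in G.\<close>
  have inG: "z \<in> G" if "1 \<le> Re (1 / z)" "z \<noteq> 0" "\<And>q. q \<in> Q \<Longrightarrow> 1 / z \<notin> ball (fst q) (snd q)" for z
  proof (rule ccontr)
    assume "z \<notin> G"
    then have "z \<in> holes H'" using D0 that H'(3) by blast
    then obtain h where h: "h \<in> H'" "z \<in> hole h" by blast
    have "1 / z \<in> ball (fst (wd h)) (snd (wd h))"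
      using inverse_in_ball(2)[OF Hp[OF h(1)] h(2)] by (simp add: wd_def)
    moreover have "wd h \<in> Q0" using h by (simp add: Q0_def)
    ultimately show False using Q(4) that(3) by blast
  qed
  \<comment> \<open>The discs to the right of the line, whose inverses lie inside the tangent
    circle; by the choice of t no disc meets the line.\<close>
  define I where "I = {q \<in> Q. t + snd q < Re (fst q)}"
  define ctr where "ctr q = inv_center (fst q) (snd q)" for q
  define rad where "rad q = inv_radius (fst q) (snd q)" for q
  have I: "q \<in> Q" "0 < snd q" "snd q < cmod (fst q)" "t + snd q < Re (fst q)" if "q \<in> I" for q
    using that Q(2)[of q] complex_Re_le_cmod[of "fst q"] t0 by (auto simp: I_def)
  have finI: "finite I" using Q by (simp add: I_def)
  have rad: "rad q > 0" "rad q \<le> snd q" if "q \<in> I" for q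
  proof -
    show "rad q > 0" unfolding rad_def using I[OF that] by (intro zero_notin_inversion_disc)
    \<comment> \<open>\<open>|C| \<ge> Re C > t + s > 1 + s\<close> gives
      \<open>|C|^2 - s^2 \<ge> 1\<close>, so inversion does not enlarge the disc.\<close>
    have "cmod (fst q) - snd q \<ge> 1" using I[OF that] t complex_Re_le_cmod[of "fst q"] by linarith
    then have "1 * 1 \<le> (cmod (fst q) - snd q) * (cmod (fst q) + snd q)"
      using I[OF that] by (intro mult_mono) auto
    then have "(cmod (fst q))\<^sup>2 - (snd q)\<^sup>2 \<ge> 1" by (simp add: power2_eq_square algebra_simps)
    then show "rad q \<le> snd q" unfolding rad_def inv_radius_def using I[OF that] by (simp add: divide_le_eq)
  qed
  have nz: "z \<noteq> 0" if "q \<in> I" "z \<in> cball (ctr q) (rad q)" for q z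
    using zero_notin_inversion_disc(1)[OF I(2,3)[OF that(1)]] that unfolding ctr_def rad_def by metis
  have inv: "z \<in> ball (ctr q) (rad q) \<longleftrightarrow> 1 / z \<in> ball (fst q) (snd q)"
    "z \<in> sphere (ctr q) (rad q) \<longleftrightarrow> 1 / z \<in> sphere (fst q) (snd q)"
    "z \<in> cball (ctr q) (rad q) \<longleftrightarrow> 1 / z \<in> cball (fst q) (snd q)" if "q \<in> I" "z \<noteq> 0" for q z
    using inversion_disc[OF I(2,3)[OF that(1)] that(2)]
    by (auto simp: ctr_def rad_def dist_norm norm_minus_commute le_less)
  have Re_in: "t < Re (1 / z)" "Re (1 / z) \<le> Re (fst q) + snd q" if "q \<in> I" "z \<in> cball (ctr q) (rad q)" for q z
  proof -
    have "1 / z \<in> cball (fst q) (snd q)" using inv(3)[OF that(1) nz[OF that]] that by simp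
    then have "\<bar>Re (1 / z - fst q)\<bar> \<le> snd q"
      using abs_Re_le_cmod[of "1 / z - fst q"] by (simp add: dist_norm norm_minus_commute)
    then show "t < Re (1 / z)" "Re (1 / z) \<le> Re (fst q) + snd q" using I(4)[OF that(1)] by auto
  qed
  have b_out: "b \<notin> cball (of_real \<rho>) \<rho>"
  proof
    assume bb: "b \<in> cball (of_real \<rho>) \<rho>"
    show False
    proof (cases "b = 0")
      case True then show ?thesis using b by simp
    next
      case False
      then show ?thesis using Gam(3)[of b] D0[of b] bb b t by auto
    qed
  qed
  have b_out': "b \<notin> cball (ctr q) (rad q)" if "q \<in> I" for q
  proof
    assume bb: "b \<in> cball (ctr q) (rad q)"
    show False using Re_in(1)[OF that bb] nz[OF that bb] D0[of b] b t by auto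
  qed
  have sphG: "sphere (ctr q) (rad q) \<subseteq> G" if q: "q \<in> I" for q
  proof
    fix z assume z: "z \<in> sphere (ctr q) (rad q)"
    then have zc: "z \<in> cball (ctr q) (rad q)" by auto
    have z0: "z \<noteq> 0" by (rule nz[OF q zc])
    have s: "1 / z \<in> sphere (fst q) (snd q)" using inv(2)[OF q z0] z by simp
    show "z \<in> G"
    proof (rule inG[OF _ z0])
      show "1 \<le> Re (1 / z)" using Re_in(1)[OF q zc] t by simp
      fix p assume p: "p \<in> Q"
      show "1 / z \<notin> ball (fst p) (snd p)"
      proof
        assume a: "1 / z \<in> ball (fst p) (snd p)"
        then have "p \<noteq> q" using s by auto
        moreover have "1 / z \<in> cball (fst p) (snd p)" "1 / z \<in> cball (fst q) (snd q)" using a s by simp_all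
        ultimately show False using Q(3)[OF p I(1)[OF q]] by blast
      qed
    qed
  qed
  have gamG: "sphere (of_real \<rho>) \<rho> \<subseteq> G"
  proof
    fix z :: complex assume z: "z \<in> sphere (of_real \<rho>) \<rho>"
    show "z \<in> G"
    proof (cases "z = 0")
      case True then show ?thesis using zero by simp
    next
      case False
      have R: "t = Re (1 / z)" using Gam(2)[OF False] z by simp
      show ?thesis
      proof (rule inG[OF _ False])
        show "1 \<le> Re (1 / z)" using R t by linarith
        fix p assume p: "p \<in> Q"
        show "1 / z \<notin> ball (fst p) (snd p)"
          using t(3)[OF p] abs_Re_le_cmod[of "fst p - 1 / z"] R by (auto simp: dist_norm)
      qed
    qed
  qed
  \<comment> \<open>A pole is outside G, so if it lies inside the tangent circle its inverse is in a
    merged disc, which must be to the right of the line. Thus the residues are distributed over the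
    inner circles.\<close>
  have Pin: "P \<inter> ball (of_real \<rho>) \<rho> = (\<Union>q\<in>I. P \<inter> ball (ctr q) (rad q))"
  proof (intro set_eqI iffI)
    fix p assume p: "p \<in> P \<inter> ball (of_real \<rho>) \<rho>"
    then have p0: "p \<noteq> 0" using zero G(3) by auto
    have pt: "t < Re (1 / p)" using Gam(1)[OF p0] p by simp
    have "p \<notin> G" using p G(3) by auto
    then obtain q where q: "q \<in> Q" "1 / p \<in> ball (fst q) (snd q)" using inG[OF _ p0] pt t by force
    have "\<bar>Re (fst q - 1 / p)\<bar> < snd q"
      using abs_Re_le_cmod[of "fst q - 1 / p"] q(2) by (simp add: dist_norm)
    then have qI: "q \<in> I" using t(3)[OF q(1)] pt q(1) by (auto simp: I_def abs_less_iff)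
    then show "p \<in> (\<Union>q\<in>I. P \<inter> ball (ctr q) (rad q))" using inv(1)[OF qI p0] q p by auto
  next
    fix p assume "p \<in> (\<Union>q\<in>I. P \<inter> ball (ctr q) (rad q))"
    then obtain q where q: "q \<in> I" "p \<in> P" "p \<in> cball (ctr q) (rad q)" by (auto simp: less_imp_le)
    then show "p \<in> P \<inter> ball (of_real \<rho>) \<rho>" using Gam(1)[OF nz[OF q(1,3)]] Re_in(1)[OF q(1,3)] by simp
  qed
  have disj: "P \<inter> ball (ctr q) (rad q) \<inter> (P \<inter> ball (ctr q') (rad q')) = {}" if "q \<in> I" "q' \<in> I" "q \<noteq> q'" for q q'
  proof (rule ccontr)
    assume "\<not> ?thesis"
    then obtain z where "z \<in> ball (ctr q) (rad q)" "z \<in> ball (ctr q') (rad q')" by blast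
    then have z: "z \<in> cball (ctr q) (rad q)" "z \<in> cball (ctr q') (rad q')" by simp_all
    have "1 / z \<in> cball (fst q) (snd q)" "1 / z \<in> cball (fst q') (snd q')"
      using inv(3)[OF that(1) nz[OF that(1) z(1)]] inv(3)[OF that(2) nz[OF that(2) z(2)]] z by auto
    then show False using Q(3)[OF I(1)[OF that(1)] I(1)[OF that(2)] that(3)] by blast
  qed
  have s1: "sphere (of_real \<rho>) \<rho> \<inter> P = {}" using gamG G(3) by blast
  have s2: "sphere (ctr q) (rad q) \<inter> P = {}" if "q \<in> I" for q using sphG[OF that] G(3) by blast
  note R1 = contour_integral_circlepath_residues[OF holo P \<rho>(1) b_out s1]
  note R2 = contour_integral_circlepath_residues[OF holo P rad(1) b_out' s2]
  define J where "J q = contour_integral (circlepath (ctr q) (rad q)) F" for q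
  have "contour_integral (circlepath (of_real \<rho>) \<rho>) F = 2 * pi * \<i> * (\<Sum>q\<in>I. \<Sum>p\<in>P \<inter> ball (ctr q) (rad q). residue F p)"
    unfolding R1(2) Pin by (subst sum.UNION_disjoint) (use finI P disj in auto)
  also have "\<dots> = (\<Sum>q\<in>I. J q)"
    unfolding J_def sum_distrib_left[of _ _ I] by (rule sum.cong[OF refl]) (use R2(2) in metis)
  finally have total: "contour_integral (circlepath (of_real \<rho>) \<rho>) F = (\<Sum>q\<in>I. J q)" .
  \<comment> \<open>On the tangent circle \<open>Re (1 / z) = t < 2\<close>, so the error there is
    at most 8/20 + 1/20 = 9/20, over a length of at most pi.\<close>
  have e2: "exp (2::real) \<le> 8"
  proof -
    have "exp (2::real) = exp 1 * exp 1" by (simp flip: exp_add)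
    also have "\<dots> \<le> (272/100) * (272/100)" using e_less_272 by (intro mult_mono) auto
    finally show ?thesis by simp
  qed
  have outer: "cmod ((\<Sum>q\<in>I. J q) - pi * \<i>) \<le> 9 * pi / 20"
  proof -
    have "cmod ((\<Sum>q\<in>I. J q) - pi * \<i>) \<le> (9 / 20) * (2 * pi * \<rho>)"
    proof (rule has_contour_integral_bound_circlepath_strong)
      show "((\<lambda>z. F z - z * exp (1 / z)) has_contour_integral ((\<Sum>q\<in>I. J q) - pi * \<i>)) (circlepath (of_real \<rho>) \<rho>)"
        using has_contour_integral_integral[OF R1(1)] unfolding total
        by (intro has_contour_integral_diff has_contour_integral_exp_inverse_tangent_circle \<rho>)
      \<comment> \<open>The tangent point 0 is the one exceptional point, as the error is estimated
        only off 0.\<close>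
      show "cmod (F z - z * exp (1 / z)) \<le> 9 / 20" if z: "cmod (z - of_real \<rho>) = \<rho>" "z \<notin> {0}" for z
      proof -
        have zs: "z \<in> sphere (of_real \<rho>) \<rho>" "z \<noteq> 0" using z by (auto simp: dist_norm norm_minus_commute)
        then have "t = Re (1 / z)" using Gam(2) by blast
        then have "exp (Re (1 / z)) \<le> exp 2" using t by simp
        then show ?thesis using err[OF subsetD[OF gamG zs(1)] zs(2)] e2 by linarith
      qed
    qed (use \<rho> in auto)
    also have "\<dots> \<le> (9 / 20) * (2 * pi * (1/2))" using \<rho> by (intro mult_left_mono) auto
    finally show ?thesis by simp
  qed
  have inner: "cmod (J q) \<le> pi / 10 * (snd q + 3 * (snd q * exp (Re (fst q))))" if q: "q \<in> I" for q
  proof -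
    have sq: "snd q \<le> 1"
    proof -
      have "sum snd {q} \<le> sum snd Q"
        by (rule sum_mono2) (use Q I(1)[OF q] in \<open>auto intro: less_imp_le\<close>)
      then show ?thesis using QW(1) by simp
    qed
    \<comment> \<open>In the right half-plane \<open>z * exp (1 / z)\<close> is holomorphic, so on
      inner circles the integral of F equals that of the error.\<close>
    have hc: "cball (ctr q) (rad q) \<subseteq> {z. Re z > 0}"
    proof
      fix z assume z: "z \<in> cball (ctr q) (rad q)"
      have "Re (1 / z) > 0" using Re_in(1)[OF q z] t by simp
      moreover have "Re (1 / z) = Re z / (cmod z)\<^sup>2" by (simp add: Re_divide cmod_power2)
      ultimately have "Re z > 0" by (metis zero_less_divide_iff zero_le_power2 not_less)
      then show "z \<in> {z. Re z > 0}" by simp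
    qed
    have "((\<lambda>z. z * exp (1 / z)) has_contour_integral 0) (circlepath (ctr q) (rad q))"
    proof (rule Cauchy_theorem_convex_simple[where S = "{z. Re z > 0}"])
      show "(\<lambda>z. z * exp (1 / z)) holomorphic_on {z. Re z > 0}" by (intro holomorphic_intros) auto
      show "path_image (circlepath (ctr q) (rad q)) \<subseteq> {z. Re z > 0}"
        using hc rad[OF q] by (force simp: path_image_circlepath)
    qed (auto simp: convex_halfspace_Re_gt)
    then have hi: "((\<lambda>z. F z - z * exp (1 / z)) has_contour_integral (J q - 0)) (circlepath (ctr q) (rad q))"
      unfolding J_def using has_contour_integral_integral[OF R2(1)[OF q q q]]
      by (intro has_contour_integral_diff)
    \<comment> \<open>On the inner circle \<open>Re (1 / z)\<close> exceeds the real part of the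
      centre by at most \<open>snd q \<le> 1\<close>, and \<open>exp 1 \<le> 3\<close>.\<close>
    define B where "B = (1 + 3 * exp (Re (fst q))) / 20"
    have "cmod (J q - 0) \<le> B * (2 * pi * rad q)"
    proof (rule has_contour_integral_bound_circlepath[OF hi])
      show "cmod (F z - z * exp (1 / z)) \<le> B" if "cmod (z - ctr q) = rad q" for z
      proof -
        have zs: "z \<in> sphere (ctr q) (rad q)" using that by (simp add: dist_norm norm_minus_commute)
        then have zc: "z \<in> cball (ctr q) (rad q)" by auto
        have "exp (Re (1 / z)) \<le> exp (Re (fst q) + 1)" using Re_in(2)[OF q zc] sq by simp
        also have "\<dots> = exp 1 * exp (Re (fst q))" by (simp add: exp_add)
        also have "\<dots> \<le> 3 * exp (Re (fst q))" using exp_le by (intro mult_right_mono) auto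
        finally show ?thesis using err[OF subsetD[OF sphG[OF q] zs] nz[OF q zc]] by (simp add: B_def)
      qed
    qed (use rad[OF q] in \<open>auto simp: B_def add_nonneg_nonneg\<close>)
    also have "\<dots> \<le> B * (2 * pi * snd q)" using rad[OF q] by (intro mult_left_mono) (auto simp: B_def add_nonneg_nonneg)
    also have "\<dots> = pi / 10 * (snd q + 3 * (snd q * exp (Re (fst q))))" by (simp add: B_def field_simps)
    finally show ?thesis by simp
  qed
  have "cmod (\<Sum>q\<in>I. J q) \<le> (\<Sum>q\<in>I. pi / 10 * (snd q + 3 * (snd q * exp (Re (fst q)))))"
    by (rule sum_norm_le) (rule inner)
  also have "\<dots> \<le> (\<Sum>q\<in>Q. pi / 10 * (snd q + 3 * (snd q * exp (Re (fst q)))))"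
  proof (rule sum_mono2)
    show "0 \<le> pi / 10 * (snd q + 3 * (snd q * exp (Re (fst q))))" if "q \<in> Q - I" for q
      using Q(2)[of q] that by (intro mult_nonneg_nonneg add_nonneg_nonneg) auto
  qed (use Q(1) I(1) in auto)
  also have "\<dots> = pi / 10 * (sum snd Q + 3 * (\<Sum>q\<in>Q. snd q * exp (Re (fst q))))"
    by (simp only: sum_distrib_left[symmetric] sum.distrib)
  also have "\<dots> \<le> pi / 10 * (1/8 + 3 * (1/8))"
    by (intro mult_left_mono add_mono QW) auto
  finally have "cmod (\<Sum>q\<in>I. J q) \<le> pi / 20" by simp
  moreover have "cmod (pi * \<i>) \<le> cmod (\<Sum>q\<in>I. J q) + cmod ((\<Sum>q\<in>I. J q) - pi * \<i>)"
    using norm_triangle_ineq4[of "\<Sum>q\<in>I. J q" "(\<Sum>q\<in>I. J q) - pi * \<i>"] by simp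
  moreover have "cmod (pi * \<i>) = pi" by (simp add: norm_mult)
  \<comment> \<open>pi / 20 from the inner circles and 9 pi / 20 from the tangent circle.\<close>
  ultimately have "pi \<le> pi / 2" using outer by linarith
  then show False using pi_gt_zero by simp
qed

text \<open>The factor \<open>exp (1 / (z + \<alpha>))\<close> turns a rational approximant of \<open>g\<close> into one of
  \<open>g * exp (1 / z)\<close>, because \<open>g\<close> vanishes where the two exponentials are far apart.\<close>

lemma vanishing_near_zero_not_close_to_identity:
  fixes g :: "complex \<Rightarrow> complex" and H :: "(complex \<times> real) set"
  defines "K \<equiv> cball (1/2) (1/2) - holes H"
  assumes H: "\<And>h. h \<in> H \<Longrightarrow> 0 < snd h \<and> snd h < cmod (fst h)"
    and W: "\<And>X. finite X \<Longrightarrow> X \<subseteq> H \<Longrightarrow> sum hole_weight X \<le> 1/8"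
    and g: "\<And>e. e > 0 \<Longrightarrow> \<exists>f. rational_on K f \<and> (\<forall>z\<in>K. cmod (g z - f z) \<le> e)"
    and \<delta>: "\<delta> > 0" "\<And>z. z \<in> K \<Longrightarrow> cmod z < \<delta> \<Longrightarrow> g z = 0"
    and close: "\<And>z. z \<in> K \<Longrightarrow> cmod (g z - z) \<le> 1/20"
  shows False
proof -
  obtain \<alpha> where \<alpha>: "\<alpha> > 0" "\<And>a z :: complex. cmod a \<le> \<alpha> \<Longrightarrow> \<delta> \<le> cmod z \<Longrightarrow>
      cmod (exp (1 / (z + a)) - exp (1 / z)) \<le> 1/100"
    using exp_inverse_translate[OF \<delta>(1), of "1/100"] by auto
  define E where "E z = exp (1 / (z + of_real \<alpha>))" for z :: complex
  define M where "M = exp (1 / \<alpha>)"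
  have Kball: "cmod (z - 1/2) \<le> 1/2" if "z \<in> K" for z
    using that by (auto simp: K_def dist_norm norm_minus_commute)
  have KRe: "Re z \<ge> 0" if "z \<in> K" for z
    using abs_Re_le_cmod[of "z - 1/2"] Kball[OF that] by auto
  have K1: "cmod z \<le> 1" if "z \<in> K" for z
    using norm_triangle_ineq[of "z - 1/2" "1/2"] Kball[OF that] by simp
  have zero: "0 \<in> K" using H by (force simp: K_def)
  have E: "cmod (E z) \<le> M" if "z \<in> K" for z
  proof -
    have "\<alpha> \<le> Re (z + of_real \<alpha>)" using KRe[OF that] by simp
    also have "\<dots> \<le> cmod (z + of_real \<alpha>)" by (rule complex_Re_le_cmod)
    finally have "cmod (1 / (z + of_real \<alpha>)) \<le> 1 / \<alpha>"
      unfolding norm_divide using \<alpha>(1) by (intro frac_le) auto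
    then have "Re (1 / (z + of_real \<alpha>)) \<le> 1 / \<alpha>" using complex_Re_le_cmod order_trans by blast
    then show ?thesis by (simp add: E_def M_def norm_exp_eq_Re)
  qed
  have M: "M > 0" by (simp add: M_def)
  \<comment> \<open>The accuracy is chosen to become 1/100 after multiplication by \<open>E\<close>,
    which is at most \<open>M\<close> on K.\<close>
  obtain p q where pq: "\<And>z. z \<in> K \<Longrightarrow> poly q z \<noteq> 0"
    "\<And>z. z \<in> K \<Longrightarrow> cmod (g z - poly p z / poly q z) \<le> 1 / (100 * M)"
  proof -
    obtain f where f: "rational_on K f" "\<forall>z\<in>K. cmod (g z - f z) \<le> 1 / (100 * M)"
      using g[of "1 / (100 * M)"] M by auto
    then show ?thesis using that unfolding rational_on_def by metis
  qed
  define F where "F z = poly p z / poly q z * E z" for z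
  define P where "P = {z. poly q z = 0}"
  have q0: "q \<noteq> 0" using pq(1)[OF zero] by auto
  have P: "finite P" unfolding P_def by (rule poly_roots_finite[OF q0])
  have nz: "z + of_real \<alpha> \<noteq> 0" if "z \<in> K" for z
  proof -
    have "Re (z + of_real \<alpha>) > 0" using KRe[OF that] \<alpha>(1) by simp
    then show ?thesis by (metis less_irrefl zero_complex.sel(1))
  qed
  have holo: "F holomorphic_on - {- of_real \<alpha>} - P"
    unfolding F_def E_def P_def by (intro holomorphic_intros) (auto simp: add_eq_0_iff2)
  have FK: "cmod (F z - g z * E z) \<le> 1/100" if z: "z \<in> K" for z
  proof -
    have "F z - g z * E z = - ((g z - poly p z / poly q z) * E z)" by (simp add: F_def algebra_simps)
    then have "cmod (F z - g z * E z) = cmod (g z - poly p z / poly q z) * cmod (E z)"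
      by (simp add: norm_mult)
    also have "\<dots> \<le> 1 / (100 * M) * M" using pq(2)[OF z] E[OF z] M by (intro mult_mono) auto
    finally show ?thesis using M by simp
  qed
  have gE: "cmod (g z * E z - g z * exp (1 / z)) \<le> 2/100" if z: "z \<in> K" for z
  proof (cases "cmod z < \<delta>")
    case True then show ?thesis using \<delta>(2)[OF z] by simp
  next
    case False
    have "cmod (g z) \<le> 2" using close[OF z] K1[OF z] norm_triangle_sub[of "g z" z] by linarith
    moreover have "cmod (E z - exp (1 / z)) \<le> 1/100"
      unfolding E_def by (rule \<alpha>(2)) (use \<alpha>(1) False in auto)
    ultimately have "cmod (g z) * cmod (E z - exp (1 / z)) \<le> 2 * (1/100)" by (intro mult_mono) auto
    then show ?thesis by (simp add: norm_mult flip: right_diff_distrib)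
  qed
  \<comment> \<open>1/100 from \<open>FK\<close> and 2/100 from \<open>gE\<close> leave strict room
    below 1/20, which continuity needs to carry the estimate beyond K.\<close>
  have errK: "cmod (F z - z * exp (1 / z)) < exp (Re (1 / z)) / 20 + 1/20" if z: "z \<in> K" "z \<noteq> 0" for z
  proof -
    have "cmod (g z * exp (1 / z) - z * exp (1 / z)) = cmod (g z - z) * exp (Re (1 / z))"
      by (simp add: norm_mult flip: left_diff_distrib)
    also have "\<dots> \<le> 1/20 * exp (Re (1 / z))" using close[OF z(1)] by (intro mult_right_mono) auto
    finally have a: "cmod (g z * exp (1 / z) - z * exp (1 / z)) \<le> exp (Re (1 / z)) / 20" by simp
    have "F z - z * exp (1 / z) = (F z - g z * E z) + (g z * E z - g z * exp (1 / z)) + (g z * exp (1 / z) - z * exp (1 / z))"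
      by simp
    moreover have "cmod (u + v + w) \<le> cmod u + cmod v + cmod w" for u v w :: complex
      using norm_triangle_ineq[of "u + v" w] norm_triangle_ineq[of u v] by linarith
    ultimately have "cmod (F z - z * exp (1 / z)) \<le> cmod (F z - g z * E z) + cmod (g z * E z - g z * exp (1 / z))
        + cmod (g z * exp (1 / z) - z * exp (1 / z))"
      by metis
    then show ?thesis using FK[OF z(1)] gE[OF z(1)] a by linarith
  qed
  \<comment> \<open>The contours may cross holes left out of the finite cover, so the estimate is
    needed on an open set containing K.\<close>
  define Good where "Good = {z. poly q z \<noteq> 0 \<and>
    (z \<noteq> 0 \<longrightarrow> cmod (F z - z * exp (1 / z)) \<le> exp (Re (1 / z)) / 20 + 1/20)}"
  have cF: "isCont F z" if "z \<in> K" for z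
    unfolding F_def E_def using pq(1)[OF that] nz[OF that] by (intro continuous_intros) auto
  have nh: "(h \<longlongrightarrow> h z) (nhds z)" if "isCont h z" for z and h :: "complex \<Rightarrow> 'b :: topological_space"
    using that by (simp add: isCont_def tendsto_at_iff_tendsto_nhds)
  have "z \<in> interior Good" if z: "z \<in> K" for z
  proof -
    have "\<forall>\<^sub>F x in nhds z. x \<in> Good"
    proof (cases "z = 0")
      case False
      have "isCont (\<lambda>x. cmod (F x - x * exp (1 / x)) - exp (Re (1 / x)) / 20) z"
        using False by (intro continuous_intros cF z) auto
      then have "((\<lambda>x. cmod (F x - x * exp (1 / x)) - exp (Re (1 / x)) / 20) \<longlongrightarrow>
          cmod (F z - z * exp (1 / z)) - exp (Re (1 / z)) / 20) (nhds z)"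
        by (rule nh)
      then have "\<forall>\<^sub>F x in nhds z. cmod (F x - x * exp (1 / x)) - exp (Re (1 / x)) / 20 < 1/20"
        by (rule order_tendstoD) (use errK[OF z False] in linarith)
      moreover have "isCont (poly q) z" by simp
      then have "(poly q \<longlongrightarrow> poly q z) (nhds z)" by (rule nh)
      then have "\<forall>\<^sub>F x in nhds z. poly q x \<noteq> 0"
        by (rule tendsto_imp_eventually_ne) (use pq(1)[OF z] in auto)
      ultimately show ?thesis by eventually_elim (auto simp: Good_def)
    next
      \<comment> \<open>At 0 \<open>exp (1 / z)\<close> has no limit, so the two summands of the
        bound are used separately: 1/20 for F, by continuity, and
        \<open>exp (Re (1 / x)) / 20\<close> for \<open>x * exp (1 / x)\<close> once
        \<open>|x| < 1/20\<close>.\<close>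
      case True
      have "g 0 = 0" using \<delta> zero by simp
      then have F0: "cmod (F 0) < 1/20" using FK[OF zero] by simp
      have "isCont (\<lambda>x. cmod (F x)) z" by (intro continuous_intros cF z)
      then have "((\<lambda>x. cmod (F x)) \<longlongrightarrow> cmod (F z)) (nhds z)"
        by (rule nh)
      then have "\<forall>\<^sub>F x in nhds z. cmod (F x) < 1/20"
        by (rule order_tendstoD) (use F0 True in simp)
      moreover have "isCont (poly q) z" by simp
      then have "(poly q \<longlongrightarrow> poly q z) (nhds z)" by (rule nh)
      then have "\<forall>\<^sub>F x in nhds z. poly q x \<noteq> 0"
        by (rule tendsto_imp_eventually_ne) (use pq(1)[OF z] in auto)
      moreover have "\<forall>\<^sub>F x in nhds z. x \<in> ball 0 (1/20)"
        by (rule eventually_nhds_in_open) (use True in auto)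
      ultimately show ?thesis
      proof eventually_elim
        case (elim x)
        have "cmod (x * exp (1 / x)) = cmod x * exp (Re (1 / x))" by (simp add: norm_mult)
        also have "\<dots> \<le> 1/20 * exp (Re (1 / x))" using elim(3) by (intro mult_right_mono) auto
        finally have "cmod (F x - x * exp (1 / x)) \<le> exp (Re (1 / x)) / 20 + 1/20"
          using norm_triangle_ineq4[of "F x" "x * exp (1 / x)"] elim(1) by linarith
        then show ?case using elim(2) by (simp add: Good_def)
      qed
    qed
    then obtain S where "open S" "z \<in> S" "\<forall>x\<in>S. x \<in> Good" unfolding eventually_nhds by blast
    then show ?thesis by (meson interiorI subsetI)
  qed
  then have KG: "K \<subseteq> interior Good" by blast
  have b: "- of_real \<alpha> \<notin> cball (1/2 :: complex) (1/2)"
  proof -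
    have "1/2 - (- of_real \<alpha>) = (of_real (1/2 + \<alpha>) :: complex)" by simp
    then have "dist (1/2) (- of_real \<alpha> :: complex) = 1/2 + \<alpha>"
      unfolding dist_norm using \<alpha>(1) by (simp only: norm_of_real)
    then show ?thesis using \<alpha>(1) by simp
  qed
  show False
  proof (rule cannot_approximate_exp_inverse[OF H W holo P b open_interior KG[unfolded K_def]])
    show "interior Good \<inter> P = {}" using interior_subset[of Good] by (auto simp: Good_def P_def)
    show "cmod (F z - z * exp (1 / z)) \<le> exp (Re (1 / z)) / 20 + 1 / 20" if "z \<in> interior Good" "z \<noteq> 0" for z
      using that interior_subset[of Good] by (auto simp: Good_def)
  qed
qed

subsection \<open>Uniform limits of rational functions\<close>

text \<open>Membership in R(K) freed from extensionality and compactness, so that one function on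
  \<open>- holes H\<close> for a single annulus can later be restricted to the final K.\<close>

definition rational_limit :: "complex set \<Rightarrow> (complex \<Rightarrow> complex) \<Rightarrow> bool" where
  "rational_limit K f \<longleftrightarrow> (\<forall>e>0. \<exists>r. rational_on K r \<and> (\<forall>z\<in>K. cmod (f z - r z) \<le> e))"

lemma rational_limit_subset: "rational_limit S f \<Longrightarrow> T \<subseteq> S \<Longrightarrow> rational_limit T f"
  unfolding rational_limit_def using rational_on_subset by (meson subsetD)

lemma rational_limitD:
  assumes "rational_limit K f" "e > 0"
  obtains r where "rational_on K r" "\<And>z. z \<in> K \<Longrightarrow> cmod (f z - r z) \<le> e"
  using assms unfolding rational_limit_def by blast

lemma rational_on_imp_rational_limit: "rational_on K f \<Longrightarrow> rational_limit K f"
  unfolding rational_limit_def by (intro allI impI exI[of _ f]) auto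

lemma rational_limit_cong: "(\<And>z. z \<in> K \<Longrightarrow> f z = g z) \<Longrightarrow> rational_limit K f \<longleftrightarrow> rational_limit K g"
  unfolding rational_limit_def by (simp cong: conj_cong)

lemma rational_on_continuous_on:
  assumes "rational_on K r" shows "continuous_on K r"
proof -
  obtain p q where pq: "\<And>z. z \<in> K \<Longrightarrow> poly q z \<noteq> 0" "\<And>z. z \<in> K \<Longrightarrow> r z = poly p z / poly q z"
    using assms unfolding rational_on_def by blast
  have "continuous_on K (\<lambda>z. poly p z / poly q z)" using pq by (intro continuous_intros) auto
  then show ?thesis using pq by (simp cong: continuous_on_cong)
qed

lemma rational_limit_continuous_on:
  assumes "rational_limit K f" shows "continuous_on K f"
proof -
  have "\<exists>r. rational_on K r \<and> (\<forall>z\<in>K. cmod (f z - r z) \<le> 1 / real (Suc n))" for n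
    using assms unfolding rational_limit_def by simp
  then obtain r where r: "\<And>n. rational_on K (r n)" "\<And>n z. z \<in> K \<Longrightarrow> cmod (f z - r n z) \<le> 1 / real (Suc n)"
    by metis
  have "uniform_limit K r f sequentially"
  proof (rule uniform_limitI)
    fix e :: real assume "e > 0"
    then obtain N where N: "1 / real (Suc N) < e" using nat_approx_posE by blast
    have "\<forall>n\<ge>N. \<forall>x\<in>K. dist (r n x) (f x) < e"
    proof (intro allI impI ballI)
      fix n x assume "N \<le> n" "x \<in> K"
      have "dist (r n x) (f x) \<le> 1 / real (Suc n)"
        using r(2)[OF \<open>x \<in> K\<close>] by (simp add: dist_norm norm_minus_commute)
      also have "\<dots> \<le> 1 / real (Suc N)" using \<open>N \<le> n\<close> by (intro divide_left_mono) auto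
      finally show "dist (r n x) (f x) < e" using N by simp
    qed
    then show "\<forall>\<^sub>F n in sequentially. \<forall>x\<in>K. dist (r n x) (f x) < e" unfolding eventually_sequentially by blast
  qed
  then show ?thesis
    by (rule uniform_limit_theorem[rotated]) (auto intro!: always_eventually rational_on_continuous_on r)
qed

lemma rational_limit_bounded:
  assumes "compact K" "rational_limit K f"
  obtains B where "B > 0" "\<And>z. z \<in> K \<Longrightarrow> cmod (f z) \<le> B"
proof -
  have "bounded (f ` K)"
    using compact_continuous_image[OF rational_limit_continuous_on] assms compact_imp_bounded by blast
  then show ?thesis using that by (auto simp: bounded_pos)
qed

lemma rational_limit_add:
  assumes "rational_limit K f" "rational_limit K g"
  shows "rational_limit K (\<lambda>z. f z + g z)"
  unfolding rational_limit_def
proof (intro allI impI)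
  fix e :: real assume e: "e > 0"
  obtain r where r: "rational_on K r" "\<And>z. z \<in> K \<Longrightarrow> cmod (f z - r z) \<le> e / 2"
    using rational_limitD[OF assms(1), of "e / 2"] e by auto
  obtain s where s: "rational_on K s" "\<And>z. z \<in> K \<Longrightarrow> cmod (g z - s z) \<le> e / 2"
    using rational_limitD[OF assms(2), of "e / 2"] e by auto
  have "cmod (f z + g z - (r z + s z)) \<le> e" if "z \<in> K" for z
    using norm_diff_triangle_ineq[of "f z" "g z" "r z" "s z"] r(2)[OF that] s(2)[OF that] by linarith
  then show "\<exists>r. rational_on K r \<and> (\<forall>z\<in>K. cmod (f z + g z - r z) \<le> e)"
    using rational_on_add[OF r(1) s(1)] by blast
qed

lemma rational_limit_mult:
  assumes K: "compact K" and f: "rational_limit K f" and g: "rational_limit K g"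
  shows "rational_limit K (\<lambda>z. f z * g z)"
  unfolding rational_limit_def
proof (intro allI impI)
  fix e :: real assume e: "e > 0"
  obtain B where B: "B > 0" "\<And>z. z \<in> K \<Longrightarrow> cmod (f z) \<le> B" by (rule rational_limit_bounded[OF K f]) blast
  obtain C where C: "C > 0" "\<And>z. z \<in> K \<Longrightarrow> cmod (g z) \<le> C" by (rule rational_limit_bounded[OF K g]) blast
  obtain s where s: "rational_on K s" "\<And>z. z \<in> K \<Longrightarrow> cmod (g z - s z) \<le> min 1 (e / (2 * B))"
    using rational_limitD[OF g, of "min 1 (e / (2 * B))"] e B by auto
  obtain r where r: "rational_on K r" "\<And>z. z \<in> K \<Longrightarrow> cmod (f z - r z) \<le> e / (2 * (C + 1))"
    using rational_limitD[OF f, of "e / (2 * (C + 1))"] e C by auto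
  have "cmod (f z * g z - r z * s z) \<le> e" if z: "z \<in> K" for z
  proof -
    have "cmod (s z) \<le> C + 1" using s(2)[OF z] C(2)[OF z] norm_triangle_sub[of "s z" "g z"]
      by (simp add: norm_minus_commute)
    then have "cmod (f z - r z) * cmod (s z) \<le> e / (2 * (C + 1)) * (C + 1)"
      using r(2)[OF z] e C by (intro mult_mono) auto
    moreover have "cmod (f z) * cmod (g z - s z) \<le> B * (e / (2 * B))"
      using B(1) B(2)[OF z] s(2)[OF z] by (intro mult_mono) auto
    moreover have "e / (2 * d) * d = e / 2" if "d > 0" for d using that by simp
    then have "e / (2 * (C + 1)) * (C + 1) = e / 2" "B * (e / (2 * B)) = e / 2"
      using B(1) C(1) by (metis add_pos_pos zero_less_one, metis mult.commute)
    moreover have "f z * g z - r z * s z = f z * (g z - s z) + (f z - r z) * s z" by (simp add: algebra_simps)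
    then have "cmod (f z * g z - r z * s z) \<le> cmod (f z) * cmod (g z - s z) + cmod (f z - r z) * cmod (s z)"
      by (metis norm_mult norm_triangle_ineq)
    ultimately show ?thesis by linarith
  qed
  then show "\<exists>r. rational_on K r \<and> (\<forall>z\<in>K. cmod (f z * g z - r z) \<le> e)"
    using rational_on_mult[OF r(1) s(1)] by blast
qed

text \<open>By compactness \<open>|f| \<ge> m > 0\<close>, so good approximants satisfy
  \<open>|r| \<ge> m / 2\<close> and can be inverted. This makes a nowhere vanishing element of R(K)
  invertible in R(K), the source of all information on characters.\<close>

lemma rational_limit_inverse:
  assumes K: "compact K" and f: "rational_limit K f" and nz: "\<And>z. z \<in> K \<Longrightarrow> f z \<noteq> 0"
  shows "rational_limit K (\<lambda>z. inverse (f z))"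
proof (cases "K = {}")
  case True then show ?thesis by (auto simp: rational_limit_def rational_on_def)
next
  case False
  obtain w where w: "w \<in> K" "\<And>z. z \<in> K \<Longrightarrow> cmod (f w) \<le> cmod (f z)"
    using continuous_attains_inf[OF K False, of "\<lambda>z. cmod (f z)"] rational_limit_continuous_on[OF f]
    by (auto intro: continuous_on_norm)
  define m where "m = cmod (f w)"
  have m: "m > 0" "\<And>z. z \<in> K \<Longrightarrow> m \<le> cmod (f z)" using w nz by (auto simp: m_def)
  show ?thesis unfolding rational_limit_def
  proof (intro allI impI)
    fix e :: real assume e: "e > 0"
    obtain r where r: "rational_on K r" "\<And>z. z \<in> K \<Longrightarrow> cmod (f z - r z) \<le> min (m / 2) (e * m * m / 2)"
      using rational_limitD[OF f, of "min (m / 2) (e * m * m / 2)"] e m by auto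
    have rm: "m / 2 \<le> cmod (r z)" if "z \<in> K" for z
      using r(2)[OF that] m(2)[OF that] norm_triangle_sub[of "f z" "r z"] by simp
    have "cmod (inverse (f z) - inverse (r z)) \<le> e" if z: "z \<in> K" for z
    proof -
      have "f z \<noteq> 0" "r z \<noteq> 0" using nz[OF z] rm[OF z] m by auto
      then have "inverse (f z) - inverse (r z) = - ((f z - r z) / (f z * r z))" by (simp add: field_simps)
      then have "cmod (inverse (f z) - inverse (r z)) = cmod (f z - r z) / (cmod (f z) * cmod (r z))"
        by (simp add: norm_divide norm_mult)
      also have "\<dots> \<le> (e * m * m / 2) / (m * (m / 2))"
        using r(2)[OF z] m(1) m(2)[OF z] rm[OF z] e by (intro frac_le mult_mono) auto
      also have "\<dots> = e" using m by simp
      finally show ?thesis .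
    qed
    moreover have "rational_on K (\<lambda>z. inverse (r z))"
      by (rule rational_on_inverse[OF r(1)]) (use rm m in force)
    ultimately show "\<exists>r. rational_on K r \<and> (\<forall>z\<in>K. cmod (inverse (f z) - r z) \<le> e)" by blast
  qed
qed

lemma rational_limit_prod:
  assumes "compact K" "\<And>i. i \<in> I \<Longrightarrow> rational_limit K (f i)"
  shows "rational_limit K (\<lambda>z. \<Prod>i\<in>I. f i z)"
proof (cases "finite I")
  case True
  then show ?thesis using assms(2)
    by (induction I) (auto intro: rational_on_imp_rational_limit rational_on_const rational_limit_mult[OF assms(1)])
qed (auto intro: rational_on_imp_rational_limit rational_on_const)

lemma rational_limit_one_minus:
  assumes "compact K" "rational_limit K f"
  shows "rational_limit K (\<lambda>z. 1 - f z)"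
proof -
  have "rational_limit K (\<lambda>z. 1 + - 1 * f z)"
    by (intro rational_limit_add rational_limit_mult assms rational_on_imp_rational_limit rational_on_const)
  then show ?thesis by simp
qed

subsection \<open>The algebra \<open>R(K)\<close>\<close>

lemma cont_space_top_of_set:
  assumes "compact K"
  shows "f \<in> cont_space (top_of_set K) \<longleftrightarrow> f \<in> extensional K \<and> continuous_on K f"
proof -
  have "compactin (top_of_set K) (topspace (top_of_set K))"
    using assms by (simp add: compactin_subtopology)
  from compactin_mspace_cfunspace[OF this, of euclidean_metric]
  have eq: "cont_space (top_of_set K) = {f \<in> extensional K. continuous_on K f}"
    by (simp del: mspace_cfunspace)
  show ?thesis by (simp only: eq mem_Collect_eq)
qed

text \<open>Serves twice: for R(K) as the closure of the rational functions, and for the closure of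
  \<open>ideal_J\<close>.\<close>

lemma sup_closure_iff:
  assumes K: "compact K" "K \<noteq> {}" and S: "S \<subseteq> cont_space (top_of_set K)"
  shows "f \<in> sup_topology (top_of_set K) closure_of S \<longleftrightarrow>
    f \<in> cont_space (top_of_set K) \<and> (\<forall>e>0. \<exists>g\<in>S. \<forall>z\<in>K. cmod (f z - g z) \<le> e)"
proof -
  interpret M: Metric_space "cont_space (top_of_set K)" "mdist (cont_metric (top_of_set K))"
    by (rule Metric_space_mspace_mdist)
  have d: "mdist (cont_metric (top_of_set K)) f g \<le> e \<longleftrightarrow> (\<forall>z\<in>K. cmod (f z - g z) \<le> e)"
    if "f \<in> cont_space (top_of_set K)" "g \<in> cont_space (top_of_set K)" for f g e
    using cfunspace_mdist_le[OF that] K by (simp add: dist_norm del: mspace_cfunspace)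
  show ?thesis unfolding mtopology_of_def M.metric_closure_of_alt
    using d S by (auto simp del: mspace_cfunspace simp: subset_iff) (metis+)
qed

lemma rational_functions_eq: "rational_functions K = {f \<in> extensional K. rational_on K f}"
proof (intro set_eqI iffI)
  fix f assume "f \<in> rational_functions K"
  then obtain p q where "f = (\<lambda>z\<in>K. poly p z / poly q z)" "\<forall>z\<in>K. poly q z \<noteq> 0"
    unfolding rational_functions_def by blast
  then show "f \<in> {f \<in> extensional K. rational_on K f}" by (auto intro!: rational_onI)
next
  fix f assume f: "f \<in> {f \<in> extensional K. rational_on K f}"
  then obtain p q where pq: "\<forall>z\<in>K. poly q z \<noteq> 0 \<and> f z = poly p z / poly q z"
    unfolding rational_on_def by blast
  have "f = (\<lambda>z\<in>K. poly p z / poly q z)" using f pq by (intro extensionalityI[of _ K]) auto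
  then show "f \<in> rational_functions K" unfolding rational_functions_def using pq by blast
qed

lemma rational_functions_subset: "compact K \<Longrightarrow> rational_functions K \<subseteq> cont_space (top_of_set K)"
  unfolding rational_functions_eq
  by (auto simp: cont_space_top_of_set rational_on_continuous_on simp del: mspace_cfunspace)

lemma R_algebra_iff:
  assumes K: "compact K" "K \<noteq> {}"
  shows "f \<in> R_algebra K \<longleftrightarrow> f \<in> extensional K \<and> rational_limit K f"
proof
  assume f: "f \<in> R_algebra K"
  then have "f \<in> cont_space (top_of_set K)" "\<forall>e>0. \<exists>g\<in>rational_functions K. \<forall>z\<in>K. cmod (f z - g z) \<le> e"
    unfolding R_algebra_def sup_closure_iff[OF K rational_functions_subset[OF K(1)]] by blast+
  then show "f \<in> extensional K \<and> rational_limit K f"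
    unfolding cont_space_top_of_set[OF K(1)] rational_functions_eq rational_limit_def by blast
next
  assume f: "f \<in> extensional K \<and> rational_limit K f"
  have "\<exists>g\<in>rational_functions K. \<forall>z\<in>K. cmod (f z - g z) \<le> e" if e: "e > 0" for e
  proof -
    obtain r where r: "rational_on K r" "\<And>z. z \<in> K \<Longrightarrow> cmod (f z - r z) \<le> e"
      by (rule rational_limitD[OF _ e, of K f]) (use f in auto)
    have "rational_on K (restrict r K)" using r(1) unfolding rational_on_def by auto
    then have "restrict r K \<in> rational_functions K" by (simp add: rational_functions_eq)
    then show ?thesis using r(2) by (intro bexI[of _ "restrict r K"]) auto
  qed
  moreover have "f \<in> cont_space (top_of_set K)"
    unfolding cont_space_top_of_set[OF K(1)] using f rational_limit_continuous_on by blast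
  ultimately show "f \<in> R_algebra K"
    unfolding R_algebra_def sup_closure_iff[OF K rational_functions_subset[OF K(1)]] by blast
qed

lemma restrict_in_R_algebra:
  assumes "compact K" "K \<noteq> {}" "rational_limit K f"
  shows "restrict f K \<in> R_algebra K"
  using assms rational_limit_cong[of K "restrict f K" f] by (simp add: R_algebra_iff)

lemma uniform_algebra_R_algebra:
  assumes K: "compact K" "K \<noteq> {}"
  shows "uniform_algebra (top_of_set K) (R_algebra K)"
  unfolding uniform_algebra_def
proof (intro conjI allI ballI impI)
  note R = R_algebra_iff[OF K]
  note mem = restrict_in_R_algebra[OF K]
  have const: "rational_limit K (\<lambda>z. c)" for c by (intro rational_on_imp_rational_limit rational_on_const)
  show "compact_space (top_of_set K)" using K by (simp add: compact_space_subtopology)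
  show "Hausdorff_space (top_of_set K)" by (intro Hausdorff_space_subtopology Hausdorff_space_euclidean)
  show "R_algebra K \<subseteq> cont_space (top_of_set K)"
    using closure_of_subset_topspace[of "sup_topology (top_of_set K)" "rational_functions K"]
    unfolding R_algebra_def by simp
  show "closedin (sup_topology (top_of_set K)) (R_algebra K)" unfolding R_algebra_def by (rule closedin_closure_of)
  show "fun_const (top_of_set K) c \<in> R_algebra K" for c
    unfolding fun_const_def using mem[OF const] by simp
  show "fun_scale (top_of_set K) c f \<in> R_algebra K" if "f \<in> R_algebra K" for f c
    unfolding fun_scale_def using mem[OF rational_limit_mult[OF K(1) const]] that R by simp
  show "fun_add (top_of_set K) f g \<in> R_algebra K" if "f \<in> R_algebra K" "g \<in> R_algebra K" for f g
    unfolding fun_add_def using mem[OF rational_limit_add] that R by simp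
  show "fun_mult (top_of_set K) f g \<in> R_algebra K" if "f \<in> R_algebra K" "g \<in> R_algebra K" for f g
    unfolding fun_mult_def using mem[OF rational_limit_mult[OF K(1)]] that R by simp
  show "\<exists>f\<in>R_algebra K. f x \<noteq> f y" if "x \<in> topspace (top_of_set K)" "y \<in> topspace (top_of_set K)" "x \<noteq> y" for x y
    using mem[OF rational_on_imp_rational_limit[OF rational_on_ident]] that by (intro bexI[of _ "restrict (\<lambda>z. z) K"]) auto
qed

text \<open>A character takes values in the range of each function, because nowhere vanishing functions are
  invertible. Hence it is bounded by the sup norm and determined by its value at the identity.\<close>

lemma complex_hom_R_algebra:
  assumes K: "compact K" "K \<noteq> {}" and \<phi>: "\<phi> \<in> complex_homs (top_of_set K) (R_algebra K)"
  obtains a where "a \<in> K" "\<phi> = point_eval (R_algebra K) a"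
proof -
  note R = R_algebra_iff[OF K]
  \<comment> \<open>\<phi> read through restriction, so that pointwise lambda terms replace
    \<open>fun_add\<close> and the other extensional operations.\<close>
  define \<psi> where "\<psi> f = \<phi> (restrict f K)" for f
  have mem: "restrict f K \<in> R_algebra K" if "rational_limit K f" for f
    using restrict_in_R_algebra[OF K that] .
  have const: "rational_limit K (\<lambda>z. c)" for c by (intro rational_on_imp_rational_limit rational_on_const)
  have hom: "\<And>f g. f \<in> R_algebra K \<Longrightarrow> g \<in> R_algebra K \<Longrightarrow> \<phi> (fun_add (top_of_set K) f g) = \<phi> f + \<phi> g"
    "\<And>f g. f \<in> R_algebra K \<Longrightarrow> g \<in> R_algebra K \<Longrightarrow> \<phi> (fun_mult (top_of_set K) f g) = \<phi> f * \<phi> g"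
    "\<And>f c. f \<in> R_algebra K \<Longrightarrow> \<phi> (fun_scale (top_of_set K) c f) = c * \<phi> f"
    using \<phi> unfolding complex_homs_def by blast+
  have ext: "\<phi> \<in> extensional (R_algebra K)" using \<phi> by (simp add: complex_homs_def)
  have add: "\<psi> (\<lambda>z. f z + g z) = \<psi> f + \<psi> g" if "rational_limit K f" "rational_limit K g" for f g
  proof -
    have "fun_add (top_of_set K) (restrict f K) (restrict g K) = restrict (\<lambda>z. f z + g z) K"
      unfolding fun_add_def by (auto simp: fun_eq_iff)
    then show ?thesis using hom(1,2)[OF mem[OF that(1)] mem[OF that(2)]] unfolding \<psi>_def by simp
  qed
  have mult: "\<psi> (\<lambda>z. f z * g z) = \<psi> f * \<psi> g" if "rational_limit K f" "rational_limit K g" for f g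
  proof -
    have "fun_mult (top_of_set K) (restrict f K) (restrict g K) = restrict (\<lambda>z. f z * g z) K"
      unfolding fun_mult_def by (auto simp: fun_eq_iff)
    then show ?thesis using hom(1,2)[OF mem[OF that(1)] mem[OF that(2)]] unfolding \<psi>_def by simp
  qed
  have scale: "\<psi> (\<lambda>z. c * f z) = c * \<psi> f" if "rational_limit K f" for c f
  proof -
    have "fun_scale (top_of_set K) c (restrict f K) = restrict (\<lambda>z. c * f z) K"
      unfolding fun_scale_def by (auto simp: fun_eq_iff)
    then show ?thesis using hom(3)[OF mem[OF that(1)]] unfolding \<psi>_def by metis
  qed
  have cong: "\<psi> f = \<psi> g" if "\<And>z. z \<in> K \<Longrightarrow> f z = g z" for f g
    unfolding \<psi>_def using that by (metis restrict_ext)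
  have one: "\<psi> (\<lambda>z. 1) = 1"
  proof -
    obtain f where f: "f \<in> R_algebra K" "\<phi> f \<noteq> 0" using \<phi> by (auto simp: complex_homs_def)
    have rf: "rational_limit K f" "restrict f K = f" using f R by (auto simp: extensional_restrict)
    have "\<psi> f = \<psi> f * \<psi> (\<lambda>z. 1)" using mult[OF rf(1) const[of 1]] by simp
    then show ?thesis using f rf by (simp add: \<psi>_def)
  qed
  have cst: "\<psi> (\<lambda>z. c) = c" for c using scale[OF const[of 1], of c] one by simp
  have inv: "\<psi> f \<noteq> 0" if f: "rational_limit K f" "\<And>z. z \<in> K \<Longrightarrow> f z \<noteq> 0" for f
  proof
    assume "\<psi> f = 0"
    then have "\<psi> (\<lambda>z. f z * inverse (f z)) = 0" using mult[OF f(1) rational_limit_inverse[OF K(1) f]] by simp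
    moreover have "\<psi> (\<lambda>z. f z * inverse (f z)) = \<psi> (\<lambda>z. 1)" by (rule cong) (use f(2) in auto)
    ultimately show False using one by simp
  qed
  have diff_const: "\<psi> (\<lambda>z. f z - c) = \<psi> f - c" "rational_limit K (\<lambda>z. f z - c)" if "rational_limit K f" for f c
    using add[OF that const[of "- c"]] rational_limit_add[OF that const[of "- c"]] cst[of "- c"] by simp_all
  have range: "\<exists>z\<in>K. f z = \<psi> f" if "rational_limit K f" for f
  proof (rule ccontr)
    assume "\<not> ?thesis"
    then have "\<psi> (\<lambda>z. f z - \<psi> f) \<noteq> 0" by (intro inv diff_const that) auto
    then show False using diff_const(1)[OF that] by simp
  qed
  have id: "rational_limit K (\<lambda>z. z)" by (intro rational_on_imp_rational_limit rational_on_ident)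
  define a where "a = \<psi> (\<lambda>z. z)"
  have a: "a \<in> K" using range[OF id] by (auto simp: a_def)
  have pl: "rational_limit K (poly p)" for p
    by (intro rational_on_imp_rational_limit rational_onI[where p = p and q = 1]) auto
  have poly: "\<psi> (poly p) = poly p a" for p
  proof (induction p)
    case 0
    have "poly 0 = (\<lambda>z::complex. 0)" by auto
    then show ?case using cst[of 0] by simp
  next
    case (pCons c p)
    have "poly (pCons c p) = (\<lambda>z. c + z * poly p z)" by auto
    then show ?case using add[OF const rational_limit_mult[OF K(1) id pl]] mult[OF id pl] cst pCons by (simp add: a_def)
  qed
  have rat: "\<psi> r = r a" if r: "rational_on K r" for r
  proof -
    obtain p q where pq: "\<And>z. z \<in> K \<Longrightarrow> poly q z \<noteq> 0" "\<And>z. z \<in> K \<Longrightarrow> r z = poly p z / poly q z"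
      using r unfolding rational_on_def by blast
    have "\<psi> (\<lambda>z. r z * poly q z) = \<psi> (poly p)" by (rule cong) (use pq in auto)
    then have "\<psi> r * poly q a = poly p a" using mult[OF rational_on_imp_rational_limit[OF r] pl] poly by simp
    moreover have "r a * poly q a = poly p a" using pq[OF a] by simp
    ultimately show ?thesis using pq(1)[OF a] by (metis mult_right_cancel)
  qed
  have "\<psi> f = f a" if f: "rational_limit K f" for f
  proof -
    have "cmod (\<psi> f - f a) \<le> e" if e: "e > 0" for e
    proof -
      obtain r where r: "rational_on K r" "\<And>z. z \<in> K \<Longrightarrow> cmod (f z - r z) \<le> e / 2"
        using rational_limitD[OF f, of "e / 2"] e by auto
      have rl: "rational_limit K (\<lambda>z. - 1 * r z)"
        by (intro rational_limit_mult K const rational_on_imp_rational_limit r)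
      \<comment> \<open>The range property applied to f - r bounds \<open>\<psi> f - r a\<close> by
        a value of f - r; no continuity of \<phi> has to be known beforehand.\<close>
      obtain z where z: "z \<in> K" "f z + (- 1 * r z) = \<psi> (\<lambda>z. f z + (- 1 * r z))"
        using range[OF rational_limit_add[OF f rl]] by blast
      have "\<psi> (\<lambda>z. f z + (- 1 * r z)) = \<psi> f - r a"
        using add[OF f rl] scale[OF rational_on_imp_rational_limit[OF r(1)], of "-1"] rat[OF r(1)] by simp
      with z(2) have "\<psi> f - r a = f z - r z" by simp
      then have "cmod (\<psi> f - r a) \<le> e / 2" using r(2)[OF z(1)] by simp
      then show ?thesis using r(2)[OF a] norm_triangle_ineq4[of "\<psi> f - r a" "f a - r a"] by simp
    qed
    then have "cmod (\<psi> f - f a) \<le> 0" by (rule field_le_epsilon) simp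
    then show ?thesis by simp
  qed
  then have "\<phi> f = f a" if "f \<in> R_algebra K" for f
    using that R[of f] by (metis \<psi>_def extensional_restrict)
  then have "\<phi> = point_eval (R_algebra K) a"
    unfolding point_eval_def using ext by (intro extensionalityI[of _ "R_algebra K"]) auto
  then show ?thesis using that[OF a] by blast
qed

text \<open>Point evaluation is a continuous bijection from a compact space to a Hausdorff space;
  surjectivity is \<open>complex_hom_R_algebra\<close>.\<close>

lemma natural_R_algebra:
  assumes K: "compact K" "K \<noteq> {}"
  shows "natural_algebra (top_of_set K) (R_algebra K)"
  unfolding natural_algebra_def
proof (rule continuous_imp_homeomorphic_map)
  note R = R_algebra_iff[OF K]
  let ?A = "R_algebra K"
  have hom: "point_eval ?A x \<in> complex_homs (top_of_set K) ?A" if x: "x \<in> K" for x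
  proof -
    have ua: "uniform_algebra (top_of_set K) ?A" by (rule uniform_algebra_R_algebra[OF K])
    then have cl: "\<And>f c. f \<in> ?A \<Longrightarrow> fun_scale (top_of_set K) c f \<in> ?A"
      "\<And>f g. f \<in> ?A \<Longrightarrow> g \<in> ?A \<Longrightarrow> fun_add (top_of_set K) f g \<in> ?A"
      "\<And>f g. f \<in> ?A \<Longrightarrow> g \<in> ?A \<Longrightarrow> fun_mult (top_of_set K) f g \<in> ?A" "fun_const (top_of_set K) 1 \<in> ?A"
      unfolding uniform_algebra_def by auto
    have "point_eval ?A x (fun_const (top_of_set K) 1) \<noteq> 0" using cl(4) x by (simp add: point_eval_def fun_const_def)
    then show ?thesis unfolding complex_homs_def using cl x
      by (auto simp: point_eval_def fun_scale_def fun_add_def fun_mult_def intro!: bexI[of _ "fun_const (top_of_set K) 1"])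
  qed
  have top: "topspace (maximal_ideal_space (top_of_set K) ?A) = complex_homs (top_of_set K) ?A"
    by (auto simp: maximal_ideal_space_def complex_homs_def PiE_def)
  show "continuous_map (top_of_set K) (maximal_ideal_space (top_of_set K) ?A) (point_eval ?A)"
    unfolding maximal_ideal_space_def continuous_map_in_subtopology continuous_map_componentwise
  proof (intro conjI ballI)
    show "continuous_map (top_of_set K) euclidean (\<lambda>x. point_eval ?A x f)" if "f \<in> ?A" for f
      using that R rational_limit_continuous_on[of K f] by (simp add: point_eval_def)
  qed (use hom in \<open>auto simp: point_eval_def\<close>)
  show "compact_space (top_of_set K)" using K by (simp add: compact_space_subtopology)
  show "Hausdorff_space (maximal_ideal_space (top_of_set K) ?A)"
    unfolding maximal_ideal_space_def
    by (intro Hausdorff_space_subtopology) (simp add: Hausdorff_space_product_topology)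
  show "point_eval ?A ` topspace (top_of_set K) = topspace (maximal_ideal_space (top_of_set K) ?A)"
    unfolding top using hom complex_hom_R_algebra[OF K] by (auto simp: image_iff) metis
  show "inj_on (point_eval ?A) (topspace (top_of_set K))"
  proof (rule inj_onI)
    fix x y assume xy: "x \<in> topspace (top_of_set K)" "y \<in> topspace (top_of_set K)" "point_eval ?A x = point_eval ?A y"
    have "restrict (\<lambda>z. z) K \<in> ?A"
      by (intro restrict_in_R_algebra K rational_on_imp_rational_limit rational_on_ident)
    then show "x = y" using fun_cong[OF xy(3), of "restrict (\<lambda>z. z) K"] xy(1,2) by (simp add: point_eval_def)
  qed
qed

text \<open>Finitely many of the sets V cover the compact K1; at each point of K1 some factor
  \<open>1 - f x\<close> vanishes, while on K0 all factors are 1.\<close>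

lemma normal_on_R_algebra:
  assumes K: "compact K" "K \<noteq> {}"
    and loc: "\<And>x U. x \<in> K \<Longrightarrow> open U \<Longrightarrow> x \<in> U \<Longrightarrow>
      \<exists>f V. rational_limit K f \<and> open V \<and> x \<in> V \<and> (\<forall>z\<in>V. f z = 1) \<and> (\<forall>z. z \<notin> U \<longrightarrow> f z = 0)"
  shows "normal_on (top_of_set K) (R_algebra K)"
  unfolding normal_on_def
proof (intro allI impI)
  fix K0 K1 assume A: "closedin (top_of_set K) K0 \<and> closedin (top_of_set K) K1 \<and> disjnt K0 K1"
  have cK: "closed K" using K compact_imp_closed by blast
  have K0: "closed K0" "K0 \<subseteq> K" using A cK closedin_closed_trans closedin_imp_subset by blast+
  have K1: "compact K1" "K1 \<subseteq> K" using A K(1) closedin_compact closedin_imp_subset by blast+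
  define P where "P x f V \<longleftrightarrow> rational_limit K f \<and> open V \<and> x \<in> V \<and> (\<forall>z\<in>V. f z = 1) \<and> (\<forall>z. z \<notin> - K0 \<longrightarrow> f z = 0)"
    for x f V
  have "\<exists>f V. P x f V" if "x \<in> K1" for x
    unfolding P_def by (rule loc) (use that K1 K0 A in \<open>auto simp: disjnt_iff\<close>)
  then obtain f V where "\<And>x. x \<in> K1 \<Longrightarrow> P x (f x) (V x)" by metis
  then have fV: "\<And>x. x \<in> K1 \<Longrightarrow> rational_limit K (f x)" "\<And>x. x \<in> K1 \<Longrightarrow> open (V x)"
    "\<And>x. x \<in> K1 \<Longrightarrow> x \<in> V x" "\<And>x z. x \<in> K1 \<Longrightarrow> z \<in> V x \<Longrightarrow> f x z = 1" "\<And>x z. x \<in> K1 \<Longrightarrow> z \<in> K0 \<Longrightarrow> f x z = 0"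
    by (simp_all add: P_def)
  have "K1 \<subseteq> (\<Union>x\<in>K1. V x)" using fV(3) by blast
  then obtain C where C: "C \<subseteq> K1" "finite C" "K1 \<subseteq> (\<Union>x\<in>C. V x)"
    using compactE_image[OF K1(1), of K1 V] fV(2) by metis
  define h where "h z = 1 - (\<Prod>x\<in>C. 1 - f x z)" for z
  have "rational_limit K h" unfolding h_def
    by (intro rational_limit_one_minus rational_limit_prod K fV) (use C in auto)
  then have "restrict h K \<in> R_algebra K" by (intro restrict_in_R_algebra K)
  moreover have "restrict h K x = 1" if x: "x \<in> K1" for x
  proof -
    obtain y where "y \<in> C" "x \<in> V y" using C(3) x by blast
    then have "(\<Prod>x'\<in>C. 1 - f x' x) = 0" using C(1,2) fV(4)[of y x] by (intro prod_zero) auto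
    then show ?thesis using x K1 by (auto simp: h_def)
  qed
  moreover have "restrict h K x = 0" if x: "x \<in> K0" for x
  proof -
    have "(\<Prod>x'\<in>C. 1 - f x' x) = (\<Prod>x'\<in>C. 1)" by (rule prod.cong) (use fV(5) x C in auto)
    then show ?thesis using x K0 by (auto simp: h_def)
  qed
  ultimately show "\<exists>f\<in>R_algebra K. (\<forall>x\<in>K1. f x = 1) \<and> (\<forall>x\<in>K0. f x = 0)" by blast
qed

subsection \<open>The Swiss cheese\<close>

text \<open>The bound passes to the closed disc, whose point p nearest to 0 has modulus
  \<open>|a| - s\<close>. The hole weight needs this numerical form of the inclusion.\<close>

lemma ball_outside_ball_zero:
  assumes s: "0 < s" and d: "0 < d" and sub: "ball a s \<subseteq> {z::complex. d \<le> cmod z}"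
  shows "d \<le> cmod a - s"
proof -
  have "closure (ball a s) \<subseteq> {z. d \<le> cmod z}"
    by (rule closure_minimal[OF sub]) (intro closed_Collect_le continuous_intros)
  then have cb: "cball a s \<subseteq> {z. d \<le> cmod z}" using s by simp
  have as: "s < cmod a"
  proof (rule ccontr)
    assume "\<not> ?thesis"
    then have "0 \<in> cball a s" by simp
    from subsetD[OF cb this] show False using d by simp
  qed
  have a0: "a \<noteq> 0" using as s by auto
  define p where "p = of_real (1 - s / cmod a) * a"
  have "a - p = of_real (s / cmod a) * a" by (simp add: p_def algebra_simps)
  then have "cmod (a - p) = s" using s a0 by (simp add: norm_mult norm_divide)
  then have "d \<le> cmod p" using cb by (auto simp: dist_norm)
  also have "cmod p = (1 - s / cmod a) * cmod a"
  proof -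
    have "1 - s / cmod a \<ge> 0" using as s by (simp add: divide_le_eq)
    then show ?thesis unfolding p_def by (simp only: norm_mult norm_of_real abs_of_nonneg)
  qed
  also have "\<dots> = cmod a - s"
  proof -
    have "cmod a \<noteq> 0" using as s by linarith
    then show ?thesis by (simp add: left_diff_distrib)
  qed
  finally show ?thesis .
qed

text \<open>The annulus keeps a distance d > 0 from 0, so a hole in it weighs at most
  \<open>w\<close> times its radius, and total radius \<open>\<epsilon> / w\<close> suffices. The
  alternative on c says that 0 is either inside the inner circle or beyond the outer one.\<close>

lemma annular_function_avoiding_zero:
  fixes c :: complex
  assumes r: "0 < r" "r < R" and c: "cmod c < r \<or> R < cmod c" and \<epsilon>: "\<epsilon> > 0"
  obtains H f where "\<And>h. h \<in> H \<Longrightarrow> 0 < snd h \<and> snd h < cmod (fst h)"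
    "\<And>X. finite X \<Longrightarrow> X \<subseteq> H \<Longrightarrow> sum hole_weight X \<le> \<epsilon>" "rational_limit (- holes H) f"
    "\<And>z. cmod (z - c) \<le> r \<Longrightarrow> f z = 1" "\<And>z. R \<le> cmod (z - c) \<Longrightarrow> f z = 0"
proof -
  define d where "d = (if cmod c < r then r - cmod c else cmod c - R)"
  have d: "d > 0" using c by (auto simp: d_def)
  have dz: "d \<le> cmod z" if "r < cmod (z - c)" "cmod (z - c) < R" for z
    using that c norm_triangle_ineq4[of z c] norm_triangle_sub[of c z] by (auto simp: d_def norm_minus_commute)
  define w where "w = exp (1 / d) / d\<^sup>2"
  have w: "w > 0" using d by (simp add: w_def)
  obtain H f where Hf: "\<And>h. h \<in> H \<Longrightarrow> snd h > 0 \<and> hole h \<subseteq> {z. r < cmod (z - c) \<and> cmod (z - c) < R}"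
    "\<And>X. finite X \<Longrightarrow> X \<subseteq> H \<Longrightarrow> sum snd X \<le> \<epsilon> / w"
    "\<And>e. e > 0 \<Longrightarrow> \<exists>g. rational_on (- holes H) g \<and> (\<forall>z. z \<notin> holes H \<longrightarrow> cmod (f z - g z) \<le> e)"
    "\<And>z. cmod (z - c) \<le> r \<Longrightarrow> f z = 1" "\<And>z. R \<le> cmod (z - c) \<Longrightarrow> f z = 0"
  proof (rule annular_function[OF r, of "\<epsilon> / w" c])
    show "0 < \<epsilon> / w" using \<epsilon> w by simp
  qed blast
  have dh: "d \<le> cmod (fst h) - snd h" if "h \<in> H" for h
    by (rule ball_outside_ball_zero) (use Hf(1)[OF that] d dz in auto)
  show ?thesis
  proof (rule that[of H f])
    show "0 < snd h \<and> snd h < cmod (fst h)" if "h \<in> H" for h using Hf(1)[OF that] dh[OF that] d by linarith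
    show "sum hole_weight X \<le> \<epsilon>" if X: "finite X" "X \<subseteq> H" for X
    proof -
      have "hole_weight h \<le> snd h * w" if h: "h \<in> X" for h
      proof -
        have h': "d \<le> cmod (fst h) - snd h" "snd h > 0" using X h dh Hf(1) by blast+
        have "hole_weight h \<le> snd h / d\<^sup>2 * exp (1 / d)"
          unfolding hole_weight_def using h' d
          by (intro mult_mono divide_left_mono power_mono mult_pos_pos zero_less_power)
             (auto intro!: divide_left_mono mult_pos_pos divide_nonneg_nonneg)
        then show ?thesis by (simp add: w_def)
      qed
      then have "sum hole_weight X \<le> (\<Sum>h\<in>X. snd h * w)" by (rule sum_mono)
      also have "\<dots> = sum snd X * w" by (simp add: sum_distrib_right)
      also have "\<dots> \<le> \<epsilon> / w * w" using Hf(2)[OF X] w by (intro mult_right_mono) auto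
      finally show ?thesis using w by simp
    qed
    show "rational_limit (- holes H) f" unfolding rational_limit_def
    proof (intro allI impI)
      fix e :: real assume "e > 0"
      from Hf(3)[OF this] show "\<exists>g. rational_on (- holes H) g \<and> (\<forall>z\<in>- holes H. cmod (f z - g z) \<le> e)"
        by blast
    qed
  qed (use Hf in auto)
qed

lemma swiss_cheese_holes:
  obtains H where "\<And>h. h \<in> H \<Longrightarrow> 0 < snd h \<and> snd h < cmod (fst h)"
    "\<And>X. finite X \<Longrightarrow> X \<subseteq> H \<Longrightarrow> sum hole_weight X \<le> 1/8"
    "\<And>x U. open U \<Longrightarrow> x \<in> U \<Longrightarrow> \<exists>f V. rational_limit (- holes H) f \<and> open V \<and> x \<in> V \<and>
        (\<forall>z\<in>V. f z = 1) \<and> (\<forall>z. z \<notin> U \<longrightarrow> f z = 0)"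
proof -
  obtain D :: "(complex \<times> real \<times> real) set" where D: "countable D" "\<And>X. open X \<Longrightarrow> X \<noteq> {} \<Longrightarrow> \<exists>d\<in>D. d \<in> X"
    using countable_dense_exists by blast
  have "D \<noteq> {}" using D(2)[of UNIV] by auto
  define T where "T = from_nat_into D"
  have T: "range T = D" unfolding T_def by (rule range_from_nat_into) fact+
  define good where "good = (\<lambda>(c::complex, r, R). 0 < r \<and> r < R \<and> (cmod c < r \<or> R < cmod c))"
  \<comment> \<open>Triples of the dense set that describe no annulus avoiding 0 satisfy the last
    clause vacuously and receive no holes. The weights \<open>1/8 * (1/2) ^ Suc n\<close> add up to
    1/8.\<close>
  define spec where "spec n H f \<longleftrightarrow> (\<forall>h\<in>H. 0 < snd h \<and> snd h < cmod (fst h)) \<and>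
      (\<forall>X. finite X \<longrightarrow> X \<subseteq> H \<longrightarrow> sum hole_weight X \<le> 1/8 * (1/2) ^ Suc n) \<and>
      (\<forall>c r R. T n = (c, r, R) \<longrightarrow> good (c, r, R) \<longrightarrow> rational_limit (- holes H) f \<and>
        (\<forall>z. cmod (z - c) \<le> r \<longrightarrow> f z = 1) \<and> (\<forall>z. R \<le> cmod (z - c) \<longrightarrow> f z = 0))" for n H f
  have "\<exists>H f. spec n H f" for n
  proof -
    obtain c r R where t: "T n = (c, r, R)" using prod_cases3 by blast
    show ?thesis
    proof (cases "good (c, r, R)")
      case True
      then have g: "0 < r" "r < R" "cmod c < r \<or> R < cmod c" by (auto simp: good_def)
      have pos: "0 < 1/8 * (1/2::real) ^ Suc n" by simp
      obtain H f where "\<And>h. h \<in> H \<Longrightarrow> 0 < snd h \<and> snd h < cmod (fst h)"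
        "\<And>X. finite X \<Longrightarrow> X \<subseteq> H \<Longrightarrow> sum hole_weight X \<le> 1/8 * (1/2) ^ Suc n" "rational_limit (- holes H) f"
        "\<And>z. cmod (z - c) \<le> r \<Longrightarrow> f z = 1" "\<And>z. R \<le> cmod (z - c) \<Longrightarrow> f z = 0"
        by (rule annular_function_avoiding_zero[OF g pos]) blast
      then have "spec n H f" unfolding spec_def t by auto
      then show ?thesis by blast
    next
      case False
      then have "spec n {} f" for f unfolding spec_def t by auto
      then show ?thesis by blast
    qed
  qed
  then obtain Hs fs where sp: "\<And>n. spec n (Hs n) (fs n)" by metis
  have Hs: "0 < snd h \<and> snd h < cmod (fst h)" if "h \<in> Hs n" for n h
    using sp[of n, unfolded spec_def, THEN conjunct1] that by (rule bspec)
  have Hw: "sum hole_weight X \<le> 1/8 * (1/2) ^ Suc n" if "finite X" "X \<subseteq> Hs n" for n X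
    using sp[of n, unfolded spec_def, THEN conjunct2, THEN conjunct1] that by metis
  have Hf: "rational_limit (- holes (Hs n)) (fs n) \<and>
      (\<forall>z. cmod (z - c) \<le> r \<longrightarrow> fs n z = 1) \<and> (\<forall>z. R \<le> cmod (z - c) \<longrightarrow> fs n z = 0)"
    if "T n = (c, r, R)" "good (c, r, R)" for n c r R
    using sp[of n, unfolded spec_def, THEN conjunct2, THEN conjunct2] that by metis
  define H where "H = (\<Union>n. Hs n)"
  have partial: "sum hole_weight X \<le> 1/8 * (1 - (1/2) ^ N)" if "finite X" "X \<subseteq> (\<Union>n<N. Hs n)" for N X
    using that
  proof (induction N arbitrary: X)
    case (Suc N)
    have "sum hole_weight X = sum hole_weight (X - Hs N) + sum hole_weight (X \<inter> Hs N)"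
      using Suc.prems(1) by (metis add.commute sum.Int_Diff)
    also have "\<dots> \<le> 1/8 * (1 - (1/2) ^ N) + 1/8 * (1/2) ^ Suc N"
      by (intro add_mono Suc.IH Hw) (use Suc.prems in \<open>auto simp: lessThan_Suc\<close>)
    also have "\<dots> = 1/8 * (1 - (1/2) ^ Suc N)" by (simp add: field_simps)
    finally show ?case .
  qed auto
  show ?thesis
  proof (rule that[of H])
    show "0 < snd h \<and> snd h < cmod (fst h)" if "h \<in> H" for h using that Hs unfolding H_def by blast
    show "sum hole_weight X \<le> 1/8" if X: "finite X" "X \<subseteq> H" for X
    proof -
      obtain k where k: "\<And>x. x \<in> X \<Longrightarrow> x \<in> Hs (k x)" using X(2) unfolding H_def by (metis UN_iff subsetD)
      have "X \<subseteq> (\<Union>n<Suc (Max (k ` X)). Hs n)"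
        using k X(1) by (force simp: less_Suc_eq_le)
      then have "sum hole_weight X \<le> 1/8 * (1 - (1/2) ^ Suc (Max (k ` X)))" by (rule partial[OF X(1)])
      also have "\<dots> \<le> 1/8" by simp
      finally show ?thesis .
    qed
    fix x :: complex and U assume U: "open U" "x \<in> U"
    then obtain e0 where e0: "e0 > 0" "ball x e0 \<subseteq> U" using openE by blast
    \<comment> \<open>For x \<noteq> 0, \<open>e \<le> |x|\<close> forces
      \<open>|c| > 7/8 * e > R\<close>, so 0 is outside the annulus; for x = 0,
      \<open>|c| < e/8 < r\<close> puts 0 inside the inner circle.\<close>
    define e where "e = (if x = 0 then e0 else min e0 (cmod x))"
    have e: "e > 0" "ball x e \<subseteq> U" "x \<noteq> 0 \<Longrightarrow> e \<le> cmod x" using e0 by (auto simp: e_def)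
    \<comment> \<open>In this box \<open>|x - c| < e/8 < r\<close> keeps x in the inner disc, and
      \<open>|x - c| + R < e\<close> keeps the outer disc in U.\<close>
    have "open (ball x (e/8) \<times> {e/8<..<e/4} \<times> {e/4<..<e/2})"
      by (intro open_Times open_ball open_greaterThanLessThan)
    moreover have "(x, 3*e/16, 3*e/8) \<in> ball x (e/8) \<times> {e/8<..<e/4} \<times> {e/4<..<e/2}" using e by simp
    ultimately obtain t where t: "t \<in> D" "t \<in> ball x (e/8) \<times> {e/8<..<e/4} \<times> {e/4<..<e/2}"
      using D(2) by blast
    from t(1) have "t \<in> range T" by (simp only: T)
    then obtain n where n: "T n = t" by blast
    obtain c r R where crR: "t = (c, r, R)" using prod_cases3 by blast
    have xc: "cmod (x - c) < e/8" and r: "e/8 < r" "r < e/4" and R: "e/4 < R" "R < e/2"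
      using t(2) by (auto simp: crR dist_norm)
    have "cmod c < r \<or> R < cmod c"
    proof (cases "x = 0")
      case True then show ?thesis using xc r by simp
    next
      case False then show ?thesis using e(3) xc R norm_triangle_sub[of x c] e(1) by linarith
    qed
    then have "good (c, r, R)" unfolding good_def using r R e(1) by auto
    note f = Hf[OF n[unfolded crR] this]
    have "rational_limit (- holes H) (fs n)"
      by (rule rational_limit_subset[of "- holes (Hs n)"]) (use f in \<open>auto simp: H_def\<close>)
    moreover have "x \<in> ball c r" using xc r by (simp add: dist_norm norm_minus_commute)
    moreover have "\<forall>z\<in>ball c r. fs n z = 1" using f by (auto simp: dist_norm norm_minus_commute)
    moreover have "fs n z = 0" if "z \<notin> U" for z
    proof -
      have "e \<le> cmod (z - x)" using e(2) that by (force simp: dist_norm norm_minus_commute)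
      then have "R \<le> cmod (z - c)" using xc R norm_triangle_ineq[of "z - c" "c - x"]
        by (simp add: norm_minus_commute)
      then show ?thesis using f by blast
    qed
    ultimately show "\<exists>f V. rational_limit (- holes H) f \<and> open V \<and> x \<in> V \<and>
        (\<forall>z\<in>V. f z = 1) \<and> (\<forall>z. z \<notin> U \<longrightarrow> f z = 0)" by blast
  qed
qed

lemma R_algebra_example:
  obtains K where "compact K" "0 \<in> K" "normal_uniform_algebra (top_of_set K) (R_algebra K)"
    "peak_point (top_of_set K) (R_algebra K) 0" "\<not> strongly_regular_at (top_of_set K) (R_algebra K) 0"
proof -
  obtain H where H: "\<And>h. h \<in> H \<Longrightarrow> 0 < snd h \<and> snd h < cmod (fst h)"
    and W: "\<And>X. finite X \<Longrightarrow> X \<subseteq> H \<Longrightarrow> sum hole_weight X \<le> 1/8"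
    and loc: "\<And>x U. open U \<Longrightarrow> x \<in> U \<Longrightarrow> \<exists>f V. rational_limit (- holes H) f \<and> open V \<and> x \<in> V \<and>
        (\<forall>z\<in>V. f z = 1) \<and> (\<forall>z. z \<notin> U \<longrightarrow> f z = 0)"
    by (rule swiss_cheese_holes) blast
  define K where "K = cball (1/2) (1/2) - holes H"
  have K: "compact K" unfolding K_def by (intro compact_diff) auto
  have zero: "0 \<in> K" using H by (force simp: K_def)
  then have ne: "K \<noteq> {}" by blast
  note R = R_algebra_iff[OF K ne]
  have id: "restrict (\<lambda>z. z) K \<in> R_algebra K"
    by (intro restrict_in_R_algebra K ne rational_on_imp_rational_limit rational_on_ident)
  have "normal_on (top_of_set K) (R_algebra K)"
  proof (rule normal_on_R_algebra[OF K ne])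
    fix x :: complex and U assume U: "open U" "x \<in> U"
    from loc[OF U] obtain f V where "rational_limit (- holes H) f" "open V" "x \<in> V"
      "\<forall>z\<in>V. f z = 1" "\<forall>z. z \<notin> U \<longrightarrow> f z = 0" by blast
    moreover from this(1) have "rational_limit K f" by (rule rational_limit_subset) (auto simp: K_def)
    ultimately show "\<exists>f V. rational_limit K f \<and> open V \<and> x \<in> V \<and> (\<forall>z\<in>V. f z = 1) \<and> (\<forall>z. z \<notin> U \<longrightarrow> f z = 0)"
      by blast
  qed
  then have normal: "normal_uniform_algebra (top_of_set K) (R_algebra K)"
    unfolding normal_uniform_algebra_def using uniform_algebra_R_algebra[OF K ne] natural_R_algebra[OF K ne] by blast
  have peak: "peak_point (top_of_set K) (R_algebra K) 0"
    unfolding peak_point_def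
  proof (intro conjI bexI)
    show "restrict (\<lambda>z. 1 - z) K \<in> R_algebra K"
      by (intro restrict_in_R_algebra K ne rational_on_imp_rational_limit rational_on_diff rational_on_const rational_on_ident)
    show "\<forall>y\<in>topspace (top_of_set K) - {0}. cmod (restrict (\<lambda>z. 1 - z) K y) < 1"
    proof
      fix y assume y: "y \<in> topspace (top_of_set K) - {0}"
      then have "cmod (y - 1/2) \<le> 1/2" by (auto simp: K_def dist_norm norm_minus_commute)
      then have "(cmod (y - 1/2))\<^sup>2 \<le> (1/2)\<^sup>2" by (intro power_mono) auto
      \<comment> \<open>The disc is \<open>|y|^2 \<le> Re y\<close>, whence
        \<open>|1 - y|^2 = 1 - 2 * Re y + |y|^2 \<le> 1 - |y|^2\<close>.\<close>
      then have le: "(cmod y)\<^sup>2 \<le> Re y" unfolding cmod_power2 by (simp add: power2_eq_square algebra_simps)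
      have "(cmod y)\<^sup>2 > 0" using y by simp
      moreover have "(cmod (1 - y))\<^sup>2 = 1 - 2 * Re y + (cmod y)\<^sup>2"
        unfolding cmod_power2 by (simp add: power2_eq_square algebra_simps)
      ultimately have "(cmod (1 - y))\<^sup>2 < 1" using le by linarith
      then have "(cmod (1 - y))\<^sup>2 < 1\<^sup>2" by simp
      then have "cmod (1 - y) < 1" by (rule power_less_imp_less_base) simp
      then show "cmod (restrict (\<lambda>z. 1 - z) K y) < 1" using y by simp
    qed
  qed (use zero in auto)
  have "\<not> strongly_regular_at (top_of_set K) (R_algebra K) 0"
  proof
    assume sr: "strongly_regular_at (top_of_set K) (R_algebra K) 0"
    have "restrict (\<lambda>z. z) K \<in> ideal_M (R_algebra K) 0" using id zero by (simp add: ideal_M_def)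
    then have cl: "restrict (\<lambda>z. z) K \<in> sup_topology (top_of_set K) closure_of ideal_J (top_of_set K) (R_algebra K) 0"
      using sr by (simp add: strongly_regular_at_def)
    have sub: "ideal_J (top_of_set K) (R_algebra K) 0 \<subseteq> cont_space (top_of_set K)"
      using normal unfolding normal_uniform_algebra_def uniform_algebra_def ideal_J_def by blast
    have "\<forall>e>0. \<exists>g\<in>ideal_J (top_of_set K) (R_algebra K) 0. \<forall>z\<in>K. cmod (restrict (\<lambda>z. z) K z - g z) \<le> e"
      using cl unfolding sup_closure_iff[OF K ne sub] by blast
    \<comment> \<open>1/20 is the accuracy excluded by
      \<open>vanishing_near_zero_not_close_to_identity\<close>.\<close>
    then obtain g where g: "g \<in> ideal_J (top_of_set K) (R_algebra K) 0"
      "\<And>z. z \<in> K \<Longrightarrow> cmod (restrict (\<lambda>z. z) K z - g z) \<le> 1/20"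
      by (metis zero_less_divide_1_iff zero_less_numeral)
    from g(1) obtain U where U: "g \<in> R_algebra K" "openin (top_of_set K) U" "0 \<in> U" "\<And>y. y \<in> U \<Longrightarrow> g y = 0"
      unfolding ideal_J_def by blast
    then obtain S where S: "open S" "U = K \<inter> S" unfolding openin_open by blast
    then obtain \<delta> where \<delta>: "\<delta> > 0" "ball 0 \<delta> \<subseteq> S" using U(3) openE by blast
    show False
    proof (rule vanishing_near_zero_not_close_to_identity[where g = g and H = H and \<delta> = \<delta>, OF H W, folded K_def])
      show "\<exists>f. rational_on K f \<and> (\<forall>z\<in>K. cmod (g z - f z) \<le> e)" if "e > 0" for e
        using U(1) that unfolding R rational_limit_def by blast
      show "g z = 0" if "z \<in> K" "cmod z < \<delta>" for z
        by (rule U(4)) (use that \<delta>(2) in \<open>auto simp: S(2)\<close>)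
      show "cmod (g z - z) \<le> 1/20" if "z \<in> K" for z using g(2)[OF that] that by (simp add: norm_minus_commute)
    qed (use \<delta> in auto)
  qed
  then show ?thesis using that K zero normal peak by blast
qed

theorem theorem1p2:
  shows "(\<exists>(X :: complex topology) A x.
            compact_space X \<and> metrizable_space X \<and>
            normal_uniform_algebra X A \<and> x \<in> topspace X \<and>
            peak_point X A x \<and> \<not> strongly_regular_at X A x) \<and>
         (\<exists>(K :: complex set) x.
            compact K \<and>
            normal_uniform_algebra (top_of_set K) (R_algebra K) \<and> x \<in> K \<and>
            peak_point (top_of_set K) (R_algebra K) x \<and>
            \<not> strongly_regular_at (top_of_set K) (R_algebra K) x)"
proof -
  obtain K where K: "compact K" "0 \<in> K" "normal_uniform_algebra (top_of_set K) (R_algebra K)"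
    "peak_point (top_of_set K) (R_algebra K) 0" "\<not> strongly_regular_at (top_of_set K) (R_algebra K) 0"
    by (rule R_algebra_example) blast
  have "compact_space (top_of_set K)" using K(1) by (simp add: compact_space_subtopology)
  moreover have "metrizable_space (top_of_set K)"
    by (intro metrizable_space_subtopology metrizable_space_euclidean)
  ultimately show ?thesis using K by (metis topspace_euclidean_subtopology)
qed

end
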